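(* Let $\psi:\mathbb{C}\to\mathbb{C}$ be an entire holomorphic function that is not a polynomial, and let $\Gamma:=\{[1:z:\psi(z)]\in\mathbb{P}^2: z\in\mathbb{C}\}$. A set $E\subset\Gamma$ is a convergence set in $\mathbb{P}^2$ if and only if $E=\bigcup_{j=1}^{\infty}E_j$, where each $E_j$ is a compact and projectively convex subset of $\mathbb{P}^2$.
   Context: A formal power series $f\in\mathbb{C}[[z_0,z_1,z_2]]$ is convergent if it converges absolutely in a neighborhood of the origin in $\mathbb{C}^3$, and divergent otherwise. Let $\pi:\mathbb{C}^{3}\setminus\{0\}\to\mathbb{P}^2$ be the natural projection. $\mathrm{Conv}(f)$ is the set of $Z\in\mathbb{P}^2$ such that $f_z(t):=f(z_0t,z_1t,z_2t)$, as a power series in the one variable $t$, converges absolutely in some neighborhood of $0$ for some (equivalently, every) $z\in\pi^{-1}(Z)$. A set $E\subset\mathbb{P}^2$ is a convergence set in $\mathbb{P}^2$ if $E=\mathrm{Conv}(f)$ for some divergent $f\in\mathbb{C}[[z_0,z_1,z_2]]$. Let $\mathscr{H}_k(\mathbb{C}^3)$ be the space of homogeneous polynomials $p$ in $3$ complex variables with $p(\lambda z)=\lambda^kp(z)$ for all $\lambda\in\mathbb{C}$, $z\in\mathbb{C}^3$ (including the zero polynomial), and $\mathscr{H}(\mathbb{C}^3)=\bigcup_{k\ge0}\mathscr{H}_k(\mathbb{C}^3)$. For $p\in\mathscr{H}_k(\mathbb{C}^3)$ with $k\ge1$ and $Z=[z]\in\mathbb{P}^2$, put $\langle p(Z)\rangle:=|p(z)|^{1/k}/|z|$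 (independent of the representative $z$; $|z|$ is the Euclidean norm); for $p\in\mathscr{H}_0(\mathbb{C}^3)$ put $\langle p(Z)\rangle:=|p(Z)|$. For $K\subset\mathbb{P}^2$, $\langle p\rangle_K:=\sup_{Z\in K}\langle p(Z)\rangle$. The projective hull $\hat K$ of a compact set $K\subset\mathbb{P}^2$ is the set of all $Z\in\mathbb{P}^2$ for which there is a constant $C=C_Z>0$ with $\langle p(Z)\rangle\le C\langle p\rangle_K$ for all $p\in\mathscr{H}(\mathbb{C}^3)$. A compact set $K$ is projectively convex if $\hat K=K$. *)

theory Defs
  imports "HOL-Complex_Analysis.Complex_Analysis"
begin

subsection \<open>The complex projective plane\<close>

definition proj_rel :: "complex ^ 3 \<Rightarrow> complex ^ 3 \<Rightarrow> bool" where
  "proj_rel x y \<longleftrightarrow> x \<noteq> 0 \<and> y \<noteq> 0 \<and> (\<exists>c. c \<noteq> 0 \<and> y = c *s x)"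

lemma part_equivp_proj_rel: "part_equivp proj_rel"
proof (rule part_equivpI)
  have "(1 :: complex ^ 3) \<noteq> 0"
    by simp
  then have "proj_rel 1 1"
    unfolding proj_rel_def by (intro conjI exI[of _ 1]) auto
  then show "\<exists>x. proj_rel x x" ..
  show "symp proj_rel"
  proof (rule sympI)
    fix x y assume "proj_rel x y"
    then obtain c where c: "x \<noteq> 0" "y \<noteq> 0" "c \<noteq> 0" "y = c *s x"
      unfolding proj_rel_def by blast
    then have "x = inverse c *s y"
      by (simp add: vec_eq_iff field_simps)
    moreover have "inverse c \<noteq> 0"
      using c by simp
    ultimately show "proj_rel y x"
      using c(1,2) unfolding proj_rel_def by blast
  qed
  show "transp proj_rel"
  proof (rule transpI)
    fix x y z assume "proj_rel x y" "proj_rel y z"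
    then obtain c d where c: "x \<noteq> 0" "c \<noteq> 0" "y = c *s x" "z \<noteq> 0" "d \<noteq> 0" "z = d *s y"
      unfolding proj_rel_def by blast
    then have "z = (d * c) *s x"
      by (simp add: vec_eq_iff mult.assoc)
    moreover have "d * c \<noteq> 0"
      using c by simp
    ultimately show "proj_rel x z"
      using c(1,4) unfolding proj_rel_def by blast
  qed
qed

quotient_type cp2 = "complex ^ 3" / partial: proj_rel
  by (rule part_equivp_proj_rel)

text \<open>The natural projection; its value at \<open>0\<close> is junk and never used.\<close>

definition proj :: "complex ^ 3 \<Rightarrow> cp2" where
  "proj = abs_cp2"

lemma proj_eq_iff:
  assumes "x \<noteq> 0" "y \<noteq> 0"
  shows "proj x = proj y \<longleftrightarrow> (\<exists>c. c \<noteq> 0 \<and> y = c *s x)"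
proof -
  have refl: "proj_rel z z" if "z \<noteq> 0" for z
    using that unfolding proj_rel_def by (intro conjI exI[of _ 1]) auto
  show ?thesis
    using Quotient_rel[OF Quotient_cp2, of x y] refl assms
    by (auto simp: proj_def proj_rel_def)
qed

lemma rep_cp2_nonzero: "rep_cp2 Z \<noteq> 0"
  and proj_rep_cp2: "proj (rep_cp2 Z) = Z"
  using Quotient_rep_reflp[OF Quotient_cp2, of Z] Quotient_abs_rep[OF Quotient_cp2, of Z]
  by (auto simp: proj_rel_def proj_def)

text \<open>The quotient topology of \<open>\<complex>\<^sup>3 - {0}\<close>, which is open in \<open>\<complex>\<^sup>3\<close>.\<close>

instantiation cp2 :: topological_space
begin

definition open_cp2 :: "cp2 set \<Rightarrow> bool" where
  "open_cp2 U \<longleftrightarrow> open {z. z \<noteq> 0 \<and> proj z \<in> U}"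

instance
proof
  have "{z :: complex ^ 3. z \<noteq> 0 \<and> proj z \<in> UNIV} = - {0}"
    by auto
  then show "open (UNIV :: cp2 set)"
    unfolding open_cp2_def by (simp add: open_Compl)
next
  fix S T :: "cp2 set" assume "open S" "open T"
  moreover have "{z. z \<noteq> 0 \<and> proj z \<in> S \<inter> T} =
      {z. z \<noteq> 0 \<and> proj z \<in> S} \<inter> {z. z \<noteq> 0 \<and> proj z \<in> T}"
    by auto
  ultimately show "open (S \<inter> T)"
    unfolding open_cp2_def by (simp only: open_Int)
next
  fix K :: "cp2 set set" assume "\<forall>S\<in>K. open S"
  moreover have "{z. z \<noteq> 0 \<and> proj z \<in> \<Union>K} = (\<Union>S\<in>K. {z. z \<noteq> 0 \<and> proj z \<in> S})"
    by auto
  ultimately show "open (\<Union>K)"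
    unfolding open_cp2_def by (simp only: open_UN)
qed

end


subsection \<open>Power series in three variables\<close>

text \<open>
  Multi-indices are vectors in \<open>nat ^ 3\<close>. A formal power series \<open>\<Sum>\<^sub>\<alpha> f\<^sub>\<alpha> z\<^sup>\<alpha>\<close> is represented by its
  coefficient function. The index type \<open>3\<close> has the elements \<open>1, 2, 3 = 0\<close>; following the library
  function \<open>vector\<close>, the components \<open>1, 2, 3\<close> stand for the coordinates \<open>z\<^sub>0, z\<^sub>1, z\<^sub>2\<close>.
\<close>

type_synonym fps3 = "nat ^ 3 \<Rightarrow> complex"

definition mdeg :: "nat ^ 3 \<Rightarrow> nat" where
  "mdeg \<alpha> = (\<Sum>i\<in>UNIV. \<alpha> $ i)"

definition mono3 :: "complex ^ 3 \<Rightarrow> nat ^ 3 \<Rightarrow> complex" where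
  "mono3 z \<alpha> = (\<Prod>i\<in>UNIV. (z $ i) ^ (\<alpha> $ i))"

definition convergent3 :: "fps3 \<Rightarrow> bool" where
  "convergent3 f \<longleftrightarrow> (\<forall>\<^sub>F z in nhds 0. (\<lambda>\<alpha>. norm (f \<alpha> * mono3 z \<alpha>)) summable_on UNIV)"

lemma finite_mdeg: "finite {\<alpha>. mdeg \<alpha> = n}"
proof -
  have "\<alpha> \<in> vec_lambda ` (UNIV \<rightarrow>\<^sub>E {..n})" if "mdeg \<alpha> = n" for \<alpha>
  proof (rule image_eqI[of _ _ "vec_nth \<alpha>"])
    show "vec_nth \<alpha> \<in> UNIV \<rightarrow>\<^sub>E {..n}"
      using that member_le_sum[of _ UNIV "vec_nth \<alpha>"] by (auto simp: mdeg_def)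
  qed simp
  then have "{\<alpha>. mdeg \<alpha> = n} \<subseteq> vec_lambda ` (UNIV \<rightarrow>\<^sub>E {..n})"
    by blast
  then show ?thesis
    by (rule finite_subset) (simp add: finite_PiE)
qed

text \<open>The one-variable series \<open>f(z\<^sub>0 t, z\<^sub>1 t, z\<^sub>2 t)\<close>, with the terms collected by powers of \<open>t\<close>.\<close>

definition slice :: "fps3 \<Rightarrow> complex ^ 3 \<Rightarrow> complex fps" where
  "slice f z = Abs_fps (\<lambda>n. \<Sum>\<alpha> | mdeg \<alpha> = n. f \<alpha> * mono3 z \<alpha>)"

definition convergent1 :: "complex fps \<Rightarrow> bool" where
  "convergent1 F \<longleftrightarrow> (\<forall>\<^sub>F t in nhds 0. summable (\<lambda>n. norm (fps_nth F n * t ^ n)))"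

definition Conv :: "fps3 \<Rightarrow> cp2 set" where
  "Conv f = {Z. \<exists>z. z \<noteq> 0 \<and> proj z = Z \<and> convergent1 (slice f z)}"

lemma slice_scale: "fps_nth (slice f (c *s z)) n = c ^ n * fps_nth (slice f z) n"
proof -
  have "mono3 (c *s z) \<alpha> = c ^ mdeg \<alpha> * mono3 z \<alpha>" for \<alpha>
    by (simp add: mono3_def mdeg_def power_mult_distrib prod.distrib power_sum)
  then show ?thesis
    by (simp add: slice_def sum_distrib_left mult_ac)
qed

lemma Conv_all_representatives:
  "Conv f = {Z. \<forall>z. z \<noteq> 0 \<and> proj z = Z \<longrightarrow> convergent1 (slice f z)}"
proof -
  have *: "convergent1 (slice f w)"
    if zw: "z \<noteq> 0" "w \<noteq> 0" "proj z = proj w" and z: "convergent1 (slice f z)" for z w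
  proof -
    from zw obtain c where w: "w = c *s z"
      by (auto simp: proj_eq_iff)
    have "filterlim (\<lambda>t. c * t) (nhds 0) (nhds 0)"
      using tendsto_mult[OF tendsto_const[of c] filterlim_ident[of "nhds 0"]] by simp
    with z have "\<forall>\<^sub>F t in nhds 0. summable (\<lambda>n. norm (fps_nth (slice f z) n * (c * t) ^ n))"
      unfolding convergent1_def filterlim_iff by blast
    then show ?thesis
      by (simp add: convergent1_def w slice_scale power_mult_distrib mult_ac)
  qed
  show ?thesis
    using * rep_cp2_nonzero proj_rep_cp2 unfolding Conv_def by blast
qed

definition convergence_set :: "cp2 set \<Rightarrow> bool" where
  "convergence_set E \<longleftrightarrow> (\<exists>f. \<not> convergent3 f \<and> E = Conv f)"


subsection \<open>Homogeneous polynomials and projective hulls\<close>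

definition polyfun3 :: "(complex ^ 3 \<Rightarrow> complex) \<Rightarrow> bool" where
  "polyfun3 p \<longleftrightarrow> (\<exists>A c. finite A \<and> (\<forall>z. p z = (\<Sum>\<alpha>\<in>A. c \<alpha> * mono3 z \<alpha>)))"

definition hompoly :: "nat \<Rightarrow> (complex ^ 3 \<Rightarrow> complex) set" where
  "hompoly k = {p. polyfun3 p \<and> (\<forall>c z. p (c *s z) = c ^ k * p z)}"

text \<open>
  The degree is passed explicitly; it is determined by \<open>p\<close> unless \<open>p = 0\<close>, and in that case
  the value is \<open>0\<close> for every \<open>k\<close>.
\<close>

definition pabs :: "nat \<Rightarrow> (complex ^ 3 \<Rightarrow> complex) \<Rightarrow> cp2 \<Rightarrow> real" where
  "pabs k p Z = (let z = rep_cp2 Z in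
     if k = 0 then norm (p z) else root k (norm (p z)) / norm z)"

lemma norm_scale_vec: "norm (c *s z) = norm c * norm (z :: complex ^ 'n)"
  by (simp add: norm_vec_def norm_mult L2_set_right_distrib)

lemma pabs_proj:
  assumes "p \<in> hompoly k" "z \<noteq> 0"
  shows "pabs k p (proj z) = (if k = 0 then norm (p z) else root k (norm (p z)) / norm z)"
proof -
  obtain c where c: "c \<noteq> 0" "rep_cp2 (proj z) = c *s z"
    using proj_eq_iff[of z "rep_cp2 (proj z)"] rep_cp2_nonzero proj_rep_cp2 assms(2) by auto
  have "p (c *s z) = c ^ k * p z"
    using assms(1) by (simp add: hompoly_def)
  then show ?thesis
    using c by (simp add: pabs_def norm_scale_vec norm_mult norm_power real_root_mult
        real_root_power_cancel)
qed

text \<open>The supremum is taken in \<open>[0, \<infinity>]\<close>, so that it is \<open>0\<close> over the empty set.\<close>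

definition pabs_sup :: "nat \<Rightarrow> (complex ^ 3 \<Rightarrow> complex) \<Rightarrow> cp2 set \<Rightarrow> ennreal" where
  "pabs_sup k p K = (SUP Z\<in>K. ennreal (pabs k p Z))"

definition projective_hull :: "cp2 set \<Rightarrow> cp2 set" where
  "projective_hull K = {Z. \<exists>C>0. \<forall>k. \<forall>p\<in>hompoly k.
     ennreal (pabs k p Z) \<le> ennreal C * pabs_sup k p K}"

definition projectively_convex :: "cp2 set \<Rightarrow> bool" where
  "projectively_convex K \<longleftrightarrow> projective_hull K = K"

end

theory Submission
  imports "Jordan_Normal_Form.Determinant" "HOL-Real_Asymp.Real_Asymp" Defs
begin

text \<open>
Write \<open>\<Gamma>\<close> for the graph and \<open>\<gamma> z = (1, z, \<psi> z)\<close>. The heart of the matter is the identity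
\<open>projective_hull_graph\<close>: the projective hull of \<open>\<gamma> ` K\<close>, for \<open>K\<close> a compact subset of \<open>\<complex>\<close>, is
\<open>\<gamma> ` fill K\<close>, where \<open>fill K\<close> is \<open>K\<close> with its holes filled in. Holes belong to the hull by the
maximum principle. The work is to show that no other point of the plane does.

Suppose first that \<open>a\<close> lies in the unbounded component of the complement of \<open>K\<close> and that
\<open>|p (\<gamma> a)| \<le> C\<^sup>k sup\<^sub>K |p|\<close> for all forms \<open>p\<close> of degree \<open>k\<close> (predicate \<open>hull_bound\<close>). In each degree
\<open>m\<close> the evaluation at \<open>\<gamma> a\<close> is then represented by a measure \<open>\<mu>\<close> on finitely many points of \<open>K\<close> with
total mass at most a polynomial in \<open>m\<close> times \<open>C\<^sup>m\<close>. Let \<open>F = p \<circ> \<gamma>\<close> with \<open>|F| \<le> 1\<close> on \<open>K\<close>. The difference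
quotient \<open>(F \<zeta>\<^sup>N - F z\<^sup>N) / (\<zeta> - z)\<close> is, as a function of \<open>z\<close> on the graph, a polynomial of degree
about \<open>2Nk\<close> up to a negligible error, because the Taylor polynomials of an entire function converge
faster than any geometric sequence. Testing the measure on it shows that
\<open>\<Psi> \<zeta> = 1 - (\<zeta> - a) \<Sum> \<mu>\<^sub>j / (\<zeta> - x\<^sub>j)\<close> and \<open>\<Psi> F\<^sup>N\<close> are both bounded by about \<open>C\<^sup>m\<close> on a disc around
\<open>a\<close> that avoids \<open>K\<close>, and \<open>\<Psi> a = 1\<close>. If a quotient of two bounded functions has no poles and a
denominator of modulus at least \<open>1\<close> at the centre, then it is bounded on the half disc (Blaschke product
and Harnack inequality), hence \<open>|F| \<le> C\<^sup>6\<^sup>k\<close> there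
(\<open>hull_bound_nearby\<close>). So the points with a hull bound form a closed and open subset of the unbounded
component, and if there is one then a common constant works on a whole circle around \<open>K\<close>. But the
polynomials of degree \<open>2h\<close> in \<open>z\<close> and \<open>\<psi> z\<close> include one, not identically zero since \<open>\<psi>\<close> is
transcendental, that vanishes at \<open>0\<close> to order \<open>h\<^sup>2\<close>; by the Schwarz lemma it grows by a factor
\<open>2\<close> to the power \<open>h\<^sup>2\<close> between two circles, and no \<open>C\<^sup>2\<^sup>h\<close> can dominate this. Points off the
graph are excluded with the Taylor polynomials of \<open>\<psi>\<close>, and points at infinity by a contour integral of
the Cauchy transform of \<open>\<mu>\<close>, which is tiny on a large circle.

If \<open>E = Conv f\<close>, the sets \<open>E\<^sub>j\<close> of points whose unit vectors satisfy \<open>|f\<^sub>n| \<le> j\<^sup>n\<close> for the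
homogeneous parts \<open>f\<^sub>n\<close>, \<open>n \<ge> 1\<close>, are compact with union \<open>E\<close>, and their hulls stay in \<open>E\<close>. By the identity these hulls are compact and projectively convex.

Conversely let \<open>E\<close> be the union of the \<open>\<gamma> ` L\<^sub>i\<close> with \<open>L\<^sub>i\<close> compact and equal to \<open>fill L\<^sub>i\<close>. One
cuts the \<open>L\<^sub>i\<close> into mutually disjoint compact shells and takes for \<open>K\<^sub>t\<close> the union of finitely many
shells, increasing in \<open>t\<close>. By Janiszewski's theorem the holes of \<open>K\<^sub>t\<close> are filled within the \<open>L\<^sub>i\<close>, and
the distances between shells force every point that is in none of the \<open>L\<^sub>i\<close> to keep a distance of at least
\<open>\<epsilon>\<^sub>t\<close> from \<open>fill K\<^sub>t\<close> for infinitely many \<open>t\<close>, where \<open>\<epsilon>\<^sub>t\<close> depends on \<open>t\<close> alone and tends to zero.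
Hence every point of the plane outside \<open>E\<close> avoids infinitely many of the \<open>\<epsilon>\<^sub>t\<close>-neighbourhoods of the
\<open>\<gamma> ` fill K\<^sub>t\<close>. By the identity and compactness there are, for each \<open>t\<close>, finitely many forms that are at
most \<open>1\<close> on \<open>\<gamma> ` K\<^sub>t\<close>, and of which one exceeds \<open>t\<^sup>k\<close>, where \<open>k\<close> is its degree, at each unit vector off the
\<open>t\<close>-th neighbourhood. Powers of all these forms, in distinct degrees, are the homogeneous parts of the desired
series.
\<close>

text \<open>
The symbol \<open>$\<close> is kept for the components of vectors in \<open>\<complex>\<^sup>3\<close> and multi-indices.
\<close>

no_notation Matrix.vec_index (infixl "$" 100)
no_notation fps_nth (infixl "$" 75)

section \<open>Representing functionals by point evaluations\<close>

definition sample_mat :: "('i \<Rightarrow> 'a \<Rightarrow> complex) \<Rightarrow> nat \<Rightarrow> (nat \<Rightarrow> 'i) \<Rightarrow> (nat \<Rightarrow> 'a) \<Rightarrow> complex mat" where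
  "sample_mat g d s x = Matrix.mat d d (\<lambda>(i, j). g (s i) (x j))"

lemma sample_mat_carrier [simp]: "sample_mat g d s x \<in> carrier_mat d d"
  by (simp add: sample_mat_def)

lemma sample_mat_index [simp]: "i < d \<Longrightarrow> j < d \<Longrightarrow> sample_mat g d s x $$ (i, j) = g (s i) (x j)"
  by (simp add: sample_mat_def)

lemma cofactor_sample_mat_upd:
  "j < d \<Longrightarrow> cofactor (sample_mat g d s (x(j := z))) i j = cofactor (sample_mat g d s x) i j"
  unfolding Determinant.cofactor_def mat_delete_def sample_mat_def
  by (intro arg_cong2[where f="(*)"] refl arg_cong[where f=Determinant.det] eq_matI) auto

text \<open>
Seen as a function of one sample point, the determinant lies in the span of the \<open>g (s i)\<close>, with
coefficients that depend on the other points only.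
\<close>

lemma det_sample_mat_upd:
  assumes "j < d"
  shows "Determinant.det (sample_mat g d s (x(j := z))) =
    (\<Sum>i<d. g (s i) z * cofactor (sample_mat g d s x) i j)"
  using assms by (subst laplace_expansion_column[of _ d j]) (auto simp: cofactor_sample_mat_upd)

lemma norm_det_sample_mat_le:
  assumes "\<And>i j. i < d \<Longrightarrow> j < d \<Longrightarrow> norm (g (s i) (x j)) \<le> B"
  shows "norm (Determinant.det (sample_mat g d s x)) \<le> fact d * B ^ d"
proof -
  have "norm (Determinant.det (sample_mat g d s x)) \<le>
      (\<Sum>p\<in>{p. p permutes {0..<d}}. norm (signof p * (\<Prod>i = 0..<d. sample_mat g d s x $$ (i, p i))))"
    by (subst Determinant.det_def'[of _ d]) (auto intro: sum_norm_le)
  also have "\<dots> \<le> (\<Sum>p\<in>{p. p permutes {0..<d}}. B ^ d)"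
  proof (rule sum_mono)
    fix p assume "p \<in> {p. p permutes {0..<d}}"
    then have p: "p permutes {0..<d}" by simp
    then have lt: "p i < d" if "i < d" for i
      using that permutes_in_image[OF p, of i] by auto
    have "norm (signof p * (\<Prod>i = 0..<d. sample_mat g d s x $$ (i, p i)) :: complex) =
        (\<Prod>i = 0..<d. norm (g (s i) (x (p i))))"
      using lt by (auto simp: norm_mult sign_def prod_norm[symmetric] intro!: prod.cong)
    also have "\<dots> \<le> (\<Prod>i = 0..<d. B)"
      using lt assms by (intro prod_mono) auto
    finally show "norm (signof p * (\<Prod>i = 0..<d. sample_mat g d s x $$ (i, p i)) :: complex) \<le> B ^ d"
      by simp
  qed
  also have "\<dots> = fact d * B ^ d"
    by (simp add: card_permutations[of "{0..<d}" d])
  finally show ?thesis .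
qed

text \<open>
Think of \<open>h\<close> as a linear functional on the span of the \<open>g i\<close> that is bounded by \<open>R\<close> for the supremum
norm on \<open>K\<close>. For continuous functions on a compact set the theorems of Hahn-Banach and Riesz give a
representing measure of mass at most \<open>R\<close>. Here a factor of twice the dimension is lost, which is harmless against exponentials, and the measure is
explicit: its points almost maximise a determinant of largest possible size (Fekete points), so that
the Lagrange functions at these points are bounded by \<open>2\<close> on \<open>K\<close>, and the weights are the values of
the functional at the Lagrange functions. Maximality of the size makes interpolation at these points
exact on \<open>K\<close> for the whole span, even if the \<open>g i\<close> are linearly dependent on \<open>K\<close>.
\<close>

lemma finite_dimensional_duality:
  fixes g :: "'i \<Rightarrow> 'a \<Rightarrow> complex" and h :: "'i \<Rightarrow> complex"
  assumes fin: "finite I"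
    and bdd: "\<And>i x. i \<in> I \<Longrightarrow> x \<in> K \<Longrightarrow> norm (g i x) \<le> B"
    and R: "\<And>c. (\<And>x. x \<in> K \<Longrightarrow> norm (\<Sum>i\<in>I. c i * g i x) \<le> 1) \<Longrightarrow> norm (\<Sum>i\<in>I. c i * h i) \<le> R"
  obtains d x \<mu> where "d \<le> card I" "\<And>j. j < d \<Longrightarrow> x j \<in> K" "\<And>j. j < d \<Longrightarrow> norm (\<mu> j) \<le> 2 * R"
    "\<And>i. i \<in> I \<Longrightarrow> h i = (\<Sum>j<d. \<mu> j * g i (x j))"
proof -
  have R': "norm (\<Sum>i<n. \<kappa> i * h (s i)) \<le> R"
    if s: "\<And>i. i < n \<Longrightarrow> s i \<in> I" and le: "\<And>x. x \<in> K \<Longrightarrow> norm (\<Sum>i<n. \<kappa> i * g (s i) x) \<le> 1"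
    for n :: nat and s \<kappa>
  proof -
    define c where "c i = (\<Sum>i'<n. if s i' = i then \<kappa> i' else 0)" for i
    have eq: "(\<Sum>i\<in>I. c i * f i) = (\<Sum>i<n. \<kappa> i * f (s i))" for f
    proof -
      have "(\<Sum>i\<in>I. c i * f i) = (\<Sum>i'<n. \<Sum>i\<in>I. if s i' = i then \<kappa> i' * f i else 0)"
        unfolding c_def sum_distrib_right by (subst sum.swap) (intro sum.cong refl, auto)
      also have "\<dots> = (\<Sum>i<n. \<kappa> i * f (s i))"
        using fin s by (intro sum.cong refl) (auto simp: sum.delta')
      finally show ?thesis .
    qed
    show ?thesis using R[of c] le by (simp add: eq)
  qed
  have vanish: "(\<Sum>i<n. \<kappa> i * h (s i)) = 0"
    if s: "\<And>i. i < n \<Longrightarrow> s i \<in> I" and 0: "\<And>x. x \<in> K \<Longrightarrow> (\<Sum>i<n. \<kappa> i * g (s i) x) = 0"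
    for n :: nat and s \<kappa>
  proof (rule ccontr)
    let ?w = "\<Sum>i<n. \<kappa> i * h (s i)"
    assume "?w \<noteq> 0"
    define t where "t = (\<bar>R\<bar> + 1) / norm ?w"
    have "norm (\<Sum>i<n. (of_real t * \<kappa> i) * h (s i)) \<le> R"
      by (rule R') (use s 0 in \<open>auto simp: mult.assoc sum_distrib_left[symmetric]\<close>)
    also have "(\<Sum>i<n. (of_real t * \<kappa> i) * h (s i)) = of_real t * ?w"
      by (simp add: mult.assoc sum_distrib_left)
    finally have "norm (of_real t * ?w) \<le> R" .
    moreover have "norm (of_real t * ?w) = \<bar>R\<bar> + 1"
      using \<open>?w \<noteq> 0\<close> unfolding norm_mult norm_of_real t_def by simp
    ultimately show False by simp
  qed
  define good where "good d \<longleftrightarrow> (\<exists>s x. (\<forall>i<d. s i \<in> I) \<and> (\<forall>j<d. x j \<in> K) \<and>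
      Determinant.det (sample_mat g d s x) \<noteq> 0)" for d
  have good0: "good 0"
    by (auto simp: good_def sample_mat_def)
  have good_le: "d \<le> card I" if gd: "good d" for d
  proof -
    obtain s x where s: "\<forall>i<d. s i \<in> I" and D: "Determinant.det (sample_mat g d s x) \<noteq> 0"
      using gd unfolding good_def by blast
    have "inj_on s {..<d}"
    proof (rule inj_onI, rule ccontr)
      fix i j assume ij: "i \<in> {..<d}" "j \<in> {..<d}" "s i = s j" "i \<noteq> j"
      have "Determinant.det (sample_mat g d s x) = 0"
        by (rule Determinant.det_identical_rows[OF sample_mat_carrier, of i j]) (use ij in \<open>auto simp: sample_mat_def\<close>)
      with D show False by simp
    qed
    moreover have "s ` {..<d} \<subseteq> I" using s by auto
    ultimately show ?thesis
      using card_inj_on_le[of s "{..<d}" I] fin by simp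
  qed
  \<comment> \<open>The numerical rank of the functions \<open>g i\<close> on \<open>K\<close>.\<close>
  define d where "d = (GREATEST d. good d)"
  have d: "good d"
    unfolding d_def using good0 good_le by (rule GreatestI_nat)
  have d_max: "n \<le> d" if "good n" for n
    unfolding d_def using that good_le by (rule Greatest_le_nat)
  obtain s x0 where s: "\<And>i. i < d \<Longrightarrow> s i \<in> I" and x0: "\<And>j. j < d \<Longrightarrow> x0 j \<in> K"
    and D0: "Determinant.det (sample_mat g d s x0) \<noteq> 0"
    using d unfolding good_def by blast
  define V where "V x = norm (Determinant.det (sample_mat g d s x))" for x
  define S where "S = (SUP x\<in>{x. \<forall>j<d. x j \<in> K}. V x)"
  have bdd_above: "bdd_above (V ` {x. \<forall>j<d. x j \<in> K})"
    by (rule bdd_aboveI2[where M="fact d * B ^ d"])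
      (use bdd s in \<open>auto simp: V_def intro!: norm_det_sample_mat_le\<close>)
  have V_le: "V x \<le> S" if "\<And>j. j < d \<Longrightarrow> x j \<in> K" for x
    unfolding S_def using that by (intro cSUP_upper bdd_above) auto
  have "0 < V x0" using D0 by (simp add: V_def)
  also have "V x0 \<le> S" using V_le x0 by blast
  finally have "0 < S" .
  then have "S / 2 < S" by simp
  then obtain x where x: "\<And>j. j < d \<Longrightarrow> x j \<in> K" and Vx: "S / 2 < V x"
    unfolding S_def using x0 less_cSUP_iff[OF _ bdd_above] by blast
  define D where "D = Determinant.det (sample_mat g d s x)"
  have D: "D \<noteq> 0" using Vx \<open>0 < S\<close> by (auto simp: V_def D_def)
  define C where "C i j = cofactor (sample_mat g d s x) i j / D" for i j
  define \<mu> where "\<mu> j = (\<Sum>i<d. C i j * h (s i))" for j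
  have \<mu>: "norm (\<mu> j) \<le> 2 * R" if j: "j < d" for j
  proof -
    \<comment> \<open>The sum with \<open>g (s i)\<close> in place of \<open>h (s i)\<close> is half the \<open>j\<close>-th Lagrange function, so it is at most \<open>1\<close> on \<open>K\<close>.\<close>
    have "norm (\<Sum>i<d. (C i j / 2) * h (s i)) \<le> R"
    proof (rule R'[OF s])
      fix z assume z: "z \<in> K"
      have "(\<Sum>i<d. (C i j / 2) * g (s i) z) = Determinant.det (sample_mat g d s (x(j := z))) / D / 2"
        using j by (simp add: det_sample_mat_upd C_def sum_divide_distrib mult_ac)
      then have "norm (\<Sum>i<d. (C i j / 2) * g (s i) z) = V (x(j := z)) / V x / 2"
        by (simp only: norm_divide V_def D_def) simp
      also have "\<dots> \<le> 1"
      proof -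
        have "V (x(j := z)) \<le> S" using V_le x z by simp
        then show ?thesis using Vx \<open>0 < S\<close> by (simp add: divide_simps)
      qed
      finally show "norm (\<Sum>i<d. (C i j / 2) * g (s i) z) \<le> 1" .
    qed auto
    moreover have "(\<Sum>i<d. (C i j / 2) * h (s i)) = \<mu> j / 2"
      by (simp add: \<mu>_def sum_divide_distrib)
    ultimately have "norm (\<mu> j / 2) \<le> R" by (simp only:)
    then show ?thesis by (simp add: norm_divide)
  qed
  have orth: "(\<Sum>j<d. g (s i') (x j) * C i j) = (if i = i' then 1 else 0)" if "i < d" "i' < d" for i i'
  proof -
    let ?A = "sample_mat g d s x"
    have "(?A * adj_mat ?A) $$ (i', i) = (D \<cdot>\<^sub>m 1\<^sub>m d) $$ (i', i)"
      using adj_mat(2)[of ?A d] by (simp add: D_def)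
    moreover have "(?A * adj_mat ?A) $$ (i', i) = (\<Sum>j<d. g (s i') (x j) * cofactor ?A i j)"
      using that by (simp add: adj_mat_def times_mat_def scalar_prod_def sample_mat_def lessThan_atLeast0)
    ultimately show ?thesis
      using that D by (auto simp: C_def sum_divide_distrib[symmetric])
  qed
  have hs: "h (s i) = (\<Sum>j<d. \<mu> j * g (s i) (x j))" if i: "i < d" for i
  proof -
    have "(\<Sum>j<d. \<mu> j * g (s i) (x j)) = (\<Sum>i'<d. h (s i') * (\<Sum>j<d. g (s i) (x j) * C i' j))"
      unfolding \<mu>_def sum_distrib_right sum_distrib_left by (subst sum.swap) (simp add: mult_ac)
    also have "\<dots> = (\<Sum>i'<d. if i' = i then h (s i') else 0)"
      using i by (intro sum.cong) (auto simp: orth)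
    finally show ?thesis using i by simp
  qed
  have "h a = (\<Sum>j<d. \<mu> j * g a (x j))" if a: "a \<in> I" for a
  proof -
    define s' where "s' = s(d := a)"
    have s': "s' i \<in> I" if "i < Suc d" for i using that a s by (auto simp: s'_def less_Suc_eq)
    have det0: "Determinant.det (sample_mat g (Suc d) s' (x(d := z))) = 0" if z: "z \<in> K" for z
    proof (rule ccontr)
      assume "Determinant.det (sample_mat g (Suc d) s' (x(d := z))) \<noteq> 0"
      then have "good (Suc d)"
        unfolding good_def using s' x z by (intro exI[of _ s'] exI[of _ "x(d := z)"]) auto
      then show False using d_max[of "Suc d"] by simp
    qed
    \<comment> \<open>The vanishing bordered determinants express \<open>g a\<close> on \<open>K\<close> by the \<open>g (s i)\<close>, with coefficients independent of the point.\<close>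
    define k where "k i = cofactor (sample_mat g (Suc d) s' x) i d" for i
    have sum0: "(\<Sum>i<Suc d. k i * g (s' i) z) = 0" if "z \<in> K" for z
      using det0[OF that] by (subst (asm) det_sample_mat_upd) (auto simp: k_def mult_ac)
    have kd: "k d = D"
    proof -
      have "mat_delete (sample_mat g (Suc d) s' x) d d = sample_mat g d s x"
        unfolding mat_delete_def sample_mat_def by (rule eq_matI) (auto simp: s'_def)
      then show ?thesis by (simp add: k_def Determinant.cofactor_def D_def power_add[symmetric] mult_2[symmetric])
    qed
    have "(\<Sum>i<Suc d. k i * h (s' i)) = 0"
      using vanish[OF s' sum0] by blast
    then have 1: "D * h a + (\<Sum>i<d. k i * h (s i)) = 0"
      by (simp add: kd s'_def add.commute)
    have 2: "D * g a z + (\<Sum>i<d. k i * g (s i) z) = 0" if "z \<in> K" for z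
      using sum0[OF that] by (simp add: kd s'_def add.commute)
    have "D * (\<Sum>j<d. \<mu> j * g a (x j)) = (\<Sum>j<d. \<mu> j * (- (\<Sum>i<d. k i * g (s i) (x j))))"
      unfolding sum_distrib_left
    proof (rule sum.cong)
      fix j assume "j \<in> {..<d}"
      then have "D * g a (x j) = - (\<Sum>i<d. k i * g (s i) (x j))"
        using 2[of "x j"] x by (simp add: eq_neg_iff_add_eq_0)
      then show "D * (\<mu> j * g a (x j)) = \<mu> j * (- (\<Sum>i<d. k i * g (s i) (x j)))"
        by (metis mult.left_commute)
    qed simp
    also have "\<dots> = - (\<Sum>i<d. k i * (\<Sum>j<d. \<mu> j * g (s i) (x j)))"
      unfolding sum_distrib_left sum_negf[symmetric] by (subst sum.swap) (simp add: mult_ac)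
    also have "\<dots> = - (\<Sum>i<d. k i * h (s i))"
      by (intro arg_cong[where f=uminus] sum.cong) (auto simp: hs)
    also have "\<dots> = D * h a" using 1 by (metis add_eq_0_iff2)
    finally show ?thesis using D by simp
  qed
  then show thesis
    using good_le[OF d] x \<mu> that by blast
qed

section \<open>Quotients of bounded holomorphic functions\<close>

lemma holomorphic_factor_finite_zeros:
  assumes "finite Z" "Z \<subseteq> S" "open S" "connected S" "f holomorphic_on S" "\<exists>z\<in>S. f z \<noteq> 0"
  shows "\<exists>ws g. set ws \<subseteq> Z \<and> g holomorphic_on S \<and> (\<forall>z\<in>S. f z = (\<Prod>w\<leftarrow>ws. z - w) * g z) \<and>
    (\<forall>z\<in>Z. g z \<noteq> 0)"
  using assms(1,2)
proof (induction Z)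
  case empty
  show ?case
    by (rule exI[of _ "[]"], rule exI[of _ f]) (use assms(5) in auto)
next
  case (insert w Z)
  then obtain ws g where ws: "set ws \<subseteq> Z" and g: "g holomorphic_on S"
    and fg: "\<forall>z\<in>S. f z = (\<Prod>w\<leftarrow>ws. z - w) * g z" and gZ: "\<forall>z\<in>Z. g z \<noteq> 0"
    by auto
  have wS: "w \<in> S" using insert by auto
  show ?case
  proof (cases "g w = 0")
    case False
    then show ?thesis using ws g fg gZ by (intro exI[of _ ws] exI[of _ g]) auto
  next
    case True
    obtain z0 where z0: "z0 \<in> S" "g z0 \<noteq> 0" using assms(6) fg by fastforce
    then have "\<not> g constant_on S" using True wS by (metis constant_on_def)
    then obtain h r n where r: "0 < r" "ball w r \<subseteq> S" and h: "h holomorphic_on ball w r"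
      and gh: "\<And>u. u \<in> ball w r \<Longrightarrow> g u = (u - w) ^ n * h u" and h0: "\<And>u. u \<in> ball w r \<Longrightarrow> h u \<noteq> 0"
      using holomorphic_factor_zero_nonconstant[OF g assms(3,4) wS True] by metis
    define k where "k u = (if u = w then h w else g u / (u - w) ^ n)" for u
    have kh: "k u = h u" if "u \<in> ball w r" for u
      using that gh by (auto simp: k_def)
    have "k holomorphic_on ball w r"
      using h by (rule holomorphic_transform) (simp add: kh)
    moreover have "k holomorphic_on S - {w}"
      by (rule holomorphic_transform[of "\<lambda>u. g u / (u - w) ^ n"])
        (auto simp: k_def intro!: holomorphic_intros holomorphic_on_subset[OF g])
    ultimately have "k holomorphic_on ball w r \<union> (S - {w})"
      using assms(3) by (intro holomorphic_on_Un) auto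
    moreover have "ball w r \<union> (S - {w}) = S" using r wS by auto
    ultimately have k: "k holomorphic_on S" by simp
    have gk: "g u = (u - w) ^ n * k u" if "u \<in> S" for u
    proof (cases "u = w")
      case True
      then show ?thesis using gh[of w] r by (simp add: k_def)
    qed (simp add: k_def)
    have "k z \<noteq> 0" if "z \<in> Z" for z
      using gk[of z] gZ insert.prems that by fastforce
    then have "\<forall>z\<in>insert w Z. k z \<noteq> 0"
      using kh[of w] h0[of w] r by auto
    moreover have "\<forall>z\<in>S. f z = (\<Prod>w\<leftarrow>replicate n w @ ws. z - w) * k z"
      using fg gk by (simp add: mult_ac)
    moreover have "set (replicate n w @ ws) \<subseteq> insert w Z"
      using ws by auto
    ultimately show ?thesis
      using k by blast
  qed
qed

text \<open>
The factor \<open>r (z - w) / (r\<^sup>2 - cnj (w - a) (z - a))\<close> of a Blaschke product for the disc of radius \<open>r\<close>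
around \<open>a\<close> is unimodular on the boundary circle.
\<close>

lemma norm_blaschke_numerator_on_sphere:
  fixes a w z :: complex
  assumes "norm (z - a) = r"
  shows "norm (of_real (r\<^sup>2) - cnj (w - a) * (z - a)) = r * norm (z - w)"
proof -
  have "of_real (r\<^sup>2) = (z - a) * cnj (z - a)"
    using complex_norm_square[of "z - a"] assms by simp
  then have "of_real (r\<^sup>2) - cnj (w - a) * (z - a) = (z - a) * cnj (z - w)"
    by (simp add: algebra_simps)
  then show ?thesis using assms by (simp only: norm_mult complex_mod_cnj)
qed

text \<open>
With \<open>g = exp L\<close> the function \<open>M - Re L\<close>, for \<open>M = ln A\<close>, is positive harmonic and at most \<open>M\<close> at the
centre, so on the half disc it is at most \<open>3 M\<close>. The proof maps the half plane \<open>Re L < M\<close> to the unit disc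
and applies the Schwarz lemma, with an arbitrary \<open>B > A\<close> in place of \<open>A\<close> to have strict inequalities.
\<close>

lemma harnack_zero_free:
  fixes g :: "complex \<Rightarrow> complex"
  assumes r: "0 < r" and g: "g holomorphic_on ball a r" and nz: "\<And>z. z \<in> ball a r \<Longrightarrow> g z \<noteq> 0"
    and le: "\<And>z. z \<in> ball a r \<Longrightarrow> norm (g z) \<le> A" and ga: "1 \<le> norm (g a)"
    and z: "norm (z - a) \<le> r / 2"
  shows "1 \<le> A ^ 2 * norm (g z)"
proof -
  have A: "1 \<le> A" using le[of a] ga r by simp
  have aB: "a \<in> ball a r" using r by simp
  obtain L where L: "L holomorphic_on ball a r" and expL: "\<And>z. z \<in> ball a r \<Longrightarrow> exp (L z) = g z"
    using holomorphic_logarithm_exists[OF convex_ball open_ball g nz aB] by metis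
  have key: "1 \<le> B ^ 2 * norm (g z)" if B: "A < B" for B
  proof -
    define M where "M = ln B"
    have "0 < B" using A B by simp
    have reL: "Re (L u) < M" if "u \<in> ball a r" for u
    proof -
      have "exp (Re (L u)) < exp M"
        using le[OF that] B \<open>0 < B\<close> expL[OF that, symmetric] by (simp add: norm_exp_eq_Re M_def)
      then show ?thesis by simp
    qed
    define u0 where "u0 = Re (L a)"
    have u0: "0 \<le> u0" "u0 < M"
      using ga expL[OF aB, symmetric] reL[OF aB] by (simp_all add: u0_def norm_exp_eq_Re)
    define D where "D u = L (a + of_real r * u) - L a" for u
    \<comment> \<open>The Moebius map sends the half plane \<open>Re w < M - u0\<close> to the unit disc and \<open>0\<close> to \<open>0\<close>.\<close>
    define \<phi> where "\<phi> u = D u / (of_real (2 * (M - u0)) - D u)" for u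
    have inB: "a + of_real r * u \<in> ball a r" if "norm u < 1" for u
      using that r by (simp add: dist_norm norm_mult)
    have reD: "Re (D u) < M - u0" if "norm u < 1" for u
      using reL[OF inB[OF that]] by (simp add: D_def u0_def)
    have den: "of_real (2 * (M - u0)) - D u \<noteq> 0" if "norm u < 1" for u
    proof
      assume "of_real (2 * (M - u0)) - D u = 0"
      then have "Re (of_real (2 * (M - u0)) - D u) = 0" by simp
      then show False using reD[OF that] u0 by simp
    qed
    have Dhol: "D holomorphic_on ball 0 1"
      unfolding D_def by (intro holomorphic_intros holomorphic_on_compose_gen[OF _ L, unfolded o_def])
        (use inB in \<open>auto simp: dist_norm\<close>)
    have \<phi>hol: "\<phi> holomorphic_on ball 0 1"
      unfolding \<phi>_def using Dhol den by (intro holomorphic_intros) auto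
    have \<phi>1: "norm (\<phi> u) < 1" if "norm u < 1" for u
    proof -
      have "norm (D u) ^ 2 < norm (of_real (2 * (M - u0)) - D u) ^ 2"
      proof -
        have "norm (of_real (2 * (M - u0)) - D u) ^ 2 - norm (D u) ^ 2 = 4 * (M - u0) * (M - u0 - Re (D u))"
          unfolding cmod_power2 by (simp add: power2_eq_square algebra_simps)
        moreover have "0 < 4 * (M - u0) * (M - u0 - Re (D u))"
          using reD[OF that] u0 by simp
        ultimately show ?thesis by simp
      qed
      then have "norm (D u) < norm (of_real (2 * (M - u0)) - D u)"
        by (simp add: power_less_imp_less_base)
      then show ?thesis
        using den[OF that] by (simp add: \<phi>_def norm_divide)
    qed
    define u where "u = (z - a) / of_real r"
    have u: "norm u \<le> 1 / 2" "norm u < 1" and zu: "z = a + of_real r * u"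
      using z r by (auto simp: u_def norm_divide)
    have "norm (\<phi> u) \<le> norm u"
      by (rule Schwarz_Lemma(1)[OF \<phi>hol _ \<phi>1 u(2)]) (simp_all add: \<phi>_def D_def)
    then have "norm (\<phi> u) \<le> 1 / 2" using u by simp
    then have "2 * norm (D u) \<le> norm (of_real (2 * (M - u0)) - D u)"
      using den[OF u(2)] by (simp add: \<phi>_def norm_divide divide_simps)
    also have "\<dots> \<le> 2 * (M - u0) + norm (D u)"
      using norm_triangle_ineq4[of "of_real (2 * (M - u0))" "D u"] u0
      by (simp only: norm_of_real) simp
    finally have "norm (D u) \<le> 2 * (M - u0)" by simp
    then have "- (2 * (M - u0)) \<le> Re (D u)"
      using abs_Re_le_cmod[of "D u"] by linarith
    then have "0 \<le> 2 * M + Re (L z)"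
      using u0 by (simp add: D_def zu[symmetric] u0_def)
    then have "1 \<le> exp (2 * M + Re (L z))" by simp
    also have "\<dots> = B ^ 2 * norm (g z)"
    proof -
      have "z \<in> ball a r" using inB[OF u(2)] zu by simp
      then have "norm (g z) = exp (Re (L z))"
        using expL by (metis norm_exp_eq_Re)
      moreover have "exp (2 * M) = B ^ 2"
        using \<open>0 < B\<close> by (simp add: M_def exp_double)
      ultimately show ?thesis by (simp add: exp_add)
    qed
    finally show ?thesis .
  qed
  show ?thesis
  proof (rule tendsto_lowerbound[of "\<lambda>B. B ^ 2 * norm (g z)" _ "at_right A"])
    show "((\<lambda>B. B\<^sup>2 * norm (g z)) \<longlongrightarrow> A\<^sup>2 * norm (g z)) (at_right A)"
      by (intro tendsto_intros)
    show "\<forall>\<^sub>F B in at_right A. 1 \<le> B\<^sup>2 * norm (g z)"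
      using key eventually_at_right_less[of A] by (auto elim: eventually_mono)
  qed simp
qed

text \<open>
If \<open>\<Psi>\<close> had no zeros in the disc, Harnack's inequality would bound it from below. In general the zeros of
\<open>\<Psi>\<close> are divided out by a Blaschke product: this keeps the values on the circle in modulus, it can only
increase the modulus at the centre, and \<open>\<Psi> F\<close> remains holomorphic because \<open>F\<close> is.
\<close>

lemma bounded_quotient_on_half_disc:
  fixes F \<Psi> :: "complex \<Rightarrow> complex"
  assumes S: "open S" "connected S" "cball a r \<subseteq> S" and r: "0 < r"
    and \<Psi>: "\<Psi> holomorphic_on S" and F: "F holomorphic_on S"
    and \<Psi>a: "1 \<le> norm (\<Psi> a)"
    and \<Psi>A: "\<And>z. norm (z - a) = r \<Longrightarrow> norm (\<Psi> z) \<le> A"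
    and \<Psi>FA: "\<And>z. norm (z - a) = r \<Longrightarrow> norm (\<Psi> z * F z) \<le> A"
    and z: "norm (z - a) \<le> r / 2"
  shows "norm (F z) \<le> A ^ 3"
proof -
  have aS: "a \<in> S" using S r by auto
  define Z where "Z = {z \<in> cball a r. \<Psi> z = 0} \<inter> ball a r"
  have Zfin: "finite Z"
  proof (cases "\<Psi> constant_on S")
    case True
    then obtain c where "\<And>u. u \<in> S \<Longrightarrow> \<Psi> u = c" by (auto simp: constant_on_def)
    then have "\<Psi> u = \<Psi> a" if "u \<in> S" for u using aS that by simp
    then have "\<Psi> u \<noteq> 0" if "u \<in> cball a r" for u using \<Psi>a S(3) that by force
    then have "Z = {}" by (auto simp: Z_def)
    then show ?thesis by simp
  next
    case False
    then have "finite {z \<in> cball a r. \<Psi> z = 0}"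
      using holomorphic_compact_finite_zeros[OF \<Psi> S(1,2) _ S(3)] by auto
    then show ?thesis unfolding Z_def by blast
  qed
  have "\<exists>z\<in>S. \<Psi> z \<noteq> 0" using aS \<Psi>a by force
  moreover have "Z \<subseteq> S" using S(3) by (auto simp: Z_def)
  ultimately obtain ws g where ws: "set ws \<subseteq> Z" and g: "g holomorphic_on S"
    and \<Psi>g: "\<And>z. z \<in> S \<Longrightarrow> \<Psi> z = (\<Prod>w\<leftarrow>ws. z - w) * g z" and gZ: "\<And>z. z \<in> Z \<Longrightarrow> g z \<noteq> 0"
    using holomorphic_factor_finite_zeros[OF Zfin _ S(1,2) \<Psi>] by metis
  define N where "N z = (\<Prod>w\<leftarrow>ws. (of_real (r\<^sup>2) - cnj (w - a) * (z - a)) / of_real r)" for z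
  define G where "G z = N z * g z" for z
  have Nhol: "N holomorphic_on X" for X
  proof -
    have "(\<lambda>z. \<Prod>w\<leftarrow>vs. (of_real (r\<^sup>2) - cnj (w - a) * (z - a)) / of_real r) holomorphic_on X" for vs
      by (induction vs) (use r in \<open>auto intro!: holomorphic_intros\<close>)
    then show ?thesis by (simp add: N_def[abs_def])
  qed
  have Ghol: "G holomorphic_on S"
    unfolding G_def by (intro holomorphic_intros Nhol g)
  have inS: "z \<in> S" if "norm (z - a) \<le> r" for z
    using that S(3) by (auto simp: dist_norm norm_minus_commute)
  have wsD: "norm (w - a) < r" if "w \<in> set ws" for w
    using that ws by (auto simp: Z_def dist_norm norm_minus_commute)
  have G_sphere: "norm (G z) = norm (\<Psi> z)" if "norm (z - a) = r" for z
  proof -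
    have "norm (\<Prod>w\<leftarrow>vs. (of_real (r\<^sup>2) - cnj (w - a) * (z - a)) / of_real r) = norm (\<Prod>w\<leftarrow>vs. z - w)" for vs
      using r norm_blaschke_numerator_on_sphere[OF that]
      by (induction vs) (auto simp: norm_mult norm_divide)
    then show ?thesis
      using \<Psi>g[of z] inS that by (simp add: G_def N_def norm_mult)
  qed
  have factor_nz: "of_real (r\<^sup>2) - cnj (w - a) * (z - a) \<noteq> 0"
    if "w \<in> set ws" "norm (z - a) \<le> r" for w z
  proof
    assume "of_real (r\<^sup>2) - cnj (w - a) * (z - a) = 0"
    then have "norm (complex_of_real (r\<^sup>2)) = norm (cnj (w - a) * (z - a))" by simp
    then have "r\<^sup>2 = norm (w - a) * norm (z - a)"
      by (simp only: norm_of_real norm_mult complex_mod_cnj) (simp add: abs_of_pos)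
    also have "\<dots> \<le> norm (w - a) * r" using that(2) by (intro mult_left_mono) auto
    also have "\<dots> < r * r" using wsD[OF that(1)] r by simp
    finally show False by (simp add: power2_eq_square)
  qed
  have N_nz: "N z \<noteq> 0" if "norm (z - a) \<le> r" for z
    using factor_nz[OF _ that] r by (auto simp: N_def prod_list_zero_iff)
  have G_nz: "G z \<noteq> 0" if "z \<in> ball a r" for z
  proof -
    have zr: "norm (z - a) < r" using that by (simp add: dist_norm norm_minus_commute)
    have "g z \<noteq> 0"
    proof (cases "z \<in> Z")
      case False
      then have "\<Psi> z \<noteq> 0" using that by (auto simp: Z_def)
      then show ?thesis using \<Psi>g[of z] inS zr by auto
    qed (use gZ in auto)
    then show ?thesis using N_nz zr by (simp add: G_def)
  qed
  have max_mod: "norm (H z) \<le> A" if "H holomorphic_on S" "\<And>z. norm (z - a) = r \<Longrightarrow> norm (H z) \<le> A"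
    "norm (z - a) \<le> r" for H z
  proof (rule maximum_modulus_frontier[of H "cball a r"])
    show "H holomorphic_on interior (cball a r)"
      by (rule holomorphic_on_subset[OF that(1)]) (use S(3) in auto)
    show "continuous_on (closure (cball a r)) H"
      using that(1) S(3) by (auto intro: holomorphic_on_imp_continuous_on continuous_on_subset)
    show "norm (H z) \<le> A" if "z \<in> frontier (cball a r)" for z
      using that \<open>\<And>z. norm (z - a) = r \<Longrightarrow> norm (H z) \<le> A\<close> r
      by (auto simp: frontier_cball dist_norm norm_minus_commute)
  qed (use that in \<open>auto simp: dist_norm norm_minus_commute\<close>)
  have GA: "norm (G z) \<le> A" if "norm (z - a) \<le> r" for z
    by (rule max_mod[OF Ghol _ that]) (simp add: G_sphere \<Psi>A)
  have GFA: "norm (G z * F z) \<le> A" if "norm (z - a) \<le> r" for z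
    by (rule max_mod[OF _ _ that]) (use \<Psi>FA in \<open>auto simp: norm_mult G_sphere intro!: holomorphic_intros Ghol F\<close>)
  have Ga: "1 \<le> norm (G a)"
  proof -
    have "norm (\<Prod>w\<leftarrow>vs. a - w) \<le> norm (\<Prod>w\<leftarrow>vs. of_real (r\<^sup>2) / of_real r :: complex)" if "set vs \<subseteq> set ws" for vs
      using that
    proof (induction vs)
      case (Cons v vs)
      have "norm (a - v) \<le> r" using wsD[of v] Cons.prems by (simp add: norm_minus_commute)
      moreover have "norm (of_real (r\<^sup>2) / of_real r :: complex) = r"
        using r by (simp only: norm_divide norm_of_real) (simp add: power2_eq_square)
      ultimately have "norm (a - v) \<le> norm (of_real (r\<^sup>2) / of_real r :: complex)" by simp
      then show ?case
        using Cons by (auto simp only: list.map prod_list.Cons norm_mult set_simps intro!: mult_mono) auto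
    qed auto
    from this[of ws] have "norm (\<Psi> a) \<le> norm (G a)"
      using \<Psi>g[OF aS] by (simp add: G_def N_def norm_mult mult_right_mono)
    then show ?thesis using \<Psi>a by simp
  qed
  have zr: "norm (z - a) \<le> r" using z r by simp
  have 1: "1 \<le> A\<^sup>2 * norm (G z)"
  proof (rule harnack_zero_free[where g = G and a = a, OF r _ _ _ Ga z])
    show "G holomorphic_on ball a r"
      by (rule holomorphic_on_subset[OF Ghol]) (use S(3) in auto)
  qed (use GA G_nz in \<open>auto simp: dist_norm norm_minus_commute\<close>)
  then have "norm (F z) \<le> (A\<^sup>2 * norm (G z)) * norm (F z)"
    using mult_right_mono[OF 1, of "norm (F z)"] by simp
  also have "\<dots> = A\<^sup>2 * norm (G z * F z)" by (simp add: norm_mult)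
  also have "\<dots> \<le> A\<^sup>2 * A" using GFA[OF zr] by (intro mult_left_mono) auto
  finally show ?thesis by (simp add: power3_eq_cube power2_eq_square)
qed

section \<open>Homogeneous polynomials and their restrictions to a graph\<close>

lemma mono3_add: "mono3 z (\<alpha> + \<beta>) = mono3 z \<alpha> * mono3 z \<beta>"
  by (simp add: mono3_def power_add prod.distrib)

lemma mono3_scale: "mono3 (c *s z) \<alpha> = c ^ mdeg \<alpha> * mono3 z \<alpha>"
  by (simp add: mono3_def mdeg_def power_mult_distrib prod.distrib power_sum)

lemma polyfun3_mono3: "polyfun3 (\<lambda>z. c * mono3 z \<alpha>)"
  unfolding polyfun3_def by (rule exI[of _ "{\<alpha>}"], rule exI[of _ "\<lambda>_. c"]) simp

lemma polyfun3_add: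
  assumes "polyfun3 p" "polyfun3 q" shows "polyfun3 (\<lambda>z. p z + q z)"
proof -
  obtain A c B d where *: "finite A" "\<And>z. p z = (\<Sum>\<alpha>\<in>A. c \<alpha> * mono3 z \<alpha>)"
      "finite B" "\<And>z. q z = (\<Sum>\<alpha>\<in>B. d \<alpha> * mono3 z \<alpha>)"
    using assms unfolding polyfun3_def by blast
  have "p z + q z = (\<Sum>\<alpha>\<in>A \<union> B. ((if \<alpha> \<in> A then c \<alpha> else 0) + (if \<alpha> \<in> B then d \<alpha> else 0)) * mono3 z \<alpha>)" for z
  proof -
    have "p z = (\<Sum>\<alpha>\<in>A \<union> B. (if \<alpha> \<in> A then c \<alpha> else 0) * mono3 z \<alpha>)"
      unfolding *(2) by (rule sum.mono_neutral_cong_left) (use *(1,3) in \<open>simp_all split: if_splits\<close>)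
    moreover have "q z = (\<Sum>\<alpha>\<in>A \<union> B. (if \<alpha> \<in> B then d \<alpha> else 0) * mono3 z \<alpha>)"
      unfolding *(4) by (rule sum.mono_neutral_cong_left) (use *(1,3) in \<open>simp_all split: if_splits\<close>)
    ultimately show ?thesis by (simp add: sum.distrib distrib_right)
  qed
  then show ?thesis
    unfolding polyfun3_def using *(1,3)
    by (intro exI[of _ "A \<union> B"] exI[of _ "\<lambda>\<alpha>. (if \<alpha> \<in> A then c \<alpha> else 0) + (if \<alpha> \<in> B then d \<alpha> else 0)"]) simp
qed

lemma polyfun3_sum:
  assumes "\<And>i. i \<in> I \<Longrightarrow> polyfun3 (f i)" shows "polyfun3 (\<lambda>z. \<Sum>i\<in>I. f i z)"
  using assms
proof (induction I rule: infinite_finite_induct)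
  case (insert x F)
  then show ?case using polyfun3_add[of "f x" "\<lambda>z. \<Sum>i\<in>F. f i z"] by simp
qed (use polyfun3_mono3[of 0 0] in simp_all)

lemma polyfun3_mult:
  assumes "polyfun3 p" "polyfun3 q" shows "polyfun3 (\<lambda>z. p z * q z)"
proof -
  obtain A c B d where *: "finite A" "\<And>z. p z = (\<Sum>\<alpha>\<in>A. c \<alpha> * mono3 z \<alpha>)"
      "finite B" "\<And>z. q z = (\<Sum>\<alpha>\<in>B. d \<alpha> * mono3 z \<alpha>)"
    using assms unfolding polyfun3_def by blast
  have "p z * q z = (\<Sum>\<alpha>\<in>A. \<Sum>\<beta>\<in>B. (c \<alpha> * d \<beta>) * mono3 z (\<alpha> + \<beta>))" for z
    unfolding *(2,4) by (simp add: sum_product mono3_add mult_ac)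
  moreover have "polyfun3 (\<lambda>z. \<Sum>\<alpha>\<in>A. \<Sum>\<beta>\<in>B. (c \<alpha> * d \<beta>) * mono3 z (\<alpha> + \<beta>))"
    by (intro polyfun3_sum polyfun3_mono3)
  ultimately show ?thesis by simp
qed

lemma hompoly_mono3: "(\<lambda>z. c * mono3 z \<alpha>) \<in> hompoly (mdeg \<alpha>)"
  by (simp add: hompoly_def polyfun3_mono3 mono3_scale)

lemma hompoly_0: "(\<lambda>z. 0) \<in> hompoly k"
  using polyfun3_mono3[of 0 0] by (simp add: hompoly_def)

lemma hompoly_add: "p \<in> hompoly k \<Longrightarrow> q \<in> hompoly k \<Longrightarrow> (\<lambda>z. p z + q z) \<in> hompoly k"
  by (simp add: hompoly_def polyfun3_add distrib_left)

lemma hompoly_mult: "p \<in> hompoly k \<Longrightarrow> q \<in> hompoly m \<Longrightarrow> (\<lambda>z. p z * q z) \<in> hompoly (k + m)"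
  by (simp add: hompoly_def polyfun3_mult power_add mult_ac)

lemma hompoly_sum: "(\<And>i. i \<in> I \<Longrightarrow> f i \<in> hompoly k) \<Longrightarrow> (\<lambda>z. \<Sum>i\<in>I. f i z) \<in> hompoly k"
  by (simp add: hompoly_def polyfun3_sum sum_distrib_left)

lemma hompoly_const: "(\<lambda>z. c) \<in> hompoly 0"
proof -
  have "mdeg 0 = 0" "mono3 z 0 = 1" for z by (simp_all add: mdeg_def mono3_def)
  then show ?thesis using hompoly_mono3[of c 0] by simp
qed

lemma hompoly_cmult: "p \<in> hompoly k \<Longrightarrow> (\<lambda>z. c * p z) \<in> hompoly k"
  using hompoly_mult[OF hompoly_const[of c], of p k] by simp

lemma hompoly_power: "p \<in> hompoly k \<Longrightarrow> (\<lambda>z. p z ^ n) \<in> hompoly (n * k)"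
proof (induction n)
  case 0
  then show ?case using hompoly_const[of 1] by simp
next
  case (Suc n)
  then show ?case using hompoly_mult[OF Suc.prems Suc.IH[OF Suc.prems]] by simp
qed

lemma hompoly_coord: "(\<lambda>z. z $ i) \<in> hompoly 1"
proof -
  have "mdeg (axis i 1) = 1"
    by (simp add: mdeg_def axis_def)
  moreover have "mono3 z (axis i 1) = z $ i" for z
  proof -
    have "mono3 z (axis i 1) = (\<Prod>j\<in>UNIV. if j = i then z $ j else 1)"
      unfolding mono3_def axis_def by (intro prod.cong) auto
    then show ?thesis by simp
  qed
  ultimately show ?thesis using hompoly_mono3[of 1 "axis i 1"] by simp
qed

lemma hompoly_scale: "p \<in> hompoly k \<Longrightarrow> p (c *s z) = c ^ k * p z"
  by (simp add: hompoly_def)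

text \<open>
The definition allows monomials of any degree. Comparing the coefficients of \<open>t\<^sup>k\<close> in
\<open>p (t z) = t\<^sup>k p z\<close> shows that those of degree \<open>k\<close> suffice.
\<close>

lemma hompoly_expand:
  assumes "p \<in> hompoly k"
  obtains c where "\<And>z. p z = (\<Sum>\<alpha> | mdeg \<alpha> = k. c \<alpha> * mono3 z \<alpha>)"
proof -
  obtain A c where A: "finite A" and p: "\<And>z. p z = (\<Sum>\<alpha>\<in>A. c \<alpha> * mono3 z \<alpha>)"
    using assms unfolding hompoly_def polyfun3_def by blast
  define c' where "c' \<alpha> = (if \<alpha> \<in> A then c \<alpha> else 0)" for \<alpha>
  have "p z = (\<Sum>\<alpha> | mdeg \<alpha> = k. c' \<alpha> * mono3 z \<alpha>)" for z
  proof -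
    define a where "a n = (\<Sum>\<alpha> | \<alpha> \<in> A \<and> mdeg \<alpha> = n. c \<alpha> * mono3 z \<alpha>)" for n
    define N where "N = Max (insert k (mdeg ` A))"
    have N: "k \<le> N" "\<And>\<alpha>. \<alpha> \<in> A \<Longrightarrow> mdeg \<alpha> \<le> N" using A by (auto simp: N_def)
    have "(\<Sum>n\<le>N. a n * t ^ n) = (\<Sum>n\<le>N. (if n = k then p z else 0) * t ^ n)" for t
    proof -
      have "(\<Sum>n\<le>N. a n * t ^ n) = (\<Sum>n\<le>N. \<Sum>\<alpha> | \<alpha> \<in> A \<and> mdeg \<alpha> = n. c \<alpha> * mono3 (t *s z) \<alpha>)"
        unfolding a_def by (intro sum.cong refl) (auto simp: sum_distrib_left mono3_scale mult_ac intro!: sum.cong)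
      also have "\<dots> = (\<Sum>\<alpha>\<in>A. c \<alpha> * mono3 (t *s z) \<alpha>)"
        using A N by (intro sum.group) auto
      also have "\<dots> = t ^ k * p z"
        using assms by (simp add: p[symmetric] hompoly_scale)
      also have "\<dots> = (\<Sum>n\<le>N. if n = k then p z * t ^ n else 0)"
        using N by simp
      also have "\<dots> = (\<Sum>n\<le>N. (if n = k then p z else 0) * t ^ n)"
        by (intro sum.cong) auto
      finally show ?thesis .
    qed
    then have "a k = p z"
      using polyfun_eq_coeffs[of a N "\<lambda>n. if n = k then p z else 0"] N by simp
    then have "p z = (\<Sum>\<alpha> | \<alpha> \<in> A \<and> mdeg \<alpha> = k. c \<alpha> * mono3 z \<alpha>)"
      by (simp add: a_def)
    also have "\<dots> = (\<Sum>\<alpha> | mdeg \<alpha> = k. c' \<alpha> * mono3 z \<alpha>)"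
      unfolding c'_def by (rule sum.mono_neutral_cong_left[OF finite_mdeg]) auto
    finally show ?thesis .
  qed
  then show ?thesis using that by blast
qed

lemma hompoly_collect: "(\<lambda>z. \<Sum>\<alpha> | mdeg \<alpha> = k. c \<alpha> * mono3 z \<alpha>) \<in> hompoly k"
  using hompoly_mono3 by (intro hompoly_sum) fastforce

lemma card_mdeg_le: "card {\<alpha>. mdeg \<alpha> = n} \<le> (n + 1) ^ 3"
proof -
  have "card {\<alpha>. mdeg \<alpha> = n} \<le> card ({..n} \<times> {..n} \<times> {..n})"
  proof (rule card_inj_on_le[where f = "\<lambda>\<alpha>. (\<alpha> $ 1, \<alpha> $ 2, \<alpha> $ 3)"])
    show "inj_on (\<lambda>\<alpha>. (\<alpha> $ 1, \<alpha> $ 2, \<alpha> $ 3)) {\<alpha>. mdeg \<alpha> = n}"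
      by (auto simp: inj_on_def vec_eq_iff forall_3)
    show "(\<lambda>\<alpha>. (\<alpha> $ 1, \<alpha> $ 2, \<alpha> $ 3)) ` {\<alpha>. mdeg \<alpha> = n} \<subseteq> {..n} \<times> {..n} \<times> {..n}"
      by (auto simp: mdeg_def sum_3)
  qed auto
  then show ?thesis by (simp add: power3_eq_cube algebra_simps)
qed

lemma continuous_on_hompoly: "p \<in> hompoly k \<Longrightarrow> continuous_on S p"
proof -
  assume "p \<in> hompoly k"
  then obtain A c where p: "p = (\<lambda>z. \<Sum>\<alpha>\<in>A. c \<alpha> * mono3 z \<alpha>)"
    unfolding hompoly_def polyfun3_def by blast
  show ?thesis unfolding p mono3_def by (intro continuous_intros)
qed

definition graph_point :: "(complex \<Rightarrow> complex) \<Rightarrow> complex \<Rightarrow> complex ^ 3" where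
  "graph_point \<psi> z = vector [1, z, \<psi> z]"

lemma graph_point_nth [simp]:
  "graph_point \<psi> z $ 1 = 1" "graph_point \<psi> z $ 2 = z" "graph_point \<psi> z $ 3 = \<psi> z"
  by (simp_all add: graph_point_def)

lemma graph_point_nonzero [simp]: "graph_point \<psi> z \<noteq> 0"
  by (metis graph_point_nth(1) zero_index zero_neq_one)

lemma prod_UNIV_3: "prod f (UNIV :: 3 set) = f 1 * f 2 * f 3"
  unfolding UNIV_3 by (simp add: mult_ac)

lemma mono3_graph_point: "mono3 (graph_point \<psi> z) \<alpha> = z ^ (\<alpha> $ 2) * \<psi> z ^ (\<alpha> $ 3)"
  unfolding mono3_def prod_UNIV_3 by simp

text \<open>
In the affine coordinate \<open>z\<close> of the graph these are the polynomials of degree at most \<open>k\<close> in \<open>z\<close> and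
\<open>\<psi> z\<close>. Since the first coordinate is \<open>1\<close>, a smaller degree can be padded.
\<close>

definition curve_polys :: "(complex \<Rightarrow> complex) \<Rightarrow> nat \<Rightarrow> (complex \<Rightarrow> complex) set" where
  "curve_polys \<psi> k = (\<lambda>p z. p (graph_point \<psi> z)) ` hompoly k"

lemma curve_polysI: "p \<in> hompoly k \<Longrightarrow> (\<lambda>z. p (graph_point \<psi> z)) \<in> curve_polys \<psi> k"
  by (auto simp: curve_polys_def)

lemma curve_polysE:
  assumes "F \<in> curve_polys \<psi> k"
  obtains p where "p \<in> hompoly k" "F = (\<lambda>z. p (graph_point \<psi> z))"
  using assms by (auto simp: curve_polys_def)

lemma curve_polys_add: "F \<in> curve_polys \<psi> k \<Longrightarrow> G \<in> curve_polys \<psi> k \<Longrightarrow> (\<lambda>z. F z + G z) \<in> curve_polys \<psi> k"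
proof -
  assume "F \<in> curve_polys \<psi> k" "G \<in> curve_polys \<psi> k"
  then obtain p q where "p \<in> hompoly k" "F = (\<lambda>z. p (graph_point \<psi> z))"
    "q \<in> hompoly k" "G = (\<lambda>z. q (graph_point \<psi> z))"
    by (auto elim!: curve_polysE)
  then show ?thesis using curve_polysI[OF hompoly_add[of p k q], of \<psi>] by simp
qed

lemma curve_polys_mult: "F \<in> curve_polys \<psi> k \<Longrightarrow> G \<in> curve_polys \<psi> m \<Longrightarrow> (\<lambda>z. F z * G z) \<in> curve_polys \<psi> (k + m)"
proof -
  assume "F \<in> curve_polys \<psi> k" "G \<in> curve_polys \<psi> m"
  then obtain p q where "p \<in> hompoly k" "F = (\<lambda>z. p (graph_point \<psi> z))"
    "q \<in> hompoly m" "G = (\<lambda>z. q (graph_point \<psi> z))"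
    by (auto elim!: curve_polysE)
  then show ?thesis using curve_polysI[OF hompoly_mult[of p k q m], of \<psi>] by simp
qed

lemma curve_polys_const: "(\<lambda>z. c) \<in> curve_polys \<psi> 0"
  using curve_polysI[OF hompoly_const] .

lemma curve_polys_id: "(\<lambda>z. z) \<in> curve_polys \<psi> 1"
  using curve_polysI[OF hompoly_coord[of 2], of \<psi>] by simp

lemma curve_polys_graph: "\<psi> \<in> curve_polys \<psi> 1"
  using curve_polysI[OF hompoly_coord[of 3], of \<psi>] by simp

lemma curve_polys_mono:
  assumes "F \<in> curve_polys \<psi> k" "k \<le> m" shows "F \<in> curve_polys \<psi> m"
proof -
  have "(\<lambda>z. 1) \<in> curve_polys \<psi> (m - k)"
    using curve_polysI[OF hompoly_power[OF hompoly_coord[of 1], where n = "m - k"], where \<psi> = \<psi>] by simp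
  from curve_polys_mult[OF assms(1) this] show ?thesis using assms(2) by simp
qed

lemma curve_polys_cmult: "F \<in> curve_polys \<psi> k \<Longrightarrow> (\<lambda>z. c * F z) \<in> curve_polys \<psi> k"
  using curve_polys_mult[OF curve_polys_const[of c]] by fastforce

lemma curve_polys_sum: "(\<And>i. i \<in> I \<Longrightarrow> f i \<in> curve_polys \<psi> k) \<Longrightarrow> (\<lambda>z. \<Sum>i\<in>I. f i z) \<in> curve_polys \<psi> k"
proof (induction I rule: infinite_finite_induct)
  case (insert x I)
  then show ?case using curve_polys_add[of "f x" \<psi> k "\<lambda>z. \<Sum>i\<in>I. f i z"] by simp
qed (use curve_polys_mono[OF curve_polys_const[of 0]] in simp_all)

lemma curve_polys_power: "F \<in> curve_polys \<psi> k \<Longrightarrow> (\<lambda>z. F z ^ n) \<in> curve_polys \<psi> (n * k)"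
proof -
  assume "F \<in> curve_polys \<psi> k"
  then obtain p where "p \<in> hompoly k" "F = (\<lambda>z. p (graph_point \<psi> z))"
    by (auto elim!: curve_polysE)
  then show ?thesis using curve_polysI[OF hompoly_power[where p = p and k = k and n = n], where \<psi> = \<psi>] by simp
qed

lemma curve_polys_poly:
  assumes "degree s \<le> n" shows "(\<lambda>z. poly s z) \<in> curve_polys \<psi> n"
proof -
  have "(\<lambda>z. \<Sum>i\<le>degree s. coeff s i * z ^ i) \<in> curve_polys \<psi> n"
  proof (intro curve_polys_sum curve_polys_cmult)
    fix i assume "i \<in> {..degree s}"
    then show "(\<lambda>z. z ^ i) \<in> curve_polys \<psi> n"
      using curve_polys_mono[OF curve_polys_power[OF curve_polys_id], of i n \<psi>] assms by simp
  qed
  then show ?thesis by (simp add: poly_altdef)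
qed

lemma curve_polys_holomorphic:
  assumes "\<psi> holomorphic_on UNIV" "F \<in> curve_polys \<psi> k"
  shows "F holomorphic_on UNIV"
proof -
  obtain p where p: "p \<in> hompoly k" and F: "F = (\<lambda>z. p (graph_point \<psi> z))"
    using curve_polysE[OF assms(2)] by blast
  obtain A c where p: "p = (\<lambda>z. \<Sum>\<alpha>\<in>A. c \<alpha> * mono3 z \<alpha>)"
    using p unfolding hompoly_def polyfun3_def by blast
  show ?thesis
    unfolding F p mono3_graph_point by (intro holomorphic_intros assms)
qed

lemma curve_polys_bounded:
  assumes "\<psi> holomorphic_on UNIV" "F \<in> curve_polys \<psi> k"
  obtains S where "1 \<le> S" "\<And>z. norm z \<le> R \<Longrightarrow> norm (F z) \<le> S"
proof -
  have "compact (F ` cball 0 R)"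
    using curve_polys_holomorphic[OF assms]
    by (intro compact_continuous_image) (auto intro: holomorphic_on_imp_continuous_on holomorphic_on_subset)
  then obtain B where "\<And>y. y \<in> F ` cball 0 R \<Longrightarrow> norm y \<le> B"
    by (meson compact_imp_bounded bounded_iff)
  then have "norm (F z) \<le> max 1 B" if "norm z \<le> R" for z
    using that by (simp add: le_max_iff_disj)
  then show ?thesis using that[of "max 1 B"] by simp
qed

section \<open>Taylor polynomials and approximate difference quotients\<close>

lemma power_diff_norm_le:
  fixes x y :: complex
  assumes "1 \<le> R" "norm x \<le> R" "norm y \<le> R"
  shows "norm (x ^ j - y ^ j) \<le> (2 * R) ^ j * norm (x - y)"
proof (induction j)
  case (Suc j)
  have "x ^ Suc j - y ^ Suc j = x * (x ^ j - y ^ j) + (x - y) * y ^ j"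
    by (simp add: algebra_simps)
  then have "norm (x ^ Suc j - y ^ Suc j) \<le> norm x * norm (x ^ j - y ^ j) + norm (x - y) * norm y ^ j"
    by (metis norm_mult norm_power norm_triangle_ineq)
  also have "\<dots> \<le> R * ((2 * R) ^ j * norm (x - y)) + norm (x - y) * (2 * R) ^ j"
    using assms Suc by (intro add_mono mult_mono power_mono) auto
  also have "\<dots> \<le> R * ((2 * R) ^ j * norm (x - y)) + R * (norm (x - y) * (2 * R) ^ j)"
  proof (rule add_left_mono)
    have "0 \<le> norm (x - y) * (2 * R) ^ j" using assms by simp
    from mult_right_mono[OF assms(1) this]
    show "norm (x - y) * (2 * R) ^ j \<le> R * (norm (x - y) * (2 * R) ^ j)"
      by (simp only: mult_1)
  qed
  also have "\<dots> = (2 * R) ^ Suc j * norm (x - y)" by simp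
  finally show ?case .
qed simp

text \<open>
The remainder must be small in the Lipschitz sense, not only uniformly, as it is going to be divided by
\<open>\<zeta> - z\<close>.
\<close>

definition lipschitz_remainder :: "(complex \<Rightarrow> complex) \<Rightarrow> real \<Rightarrow> nat \<Rightarrow> complex poly \<Rightarrow> real \<Rightarrow> bool" where
  "lipschitz_remainder \<psi> R n s \<eta> \<longleftrightarrow> degree s \<le> n \<and> 0 \<le> \<eta> \<and>
    (\<forall>\<zeta> z. norm \<zeta> \<le> R \<longrightarrow> norm z \<le> R \<longrightarrow>
      norm ((\<psi> \<zeta> - poly s \<zeta>) - (\<psi> z - poly s z)) \<le> \<eta> * norm (\<zeta> - z))"

text \<open>
Cauchy's estimates on the circle of radius \<open>4 R B\<close> make the Taylor coefficients of \<open>\<psi>\<close> small enough to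
beat the factor \<open>(2 R)\<^sup>j\<close> from the difference of the \<open>j\<close>-th powers.
\<close>

lemma taylor_remainder_lipschitz:
  assumes \<psi>: "\<psi> holomorphic_on UNIV" and R: "1 \<le> R" and B: "1 \<le> (B::real)"
  obtains n0 where "\<And>n. n0 \<le> n \<Longrightarrow> \<exists>s. lipschitz_remainder \<psi> R n s (1 / B ^ n) \<and> poly s 0 = \<psi> 0"
proof -
  define c where "c j = (deriv ^^ j) \<psi> 0 / fact j" for j
  have sums: "(\<lambda>j. c j * z ^ j) sums \<psi> z" for z
    using holomorphic_power_series[of \<psi> 0 "norm z + 1" z] holomorphic_on_subset[OF \<psi>]
    by (simp add: c_def)
  define r where "r = 4 * R * B"
  have r: "0 < r" using R B by (simp add: r_def)
  obtain M where M: "1 \<le> M" "\<And>z. norm z \<le> r \<Longrightarrow> norm (\<psi> z) \<le> M"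
    using curve_polys_bounded[OF \<psi> curve_polys_graph] by metis
  have c_le: "norm (c j) \<le> M / r ^ j" for j
  proof -
    have "norm ((deriv ^^ j) \<psi> 0) \<le> fact j * M / r ^ j"
      by (rule Cauchy_inequality) (use M r in \<open>auto intro: holomorphic_on_subset[OF \<psi>]
          holomorphic_on_imp_continuous_on\<close>)
    then show ?thesis
      using zero_less_power[OF r, of j] by (simp add: c_def norm_divide field_simps)
  qed
  obtain n0 :: nat where n0: "M \<le> 2 ^ n0"
    using real_arch_pow[of 2 M] by (auto intro: less_imp_le)
  show ?thesis
  proof (rule that[of n0])
    fix n assume n: "n0 \<le> n"
    define s where "s = (\<Sum>j\<le>n. monom (c j) j)"
    have ps: "poly s z = (\<Sum>j\<le>n. c j * z ^ j)" for z
      by (simp add: s_def poly_sum poly_monom)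
    have "degree s \<le> n"
      unfolding s_def by (intro degree_sum_le) (auto intro: order_trans[OF degree_monom_le])
    moreover have "poly s 0 = \<psi> 0"
    proof -
      have "poly s 0 = c 0" by (simp add: ps power_0_left if_distrib sum.delta cong: if_cong)
      then show ?thesis by (simp add: c_def)
    qed
    moreover have "norm ((\<psi> \<zeta> - poly s \<zeta>) - (\<psi> z - poly s z)) \<le> 1 / B ^ n * norm (\<zeta> - z)"
      if \<zeta>z: "norm \<zeta> \<le> R" "norm z \<le> R" for \<zeta> z
    proof -
      define q where "q = 1 / (2 * B)"
      have q: "0 < q" "q \<le> 1 / 2" using B by (auto simp: q_def divide_simps)
      have "(\<lambda>j. c j * \<zeta> ^ j - c j * z ^ j) sums (\<psi> \<zeta> - \<psi> z)"
        by (intro sums_diff sums)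
      from sums_split_initial_segment[OF this, of "Suc n"]
      have 1: "(\<lambda>j. c (j + Suc n) * (\<zeta> ^ (j + Suc n) - z ^ (j + Suc n))) sums
          ((\<psi> \<zeta> - poly s \<zeta>) - (\<psi> z - poly s z))"
        by (simp add: ps sum_subtractf lessThan_Suc_atMost algebra_simps)
      have le: "norm (c (j + Suc n) * (\<zeta> ^ (j + Suc n) - z ^ (j + Suc n))) \<le>
          M * q ^ Suc n * norm (\<zeta> - z) * q ^ j" for j
      proof -
        have "norm (c (j + Suc n) * (\<zeta> ^ (j + Suc n) - z ^ (j + Suc n))) \<le>
            M / r ^ (j + Suc n) * ((2 * R) ^ (j + Suc n) * norm (\<zeta> - z))"
          unfolding norm_mult using M r R \<zeta>z
          by (intro mult_mono c_le power_diff_norm_le) auto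
        also have "\<dots> = M * q ^ (j + Suc n) * norm (\<zeta> - z)"
        proof -
          have "(2 * R) / r = q" using R B by (simp add: r_def q_def divide_simps)
          then have "(2 * R) ^ (j + Suc n) / r ^ (j + Suc n) = q ^ (j + Suc n)"
            by (metis power_divide)
          then show ?thesis by (metis (no_types, opaque_lifting) mult.assoc mult.commute times_divide_eq_right)
        qed
        finally show ?thesis by (simp add: power_add mult_ac)
      qed
      have 2: "(\<lambda>j. M * q ^ Suc n * norm (\<zeta> - z) * q ^ j) sums (M * q ^ Suc n * norm (\<zeta> - z) * (1 / (1 - q)))"
        using q by (intro sums_mult geometric_sums) auto
      have "norm ((\<psi> \<zeta> - poly s \<zeta>) - (\<psi> z - poly s z)) \<le> M * q ^ Suc n * norm (\<zeta> - z) * (1 / (1 - q))"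
        unfolding sums_unique[OF 1] sums_unique[OF 2]
        by (rule norm_suminf_le[OF le sums_summable[OF 2]])
      also have "\<dots> = (M * q ^ n * norm (\<zeta> - z)) * (q / (1 - q))" by simp
      also have "\<dots> \<le> (M * q ^ n * norm (\<zeta> - z)) * 1"
        using q M by (intro mult_left_mono) (auto simp: divide_simps)
      also have "\<dots> = M / 2 ^ n * (1 / B ^ n) * norm (\<zeta> - z)"
        by (simp add: q_def power_divide power_mult_distrib)
      also have "\<dots> \<le> 1 * (1 / B ^ n) * norm (\<zeta> - z)"
      proof -
        have "M \<le> 2 ^ n" using n0 n by (meson one_le_numeral order_trans power_increasing)
        then show ?thesis using B by (intro mult_right_mono) auto
      qed
      finally show ?thesis by simp
    qed
    ultimately show "\<exists>s. lipschitz_remainder \<psi> R n s (1 / B ^ n) \<and> poly s 0 = \<psi> 0"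
      using B by (intro exI[of _ s]) (simp add: lipschitz_remainder_def)
  qed
qed

text \<open>
Exact difference quotients of polynomials in \<open>z\<close> and \<open>\<psi> z\<close> involve \<open>(\<psi> \<zeta> - \<psi> z) / (\<zeta> - z)\<close>, which is not a
polynomial on the graph. Replacing \<open>\<psi>\<close> by a polynomial \<open>s\<close> of degree \<open>n\<close> in this one place raises the
degree by \<open>n\<close> and costs an error proportional to the remainder. The constant \<open>b\<close> does not depend on
\<open>n\<close>, so \<open>n\<close> can be chosen at the end.
\<close>

definition quotient_approx :: "(complex \<Rightarrow> complex) \<Rightarrow> real \<Rightarrow> nat \<Rightarrow> (complex \<Rightarrow> complex) \<Rightarrow> real \<Rightarrow> bool" where
  "quotient_approx \<psi> R k F b \<longleftrightarrow> F \<in> curve_polys \<psi> k \<and> 0 \<le> b \<and> (\<forall>n s \<eta> (\<zeta> :: complex).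
    lipschitz_remainder \<psi> R n s \<eta> \<longrightarrow> norm \<zeta> \<le> R \<longrightarrow>
    (\<exists>Q\<in>curve_polys \<psi> (k + n). \<forall>z. norm z \<le> R \<longrightarrow>
      norm (F \<zeta> - F z - (\<zeta> - z) * Q z) \<le> b * \<eta> * norm (\<zeta> - z)))"

lemma quotient_approxI:
  assumes "F \<in> curve_polys \<psi> k" "0 \<le> b"
    "\<And>n s \<eta> (\<zeta> :: complex). lipschitz_remainder \<psi> R n s \<eta> \<Longrightarrow> norm \<zeta> \<le> R \<Longrightarrow>
      \<exists>Q\<in>curve_polys \<psi> (k + n). \<forall>z. norm z \<le> R \<longrightarrow>
        norm (F \<zeta> - F z - (\<zeta> - z) * Q z) \<le> b * \<eta> * norm (\<zeta> - z)"
  shows "quotient_approx \<psi> R k F b"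
  unfolding quotient_approx_def using assms by blast

lemma quotient_approxD:
  assumes "quotient_approx \<psi> R k F b"
  shows "F \<in> curve_polys \<psi> k" "0 \<le> b"
  using assms unfolding quotient_approx_def by blast+

lemma quotient_approxE:
  assumes "quotient_approx \<psi> R k F b" "lipschitz_remainder \<psi> R n s \<eta>" "norm \<zeta> \<le> R"
  obtains Q where "Q \<in> curve_polys \<psi> (k + n)"
    "\<And>z. norm z \<le> R \<Longrightarrow> norm (F \<zeta> - F z - (\<zeta> - z) * Q z) \<le> b * \<eta> * norm (\<zeta> - z)"
  using assms unfolding quotient_approx_def by blast

lemma quotient_approx_const: "quotient_approx \<psi> R 0 (\<lambda>z. c) 0"
proof (rule quotient_approxI)
  fix n s \<eta> and \<zeta> :: complex
  show "\<exists>Q\<in>curve_polys \<psi> (0 + n). \<forall>z. norm z \<le> R \<longrightarrow>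
      norm (c - c - (\<zeta> - z) * Q z) \<le> 0 * \<eta> * norm (\<zeta> - z)"
    by (rule bexI[of _ "\<lambda>z. 0"]) (use curve_polys_mono[OF curve_polys_const[of 0]] in auto)
qed (simp_all add: curve_polys_const)

lemma quotient_approx_id: "quotient_approx \<psi> R 1 (\<lambda>z. z) 0"
proof (rule quotient_approxI)
  fix n s \<eta> and \<zeta> :: complex
  show "\<exists>Q\<in>curve_polys \<psi> (1 + n). \<forall>z. norm z \<le> R \<longrightarrow>
      norm (\<zeta> - z - (\<zeta> - z) * Q z) \<le> 0 * \<eta> * norm (\<zeta> - z)"
    by (rule bexI[of _ "\<lambda>z. 1"]) (use curve_polys_mono[OF curve_polys_const[of 1]] in auto)
qed (simp_all only: curve_polys_id order_refl)

lemma quotient_approx_graph: "quotient_approx \<psi> R 1 \<psi> 1"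
proof (rule quotient_approxI)
  fix n s \<eta> and \<zeta> :: complex
  assume s: "lipschitz_remainder \<psi> R n s \<eta>" and \<zeta>: "norm \<zeta> \<le> R"
  define q where "q = synthetic_div s \<zeta>"
  have "degree q \<le> 1 + n"
    using s by (auto simp: q_def degree_synthetic_div lipschitz_remainder_def)
  then have "(\<lambda>z. poly q z) \<in> curve_polys \<psi> (1 + n)" by (rule curve_polys_poly)
  moreover have "norm (\<psi> \<zeta> - \<psi> z - (\<zeta> - z) * poly q z) \<le> 1 * \<eta> * norm (\<zeta> - z)" if "norm z \<le> R" for z
  proof -
    have "poly ([:- \<zeta>, 1:] * q + [:poly s \<zeta>:]) z = poly s z"
      unfolding q_def by (simp only: synthetic_div_correct')
    then have "(\<zeta> - z) * poly q z = poly s \<zeta> - poly s z" by (simp add: algebra_simps)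
    then have eq: "\<psi> \<zeta> - \<psi> z - (\<zeta> - z) * poly q z = (\<psi> \<zeta> - poly s \<zeta>) - (\<psi> z - poly s z)" by simp
    show ?thesis unfolding eq mult_1 using s \<zeta> that by (simp add: lipschitz_remainder_def)
  qed
  ultimately show "\<exists>Q\<in>curve_polys \<psi> (1 + n). \<forall>z. norm z \<le> R \<longrightarrow>
      norm (\<psi> \<zeta> - \<psi> z - (\<zeta> - z) * Q z) \<le> 1 * \<eta> * norm (\<zeta> - z)"
    by blast
qed (simp_all only: curve_polys_graph zero_le_one)

lemma quotient_approx_add:
  assumes F: "quotient_approx \<psi> R k F b" and G: "quotient_approx \<psi> R k G d"
  shows "quotient_approx \<psi> R k (\<lambda>z. F z + G z) (b + d)"
proof (rule quotient_approxI)
  fix n s \<eta> and \<zeta> :: complex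
  assume s: "lipschitz_remainder \<psi> R n s \<eta>" and \<zeta>: "norm \<zeta> \<le> R"
  obtain P where P: "P \<in> curve_polys \<psi> (k + n)"
    "\<And>z. norm z \<le> R \<Longrightarrow> norm (F \<zeta> - F z - (\<zeta> - z) * P z) \<le> b * \<eta> * norm (\<zeta> - z)"
    using quotient_approxE[OF F s \<zeta>] by blast
  obtain Q where Q: "Q \<in> curve_polys \<psi> (k + n)"
    "\<And>z. norm z \<le> R \<Longrightarrow> norm (G \<zeta> - G z - (\<zeta> - z) * Q z) \<le> d * \<eta> * norm (\<zeta> - z)"
    using quotient_approxE[OF G s \<zeta>] by blast
  have "norm (F \<zeta> + G \<zeta> - (F z + G z) - (\<zeta> - z) * (P z + Q z)) \<le> (b + d) * \<eta> * norm (\<zeta> - z)"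
    if "norm z \<le> R" for z
  proof -
    have "F \<zeta> + G \<zeta> - (F z + G z) - (\<zeta> - z) * (P z + Q z) =
        (F \<zeta> - F z - (\<zeta> - z) * P z) + (G \<zeta> - G z - (\<zeta> - z) * Q z)"
      by (simp add: algebra_simps)
    then show ?thesis
      using norm_triangle_le[OF add_mono[OF P(2)[OF that] Q(2)[OF that]]] by (simp add: algebra_simps)
  qed
  then show "\<exists>Q\<in>curve_polys \<psi> (k + n). \<forall>z. norm z \<le> R \<longrightarrow>
      norm (F \<zeta> + G \<zeta> - (F z + G z) - (\<zeta> - z) * Q z) \<le> (b + d) * \<eta> * norm (\<zeta> - z)"
    by (intro bexI[OF _ curve_polys_add[OF P(1) Q(1)]]) simp
qed (simp_all add: curve_polys_add quotient_approxD[OF F] quotient_approxD[OF G])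

lemma quotient_approx_mult:
  assumes \<psi>: "\<psi> holomorphic_on UNIV"
    and F: "\<exists>b. quotient_approx \<psi> R k F b" and G: "\<exists>b. quotient_approx \<psi> R m G b"
  shows "\<exists>b. quotient_approx \<psi> R (k + m) (\<lambda>z. F z * G z) b"
proof -
  obtain b d where F: "quotient_approx \<psi> R k F b" and G: "quotient_approx \<psi> R m G d"
    using F G by blast
  note Fb = quotient_approxD[OF F] and Gd = quotient_approxD[OF G]
  obtain S where S: "1 \<le> S" "\<And>z. norm z \<le> R \<Longrightarrow> norm (F z) \<le> S"
    using curve_polys_bounded[OF \<psi> Fb(1)] by blast
  obtain T where T: "1 \<le> T" "\<And>z. norm z \<le> R \<Longrightarrow> norm (G z) \<le> T"
    using curve_polys_bounded[OF \<psi> Gd(1)] by blast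
  have "quotient_approx \<psi> R (k + m) (\<lambda>z. F z * G z) (T * b + S * d)"
  proof (rule quotient_approxI)
    fix n s \<eta> and \<zeta> :: complex
    assume s: "lipschitz_remainder \<psi> R n s \<eta>" and \<zeta>: "norm \<zeta> \<le> R"
    obtain P where P: "P \<in> curve_polys \<psi> (k + n)"
      "\<And>z. norm z \<le> R \<Longrightarrow> norm (F \<zeta> - F z - (\<zeta> - z) * P z) \<le> b * \<eta> * norm (\<zeta> - z)"
      using quotient_approxE[OF F s \<zeta>] by blast
    obtain Q where Q: "Q \<in> curve_polys \<psi> (m + n)"
      "\<And>z. norm z \<le> R \<Longrightarrow> norm (G \<zeta> - G z - (\<zeta> - z) * Q z) \<le> d * \<eta> * norm (\<zeta> - z)"
      using quotient_approxE[OF G s \<zeta>] by blast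
    have "norm (F \<zeta> * G \<zeta> - F z * G z - (\<zeta> - z) * (G \<zeta> * P z + F z * Q z)) \<le> (T * b + S * d) * \<eta> * norm (\<zeta> - z)"
      if z: "norm z \<le> R" for z
    proof -
      have "F \<zeta> * G \<zeta> - F z * G z - (\<zeta> - z) * (G \<zeta> * P z + F z * Q z) =
          G \<zeta> * (F \<zeta> - F z - (\<zeta> - z) * P z) + F z * (G \<zeta> - G z - (\<zeta> - z) * Q z)"
        by (simp add: algebra_simps)
      also have "norm \<dots> \<le> T * (b * \<eta> * norm (\<zeta> - z)) + S * (d * \<eta> * norm (\<zeta> - z))"
      proof (intro norm_triangle_le add_mono)
        show "norm (G \<zeta> * (F \<zeta> - F z - (\<zeta> - z) * P z)) \<le> T * (b * \<eta> * norm (\<zeta> - z))"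
          unfolding norm_mult[of "G \<zeta>"] using T \<zeta> P(2)[OF z] by (intro mult_mono) auto
        show "norm (F z * (G \<zeta> - G z - (\<zeta> - z) * Q z)) \<le> S * (d * \<eta> * norm (\<zeta> - z))"
          unfolding norm_mult[of "F z"] using S z Q(2)[OF z] by (intro mult_mono) auto
      qed
      finally show ?thesis by (simp add: algebra_simps)
    qed
    moreover have "(\<lambda>z. G \<zeta> * P z + F z * Q z) \<in> curve_polys \<psi> (k + m + n)"
    proof (rule curve_polys_add[OF curve_polys_cmult])
      show "P \<in> curve_polys \<psi> (k + m + n)" by (rule curve_polys_mono[OF P(1)]) simp
      show "(\<lambda>z. F z * Q z) \<in> curve_polys \<psi> (k + m + n)"
        by (rule curve_polys_mono[OF curve_polys_mult[OF Fb(1) Q(1)]]) simp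
    qed
    ultimately show "\<exists>Q\<in>curve_polys \<psi> (k + m + n). \<forall>z. norm z \<le> R \<longrightarrow>
        norm (F \<zeta> * G \<zeta> - F z * G z - (\<zeta> - z) * Q z) \<le> (T * b + S * d) * \<eta> * norm (\<zeta> - z)"
      by (intro bexI[of _ "\<lambda>z. G \<zeta> * P z + F z * Q z"]) simp_all
  qed (use Fb Gd S T in \<open>simp_all add: curve_polys_mult\<close>)
  then show ?thesis ..
qed

lemma quotient_approx_power:
  assumes "\<psi> holomorphic_on UNIV" "\<exists>b. quotient_approx \<psi> R k F b"
  shows "\<exists>b. quotient_approx \<psi> R (n * k) (\<lambda>z. F z ^ n) b"
proof (induction n)
  case 0
  show ?case using quotient_approx_const[of \<psi> R 1] by auto
next
  case (Suc n)
  then show ?case using quotient_approx_mult[OF assms Suc] by simp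
qed

lemma quotient_approx_mono:
  assumes F: "quotient_approx \<psi> R k F b" and "k \<le> m"
  shows "quotient_approx \<psi> R m F b"
proof (rule quotient_approxI)
  fix n s \<eta> and \<zeta> :: complex
  assume s: "lipschitz_remainder \<psi> R n s \<eta>" and \<zeta>: "norm \<zeta> \<le> R"
  obtain Q where Q: "Q \<in> curve_polys \<psi> (k + n)"
    "\<And>z. norm z \<le> R \<Longrightarrow> norm (F \<zeta> - F z - (\<zeta> - z) * Q z) \<le> b * \<eta> * norm (\<zeta> - z)"
    using quotient_approxE[OF F s \<zeta>] by blast
  then show "\<exists>Q\<in>curve_polys \<psi> (m + n). \<forall>z. norm z \<le> R \<longrightarrow>
      norm (F \<zeta> - F z - (\<zeta> - z) * Q z) \<le> b * \<eta> * norm (\<zeta> - z)"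
    using curve_polys_mono[OF Q(1), of "m + n"] assms(2) by auto
qed (use quotient_approxD[OF F] curve_polys_mono[OF _ assms(2)] in auto)

lemma quotient_approx_curve_polys:
  assumes \<psi>: "\<psi> holomorphic_on UNIV" and F: "F \<in> curve_polys \<psi> k"
  shows "\<exists>b. quotient_approx \<psi> R k F b"
proof -
  obtain p where p: "p \<in> hompoly k" and Fp: "F = (\<lambda>z. p (graph_point \<psi> z))"
    using curve_polysE[OF F] by blast
  obtain c where c: "\<And>X. p X = (\<Sum>\<alpha> | mdeg \<alpha> = k. c \<alpha> * mono3 X \<alpha>)"
    using hompoly_expand[OF p] by blast
  have mono: "\<exists>b. quotient_approx \<psi> R k (\<lambda>z. c \<alpha> * (z ^ (\<alpha> $ 2) * \<psi> z ^ (\<alpha> $ 3))) b" if "mdeg \<alpha> = k" for \<alpha>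
  proof -
    have "\<exists>b. quotient_approx \<psi> R (0 + (\<alpha> $ 2 * 1 + \<alpha> $ 3 * 1)) (\<lambda>z. c \<alpha> * (z ^ (\<alpha> $ 2) * \<psi> z ^ (\<alpha> $ 3))) b"
      using quotient_approx_const quotient_approx_id quotient_approx_graph
      by (intro quotient_approx_mult[OF \<psi>] quotient_approx_power[OF \<psi>]) blast+
    moreover have "0 + (\<alpha> $ 2 * 1 + \<alpha> $ 3 * 1) \<le> k" using that by (simp add: mdeg_def sum_3)
    ultimately show ?thesis using quotient_approx_mono by blast
  qed
  have "\<exists>b. quotient_approx \<psi> R k (\<lambda>z. \<Sum>\<alpha>\<in>A. c \<alpha> * (z ^ (\<alpha> $ 2) * \<psi> z ^ (\<alpha> $ 3))) b"
    if "finite A" "A \<subseteq> {\<alpha>. mdeg \<alpha> = k}" for A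
    using that
  proof (induction A)
    case empty
    show ?case
      using quotient_approx_mono[OF quotient_approx_const[of \<psi> R 0], of k] by auto
  next
    case (insert \<alpha> A)
    obtain b where b: "quotient_approx \<psi> R k (\<lambda>z. c \<alpha> * (z ^ (\<alpha> $ 2) * \<psi> z ^ (\<alpha> $ 3))) b"
      using mono[of \<alpha>] insert.prems by auto
    obtain d where d: "quotient_approx \<psi> R k (\<lambda>z. \<Sum>\<alpha>\<in>A. c \<alpha> * (z ^ (\<alpha> $ 2) * \<psi> z ^ (\<alpha> $ 3))) d"
      using insert.IH insert.prems by auto
    show ?case using quotient_approx_add[OF b d] insert.hyps by auto
  qed
  from this[OF finite_mdeg order_refl] show ?thesis
    by (simp add: Fp c mono3_graph_point)
qed

text \<open>
The choice \<open>n = N k\<close> keeps the total degree linear in \<open>N\<close>, while the superexponential decay of the Taylor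
remainder beats the exponential size of the \<open>N\<close>-th powers.
\<close>

lemma power_difference_quotient_approx:
  assumes \<psi>: "\<psi> holomorphic_on UNIV" and R: "1 \<le> R" and F: "F \<in> curve_polys \<psi> k" and k: "1 \<le> k"
    and T: "1 \<le> (T :: real)"
  shows "\<forall>\<^sub>F N in sequentially. \<forall>\<zeta>. norm \<zeta> \<le> R \<longrightarrow> (\<exists>Q\<in>curve_polys \<psi> (2 * (N * k)).
    \<forall>z. norm z \<le> R \<longrightarrow> norm (F \<zeta> ^ N - F z ^ N - (\<zeta> - z) * Q z) \<le> 1 / T ^ N * norm (\<zeta> - z))"
proof -
  obtain S where S: "1 \<le> S" "\<And>z. norm z \<le> R \<Longrightarrow> norm (F z) \<le> S"
    using curve_polys_bounded[OF \<psi> F] by blast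
  obtain b where FQ: "quotient_approx \<psi> R k F b"
    using quotient_approx_curve_polys[OF \<psi> F] by blast
  note b = quotient_approxD(2)[OF FQ]
  define B where "B = 4 * S * T"
  have "1 * 1 \<le> S * T" using S T by (intro mult_mono) auto
  then have B: "1 \<le> B" by (simp add: B_def)
  obtain n0 where n0: "\<And>n. n0 \<le> n \<Longrightarrow> \<exists>s. lipschitz_remainder \<psi> R n s (1 / B ^ n) \<and> poly s 0 = \<psi> 0"
    using taylor_remainder_lipschitz[OF \<psi> R B] by blast
  obtain n1 :: nat where n1: "b \<le> 2 ^ n1"
    using real_arch_pow[of 2 b] by (auto intro: less_imp_le)
  have "\<forall>\<zeta>. norm \<zeta> \<le> R \<longrightarrow> (\<exists>Q\<in>curve_polys \<psi> (2 * (N * k)).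
    \<forall>z. norm z \<le> R \<longrightarrow> norm (F \<zeta> ^ N - F z ^ N - (\<zeta> - z) * Q z) \<le> 1 / T ^ N * norm (\<zeta> - z))"
    if N: "max 1 (max n0 n1) \<le> N" for N
  proof (intro allI impI)
    fix \<zeta> :: complex assume \<zeta>: "norm \<zeta> \<le> R"
    define n where "n = N * k"
    have Nn: "N \<le> n" using k by (simp add: n_def)
    then have "n0 \<le> n" using N by simp
    from n0[OF this] obtain s where "lipschitz_remainder \<psi> R n s (1 / B ^ n)" by blast
    from quotient_approxE[OF FQ this \<zeta>] obtain Q where Q: "Q \<in> curve_polys \<psi> (k + n)"
      "\<And>z. norm z \<le> R \<Longrightarrow> norm (F \<zeta> - F z - (\<zeta> - z) * Q z) \<le> b * (1 / B ^ n) * norm (\<zeta> - z)"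
      by blast
    define W where "W z = (\<Sum>i<N. F \<zeta> ^ (N - Suc i) * F z ^ i)" for z
    have eq: "F \<zeta> ^ N - F z ^ N - (\<zeta> - z) * (W z * Q z) = W z * (F \<zeta> - F z - (\<zeta> - z) * Q z)" for z
    proof -
      have "F z ^ N - F \<zeta> ^ N = (F z - F \<zeta>) * W z"
        unfolding W_def by (rule power_diff_sumr2)
      then show ?thesis by (simp add: algebra_simps)
    qed
    have "(\<lambda>z. W z) \<in> curve_polys \<psi> ((N - 1) * k)"
      unfolding W_def
    proof (intro curve_polys_sum curve_polys_cmult)
      fix i assume "i \<in> {..<N}"
      then have "i * k \<le> (N - 1) * k" by (intro mult_le_mono1) auto
      then show "(\<lambda>z. F z ^ i) \<in> curve_polys \<psi> ((N - 1) * k)"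
        using curve_polys_mono[OF curve_polys_power[OF F]] by blast
    qed
    then have "(\<lambda>z. W z * Q z) \<in> curve_polys \<psi> ((N - 1) * k + (k + n))"
      using Q(1) by (rule curve_polys_mult)
    moreover have "(N - 1) * k + (k + n) = 2 * (N * k)"
      using N by (cases N) (simp_all add: n_def)
    ultimately have WQ: "(\<lambda>z. W z * Q z) \<in> curve_polys \<psi> (2 * (N * k))" by simp
    have "norm (W z * (F \<zeta> - F z - (\<zeta> - z) * Q z)) \<le> 1 / T ^ N * norm (\<zeta> - z)" if z: "norm z \<le> R" for z
    proof -
      have "norm (W z) \<le> (\<Sum>i<N. S ^ N)"
        unfolding W_def
      proof (rule sum_norm_le)
        fix i assume i: "i \<in> {..<N}"
        have "norm (F \<zeta> ^ (N - Suc i) * F z ^ i) \<le> S ^ (N - Suc i) * S ^ i"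
          unfolding norm_mult norm_power using S \<zeta> z by (intro mult_mono power_mono) auto
        also have "\<dots> \<le> S ^ N"
          unfolding power_add[symmetric] using i S by (intro power_increasing) auto
        finally show "norm (F \<zeta> ^ (N - Suc i) * F z ^ i) \<le> S ^ N" .
      qed
      then have W: "norm (W z) \<le> real N * S ^ N" by simp
      have BN: "1 / B ^ n \<le> 1 / B ^ N"
        using B Nn by (intro divide_left_mono power_increasing) auto
      have Nb: "real N * b \<le> 4 ^ N"
      proof -
        have "b \<le> 2 ^ N" using n1 N by (meson max.boundedE one_le_numeral order_trans power_increasing)
        moreover have "real N \<le> 2 ^ N" by (simp add: less_imp_le)
        ultimately have "real N * b \<le> 2 ^ N * 2 ^ N" using b by (intro mult_mono) auto
        then show ?thesis by (simp add: power_mult_distrib[symmetric])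
      qed
      have "norm (W z * (F \<zeta> - F z - (\<zeta> - z) * Q z)) \<le> (real N * S ^ N) * (b * (1 / B ^ n) * norm (\<zeta> - z))"
        unfolding norm_mult using W Q(2)[OF z] by (intro mult_mono) (use S in auto)
      also have "\<dots> \<le> (real N * S ^ N) * (b * (1 / B ^ N) * norm (\<zeta> - z))"
        using BN b S by (intro mult_left_mono mult_right_mono) auto
      also have "\<dots> = (real N * b) * (S ^ N * (1 / B ^ N) * norm (\<zeta> - z))" by simp
      also have "\<dots> \<le> 4 ^ N * (S ^ N * (1 / B ^ N) * norm (\<zeta> - z))"
        using Nb S B by (intro mult_right_mono) auto
      also have "\<dots> = 1 / T ^ N * norm (\<zeta> - z)"
        using S T by (simp add: B_def power_mult_distrib)
      finally show ?thesis .
    qed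
    with WQ show "\<exists>Q\<in>curve_polys \<psi> (2 * (N * k)). \<forall>z. norm z \<le> R \<longrightarrow>
        norm (F \<zeta> ^ N - F z ^ N - (\<zeta> - z) * Q z) \<le> 1 / T ^ N * norm (\<zeta> - z)"
      by (intro bexI[OF _ WQ]) (simp add: eq)
  qed
  then show ?thesis unfolding eventually_sequentially by blast
qed

section \<open>Hull bounds and their propagation\<close>

text \<open>
Up to the normalising factor \<open>1 / |X|\<close> this says that \<open>proj X\<close> belongs to the projective hull of the
part of the graph over \<open>K\<close> with constant \<open>C\<close>.
\<close>

definition hull_bound :: "(complex \<Rightarrow> complex) \<Rightarrow> complex set \<Rightarrow> complex ^ 3 \<Rightarrow> real \<Rightarrow> bool" where
  "hull_bound \<psi> K X C \<longleftrightarrow> (\<forall>k. \<forall>p\<in>hompoly k.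
    (\<forall>z\<in>K. norm (p (graph_point \<psi> z)) \<le> 1) \<longrightarrow> norm (p X) \<le> C ^ k)"

lemma hull_boundD:
  "hull_bound \<psi> K X C \<Longrightarrow> p \<in> hompoly k \<Longrightarrow> (\<And>z. z \<in> K \<Longrightarrow> norm (p (graph_point \<psi> z)) \<le> 1) \<Longrightarrow> norm (p X) \<le> C ^ k"
  by (simp add: hull_bound_def)

lemma hull_bound_mono: "hull_bound \<psi> K X C \<Longrightarrow> K \<subseteq> L \<Longrightarrow> 0 \<le> C \<Longrightarrow> C \<le> D \<Longrightarrow> hull_bound \<psi> L X D"
  unfolding hull_bound_def by (meson order_trans power_mono subsetD)

lemma hull_bound_representing_measure:
  assumes \<psi>: "\<psi> holomorphic_on UNIV" and K: "K \<subseteq> cball 0 R" and X: "hull_bound \<psi> K X C"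
  obtains d x \<mu> where "d \<le> (m + 1) ^ 3" "\<And>j::nat. j < d \<Longrightarrow> x j \<in> K" "\<And>j. j < d \<Longrightarrow> norm (\<mu> j) \<le> 2 * C ^ m"
    "\<And>p. p \<in> hompoly m \<Longrightarrow> p X = (\<Sum>j<d. \<mu> j * p (graph_point \<psi> (x j)))"
proof -
  define I where "I = {\<alpha> :: nat ^ 3. mdeg \<alpha> = m}"
  define g where "g \<alpha> z = mono3 (graph_point \<psi> z) \<alpha>" for \<alpha> z
  have "g \<alpha> \<in> curve_polys \<psi> (mdeg \<alpha>)" for \<alpha>
    using curve_polysI[OF hompoly_mono3[of 1 \<alpha>], of \<psi>] by (simp add: g_def[abs_def])
  then have "\<forall>\<alpha>. \<exists>S\<ge>1. \<forall>z. norm z \<le> R \<longrightarrow> norm (g \<alpha> z) \<le> S"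
    using curve_polys_bounded[OF \<psi>] by metis
  then obtain S where S: "\<And>\<alpha>. 1 \<le> S \<alpha>" "\<And>\<alpha> z. norm z \<le> R \<Longrightarrow> norm (g \<alpha> z) \<le> S \<alpha>"
    by metis
  have fin: "finite I" unfolding I_def by (rule finite_mdeg)
  have bdd: "norm (g \<alpha> z) \<le> sum S I" if "\<alpha> \<in> I" "z \<in> K" for \<alpha> z
  proof -
    have "norm (g \<alpha> z) \<le> S \<alpha>" using S that K by auto
    also have "S \<alpha> \<le> sum S I"
      using fin that S(1) by (intro member_le_sum) (auto intro: order_trans[OF zero_le_one])
    finally show ?thesis .
  qed
  have R: "norm (\<Sum>\<alpha>\<in>I. c \<alpha> * mono3 X \<alpha>) \<le> C ^ m"
    if "\<And>z. z \<in> K \<Longrightarrow> norm (\<Sum>\<alpha>\<in>I. c \<alpha> * g \<alpha> z) \<le> 1" for c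
    using hull_boundD[OF X hompoly_collect[of c m]] that by (simp add: I_def g_def)
  obtain d x \<mu> where *: "d \<le> card I" "\<And>j. j < d \<Longrightarrow> x j \<in> K" "\<And>j. j < d \<Longrightarrow> norm (\<mu> j) \<le> 2 * C ^ m"
    "\<And>\<alpha>. \<alpha> \<in> I \<Longrightarrow> mono3 X \<alpha> = (\<Sum>j<d. \<mu> j * g \<alpha> (x j))"
    by (rule finite_dimensional_duality[where I = I and K = K and g = g and h = "mono3 X", OF fin bdd R])
      (assumption | rule that)+
  have "p X = (\<Sum>j<d. \<mu> j * p (graph_point \<psi> (x j)))" if p: "p \<in> hompoly m" for p
  proof -
    obtain c where c: "\<And>Y. p Y = (\<Sum>\<alpha>\<in>I. c \<alpha> * mono3 Y \<alpha>)"
      using hompoly_expand[OF p] unfolding I_def by blast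
    have "p X = (\<Sum>\<alpha>\<in>I. \<Sum>j<d. c \<alpha> * (\<mu> j * g \<alpha> (x j)))"
      unfolding c by (intro sum.cong refl) (simp add: *(4) sum_distrib_left)
    also have "\<dots> = (\<Sum>j<d. \<mu> j * p (graph_point \<psi> (x j)))"
      unfolding c by (subst sum.swap) (simp add: sum_distrib_left g_def mult_ac)
    finally show ?thesis .
  qed
  moreover have "d \<le> (m + 1) ^ 3"
    using *(1) card_mdeg_le[of m] by (simp add: I_def)
  ultimately show thesis using *(2,3) that by blast
qed

text \<open>
If the measure with weights \<open>\<mu> j\<close> at \<open>x j\<close> is tested on the exact difference quotient
\<open>(F \<zeta>\<^sup>N - F z\<^sup>N) / (\<zeta> - z)\<close>, the term with \<open>F \<zeta>\<^sup>N\<close> is \<open>F \<zeta>\<^sup>N\<close> times the Cauchy transform at \<open>\<zeta>\<close>, and the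
term with \<open>F z\<^sup>N\<close> is bounded because \<open>F\<close> is bounded on the support. So the Cauchy transform is
known up to a bounded error, divided by \<open>F \<zeta>\<^sup>N\<close>.
\<close>

lemma cauchy_transform_estimate:
  fixes x :: "nat \<Rightarrow> complex"
  assumes \<delta>: "0 < \<delta>" "\<And>j. j < d \<Longrightarrow> \<delta> \<le> norm (\<zeta> - x j)"
    and \<mu>: "\<And>j. j < d \<Longrightarrow> norm (\<mu> j) \<le> W" and F: "\<And>j. j < d \<Longrightarrow> norm (F (x j)) \<le> 1"
    and Q: "\<And>j. j < d \<Longrightarrow> norm (F \<zeta> ^ N - F (x j) ^ N - (\<zeta> - x j) * Q (x j)) \<le> norm (\<zeta> - x j)"
  shows "norm (F \<zeta> ^ N * (\<Sum>j<d. \<mu> j / (\<zeta> - x j)) - (\<Sum>j<d. \<mu> j * Q (x j))) \<le> real d * (W * (1 / \<delta> + 1))"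
proof -
  have "F \<zeta> ^ N * (\<Sum>j<d. \<mu> j / (\<zeta> - x j)) - (\<Sum>j<d. \<mu> j * Q (x j)) =
      (\<Sum>j<d. \<mu> j * ((F \<zeta> ^ N - (\<zeta> - x j) * Q (x j)) / (\<zeta> - x j)))"
    unfolding sum_distrib_left sum_subtractf[symmetric]
  proof (intro sum.cong refl)
    fix j assume "j \<in> {..<d}"
    then have "0 < norm (\<zeta> - x j)" using less_le_trans[OF \<delta>] by simp
    then have eq: "(F \<zeta> ^ N - (\<zeta> - x j) * Q (x j)) / (\<zeta> - x j) = F \<zeta> ^ N / (\<zeta> - x j) - Q (x j)"
      by (simp add: diff_divide_distrib)
    show "F \<zeta> ^ N * (\<mu> j / (\<zeta> - x j)) - \<mu> j * Q (x j) =
        \<mu> j * ((F \<zeta> ^ N - (\<zeta> - x j) * Q (x j)) / (\<zeta> - x j))"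
      unfolding eq right_diff_distrib by simp
  qed
  also have "norm \<dots> \<le> (\<Sum>j<d. W * (1 / \<delta> + 1))"
  proof (rule sum_norm_le)
    fix j assume "j \<in> {..<d}"
    then have j: "j < d" by simp
    let ?r = "norm (\<zeta> - x j)"
    have r: "0 < ?r" by (rule less_le_trans[OF \<delta>(1) \<delta>(2)[OF j]])
    have "norm (F (x j) ^ N) \<le> 1"
      using F[OF j] by (simp add: norm_power power_le_one)
    then have "norm (F \<zeta> ^ N - (\<zeta> - x j) * Q (x j)) \<le> ?r + 1"
      using norm_triangle_mono[OF Q[OF j], of "F (x j) ^ N" 1] by simp
    then have "norm ((F \<zeta> ^ N - (\<zeta> - x j) * Q (x j)) / (\<zeta> - x j)) \<le> (?r + 1) / ?r"
      unfolding norm_divide by (intro divide_right_mono) auto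
    also have "\<dots> = 1 / ?r + 1" using r by (simp add: add_divide_distrib)
    also have "\<dots> \<le> 1 / \<delta> + 1"
      using \<delta>(1) \<delta>(2)[OF j] r by (intro add_right_mono divide_left_mono mult_pos_pos) auto
    finally show "norm (\<mu> j * ((F \<zeta> ^ N - (\<zeta> - x j) * Q (x j)) / (\<zeta> - x j))) \<le> W * (1 / \<delta> + 1)"
      unfolding norm_mult[of "\<mu> j"] using \<mu>[OF j] order_trans[OF norm_ge_zero \<mu>[OF j]]
      by (intro mult_mono) auto
  qed
  finally show ?thesis by simp
qed

lemma hompoly_0_const: "p \<in> hompoly 0 \<Longrightarrow> p X = p Y"
  using hompoly_scale[of p 0 0 X] hompoly_scale[of p 0 0 Y] by simp

text \<open>
This is the analogue of a minimum principle: the extremal function that measures the hull is superharmonic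
on the graph away from \<open>K\<close>, so if it is finite at the centre of a disc it is bounded on the half disc. The
representing measure of \<open>a\<close> gives the function \<open>\<Psi>\<close>, whose product with \<open>F\<^sup>N\<close> is bounded although \<open>F\<close> may be
large; \<open>bounded_quotient_on_half_disc\<close> turns this into a bound for \<open>F\<^sup>N\<close>, and \<open>N\<close> tends to infinity to
absorb all polynomial factors.
\<close>

lemma hull_bound_nearby:
  assumes \<psi>: "\<psi> holomorphic_on UNIV" and K: "K \<subseteq> cball 0 R" and \<delta>: "0 < \<delta>"
    and far: "\<And>x. x \<in> K \<Longrightarrow> 2 * \<delta> \<le> norm (x - a)" and C: "1 \<le> C"
    and a: "hull_bound \<psi> K (graph_point \<psi> a) C" and z0: "norm (z0 - a) \<le> \<delta> / 2"
  shows "hull_bound \<psi> K (graph_point \<psi> z0) (C ^ 6)"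
  unfolding hull_bound_def
proof (intro allI ballI impI)
  fix k p assume p: "p \<in> hompoly k" and le1: "\<forall>z\<in>K. norm (p (graph_point \<psi> z)) \<le> 1"
  show "norm (p (graph_point \<psi> z0)) \<le> (C ^ 6) ^ k"
  proof (cases "k = 0")
    case True
    then show ?thesis
      using hull_boundD[OF a p] le1 hompoly_0_const[of p "graph_point \<psi> z0" "graph_point \<psi> a"] p by simp
  next
    case False
    then have k: "1 \<le> k" by simp
    define F where "F z = p (graph_point \<psi> z)" for z
    have F: "F \<in> curve_polys \<psi> k" using curve_polysI[OF p, of \<psi>] by (simp add: F_def[abs_def])
    have Fhol: "F holomorphic_on A" for A
      using curve_polys_holomorphic[OF \<psi> F] holomorphic_on_subset by blast
    define R' where "R' = max 1 (max R (norm a + \<delta>))"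
    have inR': "norm x \<le> R'" if "x \<in> K" for x using that K by (auto simp: R'_def)
    have inR'': "norm \<zeta> \<le> R'" if "norm (\<zeta> - a) \<le> \<delta>" for \<zeta>
      using norm_triangle_ineq2[of \<zeta> a] that by (simp add: R'_def)
    have Fa: "norm (F a) \<le> C ^ k" using hull_boundD[OF a p] le1 by (simp add: F_def)
    have key: "norm (F z0) ^ N \<le> ((1 + \<delta>) * (1 + 2 * (2 * (real N * real k) + 1) ^ 3)) ^ 3 * (C ^ 6) ^ (k * N)"
      if N: "\<forall>\<zeta>. norm \<zeta> \<le> R' \<longrightarrow> (\<exists>Q\<in>curve_polys \<psi> (2 * (N * k)).
        \<forall>z. norm z \<le> R' \<longrightarrow> norm (F \<zeta> ^ N - F z ^ N - (\<zeta> - z) * Q z) \<le> 1 / 1 ^ N * norm (\<zeta> - z))" for N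
    proof -
      define m where "m = 2 * (N * k)"
      have C_le: "C ^ i \<le> C ^ m" if "i \<le> m" for i using C that by (rule power_increasing[rotated])
      obtain d x \<mu> where d: "d \<le> (m + 1) ^ 3" and x: "\<And>j. j < d \<Longrightarrow> x j \<in> K"
        and \<mu>: "\<And>j. j < d \<Longrightarrow> norm (\<mu> j) \<le> 2 * C ^ m"
        and repr: "\<And>q. q \<in> hompoly m \<Longrightarrow> q (graph_point \<psi> a) = (\<Sum>j<d. \<mu> j * q (graph_point \<psi> (x j)))"
        using hull_bound_representing_measure[OF \<psi> K a] by blast
      define P where "P = 2 * (real m + 1) ^ 3"
      have P: "0 \<le> P" by (simp add: P_def)
      define A where "A = (1 + \<delta>) * (1 + P) * C ^ m"
      \<comment> \<open>Up to the factor \<open>\<zeta> - a\<close> this is the Cauchy transform of the unit mass at \<open>a\<close> minus the representing measure.\<close>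
      define \<Psi> where "\<Psi> \<zeta> = 1 - (\<zeta> - a) * (\<Sum>j<d. \<mu> j / (\<zeta> - x j))" for \<zeta>
      have sum_le: "norm (\<Sum>j<d. \<mu> j * w j) \<le> P * C ^ m * b" if "\<And>j. j < d \<Longrightarrow> norm (w j) \<le> b" "0 \<le> b" for w b
      proof -
        have "norm (\<Sum>j<d. \<mu> j * w j) \<le> (\<Sum>j<d. 2 * C ^ m * b)"
          using that \<mu> C by (intro sum_norm_le) (auto simp: norm_mult intro!: mult_mono)
        also have "\<dots> = real d * (2 * C ^ m * b)" by simp
        also have "\<dots> \<le> real ((m + 1) ^ 3) * (2 * C ^ m * b)"
          using d C that(2) by (intro mult_right_mono) (simp_all only: of_nat_le_iff, simp)
        finally show ?thesis by (simp add: P_def mult_ac add_ac)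
      qed
      have dist: "\<delta> \<le> norm (\<zeta> - x j)" if "norm (\<zeta> - a) \<le> \<delta>" "j < d" for \<zeta> j
        using far[OF x[OF that(2)]] that(1) norm_triangle_ineq[of "x j - \<zeta>" "\<zeta> - a"]
        by (simp add: norm_minus_commute)
      have Cm: "1 \<le> C ^ m" using C by simp
      have \<Psi>A: "norm (\<Psi> \<zeta>) \<le> A" if "norm (\<zeta> - a) = \<delta>" for \<zeta>
      proof -
        have "norm (\<Sum>j<d. \<mu> j * (1 / (\<zeta> - x j))) \<le> P * C ^ m * (1 / \<delta>)"
          using dist that \<delta> by (intro sum_le) (auto simp: norm_divide intro!: divide_left_mono mult_pos_pos
              dest!: dist[rotated] elim: less_le_trans)
        then have "norm (\<zeta> - a) * norm (\<Sum>j<d. \<mu> j / (\<zeta> - x j)) \<le> \<delta> * (P * C ^ m * (1 / \<delta>))"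
          using that \<delta> by (intro mult_mono) auto
        then have "norm (\<Psi> \<zeta>) \<le> 1 + P * C ^ m"
          unfolding \<Psi>_def using \<delta> norm_triangle_ineq4[of 1 "(\<zeta> - a) * (\<Sum>j<d. \<mu> j / (\<zeta> - x j))"]
          by (simp add: norm_mult)
        also have "\<dots> \<le> (1 + P) * C ^ m" using Cm by (simp add: algebra_simps)
        also have "\<dots> \<le> (1 + \<delta>) * ((1 + P) * C ^ m)"
          using \<delta> P Cm by (simp add: distrib_right)
        finally show ?thesis by (simp add: A_def mult_ac)
      qed
      have \<Psi>FA: "norm (\<Psi> \<zeta> * F \<zeta> ^ N) \<le> A" if \<zeta>: "norm (\<zeta> - a) = \<delta>" for \<zeta>
      proof -
        have "norm \<zeta> \<le> R'" using inR''[of \<zeta>] \<zeta> by simp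
        with N obtain Q where Q: "Q \<in> curve_polys \<psi> m"
          and QE: "\<And>z. norm z \<le> R' \<Longrightarrow> norm (F \<zeta> ^ N - F z ^ N - (\<zeta> - z) * Q z) \<le> norm (\<zeta> - z)"
          unfolding m_def by auto
        obtain q where q: "q \<in> hompoly m" "Q = (\<lambda>z. q (graph_point \<psi> z))"
          using curve_polysE[OF Q] by blast
        define E where "E = F \<zeta> ^ N - F a ^ N - (\<zeta> - a) * Q a"
        define w where "w = F \<zeta> ^ N * (\<Sum>j<d. \<mu> j / (\<zeta> - x j)) - (\<Sum>j<d. \<mu> j * Q (x j))"
        have "Q a = (\<Sum>j<d. \<mu> j * Q (x j))" using repr[OF q(1)] q(2) by simp
        then have eq: "\<Psi> \<zeta> * F \<zeta> ^ N = F a ^ N + E - (\<zeta> - a) * w"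
          by (simp add: \<Psi>_def w_def E_def algebra_simps)
        have Ea: "norm E \<le> \<delta>" using QE[OF inR''[of a]] \<delta> \<zeta> by (simp add: E_def)
        have FaN: "norm (F a ^ N) \<le> C ^ m"
        proof -
          have "norm (F a ^ N) \<le> (C ^ k) ^ N" unfolding norm_power using Fa by (intro power_mono) auto
          also have "\<dots> = C ^ (N * k)" by (simp add: power_mult[symmetric] mult.commute)
          also have "\<dots> \<le> C ^ m" by (rule C_le) (simp add: m_def)
          finally show ?thesis .
        qed
        have "norm w \<le> real d * (2 * C ^ m * (1 / \<delta> + 1))"
          unfolding w_def by (rule cauchy_transform_estimate[OF \<delta> dist[OF eq_refl[OF \<zeta>]] \<mu>])
            (use le1 x QE[OF inR'[OF x]] in \<open>auto simp: F_def\<close>)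
        also have "\<dots> \<le> real ((m + 1) ^ 3) * (2 * C ^ m * (1 / \<delta> + 1))"
          using d C \<delta> by (intro mult_right_mono) (simp_all only: of_nat_le_iff, simp)
        also have "\<dots> = P * C ^ m * (1 / \<delta> + 1)" by (simp add: P_def add_ac)
        finally have "norm ((\<zeta> - a) * w) \<le> \<delta> * (P * C ^ m * (1 / \<delta> + 1))"
          unfolding norm_mult using \<zeta> \<delta> by (intro mult_mono) auto
        also have "\<dots> = (1 + \<delta>) * P * C ^ m" using \<delta> by (simp add: field_simps)
        finally have "norm (\<Psi> \<zeta> * F \<zeta> ^ N) \<le> C ^ m + \<delta> + (1 + \<delta>) * P * C ^ m"
          unfolding eq by (intro order_trans[OF norm_triangle_ineq4] add_mono
              order_trans[OF norm_triangle_ineq] FaN Ea)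
        also have "\<dots> \<le> C ^ m + \<delta> * C ^ m + (1 + \<delta>) * P * C ^ m"
          using Cm \<delta> by simp
        also have "\<dots> = A" by (simp add: A_def algebra_simps)
        finally show ?thesis .
      qed
      have ball_ne: "\<zeta> - x j \<noteq> 0" if "\<zeta> \<in> ball a (2 * \<delta>)" "j < d" for \<zeta> j
        using far[OF x[OF that(2)]] that(1) by (auto simp: dist_norm norm_minus_commute)
      have "norm (F z0 ^ N) \<le> A ^ 3"
      proof (rule bounded_quotient_on_half_disc[where S = "ball a (2 * \<delta>)" and r = \<delta> and a = a and \<Psi> = \<Psi>
            and F = "\<lambda>z. F z ^ N" and z = z0])
        show "\<Psi> holomorphic_on ball a (2 * \<delta>)"
          unfolding \<Psi>_def using ball_ne by (intro holomorphic_intros) auto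
        show "1 \<le> norm (\<Psi> a)" by (simp add: \<Psi>_def)
      qed (use \<delta> z0 \<Psi>A \<Psi>FA in \<open>auto intro!: holomorphic_intros Fhol\<close>)
      also have "A ^ 3 = ((1 + \<delta>) * (1 + P)) ^ 3 * (C ^ 6) ^ (k * N)"
      proof -
        have "(C ^ m) ^ 3 = (C ^ 6) ^ (k * N)"
          by (simp add: power_mult[symmetric] m_def mult_ac)
        then show ?thesis by (simp add: A_def power_mult_distrib)
      qed
      finally show ?thesis by (simp add: norm_power P_def m_def)
    qed
    have ev: "\<forall>\<^sub>F N in sequentially. norm (F z0) ^ N \<le>
        ((1 + \<delta>) * (1 + 2 * (2 * (real N * real k) + 1) ^ 3)) ^ 3 * (C ^ 6) ^ (k * N)"
      using power_difference_quotient_approx[OF \<psi> _ F k order_refl, of R']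
      by (auto simp: R'_def elim!: eventually_mono intro!: key)
    have "norm (F z0) \<le> (C ^ 6) ^ k"
    proof (rule ccontr)
      assume gt: "\<not> norm (F z0) \<le> (C ^ 6) ^ k"
      define q where "q = norm (F z0) / (C ^ 6) ^ k"
      have C6: "0 < (C ^ 6) ^ k" using C by simp
      then have q: "1 < q" using gt by (simp add: q_def)
      define \<kappa> where "\<kappa> = real k"
      have \<kappa>: "0 < \<kappa>" using k by (simp add: \<kappa>_def)
      have "\<forall>\<^sub>F N in sequentially. ((1 + \<delta>) * (1 + 2 * (2 * (real N * \<kappa>) + 1) ^ 3)) ^ 3 < q ^ N"
        using q \<delta> \<kappa> by real_asymp
      with ev have "\<forall>\<^sub>F N in sequentially. False"
      proof eventually_elim
        case (elim N)
        have "norm (F z0) = q * (C ^ 6) ^ k" using C by (simp add: q_def)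
        then have "norm (F z0) ^ N = q ^ N * (C ^ 6) ^ (k * N)"
          by (simp only: power_mult_distrib power_mult)
        moreover have "((1 + \<delta>) * (1 + 2 * (2 * (real N * \<kappa>) + 1) ^ 3)) ^ 3 * (C ^ 6) ^ (k * N) < q ^ N * (C ^ 6) ^ (k * N)"
          using elim(2) C by (intro mult_strict_right_mono) auto
        ultimately show False using elim(1) by (simp add: \<kappa>_def)
      qed
      then show False by simp
    qed
    then show ?thesis by (simp add: F_def)
  qed
qed

section \<open>Transcendental graphs have no hull bounds outside a compact set\<close>

lemma homogeneous_system_nontrivial_solution:
  fixes A :: "'i \<Rightarrow> nat \<Rightarrow> complex"
  assumes "finite I" "N < card I"
  shows "\<exists>c. (\<exists>i\<in>I. c i \<noteq> 0) \<and> (\<forall>j<N. (\<Sum>i\<in>I. c i * A i j) = 0)"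
  using assms
proof (induction N arbitrary: I A)
  case 0
  then obtain i where "i \<in> I" by fastforce
  then show ?case by (intro exI[of _ "\<lambda>_. 1"]) auto
next
  case (Suc N)
  show ?case
  proof (cases "\<forall>i\<in>I. A i N = 0")
    case True
    from Suc.prems have "N < card I" by simp
    from Suc.IH[OF Suc.prems(1) this, of A] obtain c
      where c: "\<exists>i\<in>I. c i \<noteq> 0" "\<forall>j<N. (\<Sum>i\<in>I. c i * A i j) = 0" by blast
    have "(\<Sum>i\<in>I. c i * A i N) = 0" using True by simp
    then show ?thesis using c by (metis less_Suc_eq)
  next
    case False
    then obtain i0 where i0: "i0 \<in> I" "A i0 N \<noteq> 0" by blast
    define J where "J = I - {i0}"
    have J: "finite J" "I = insert i0 J" "i0 \<notin> J" using Suc.prems i0 by (auto simp: J_def)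
    have "N < card J" using Suc.prems J by simp
    define A' where "A' i j = A i j - A i N / A i0 N * A i0 j" for i j
    obtain c where c: "\<exists>i\<in>J. c i \<noteq> 0" "\<And>j. j < N \<Longrightarrow> (\<Sum>i\<in>J. c i * A' i j) = 0"
      using Suc.IH[OF J(1) \<open>N < card J\<close>, of A'] by blast
    define c' where "c' i = (if i = i0 then - (\<Sum>i\<in>J. c i * A i N) / A i0 N else c i)" for i
    have sum_c': "(\<Sum>i\<in>I. c' i * A i j) = (\<Sum>i\<in>J. c i * A' i j)" for j
    proof -
      have "(\<Sum>i\<in>I. c' i * A i j) = c' i0 * A i0 j + (\<Sum>i\<in>J. c' i * A i j)"
        using J by simp
      also have "(\<Sum>i\<in>J. c' i * A i j) = (\<Sum>i\<in>J. c i * A i j)"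
        using J by (intro sum.cong) (auto simp: c'_def)
      also have "c' i0 * A i0 j + (\<Sum>i\<in>J. c i * A i j) = (\<Sum>i\<in>J. c i * A' i j)"
        by (simp add: c'_def A'_def algebra_simps sum_subtractf sum_distrib_left sum_divide_distrib)
      finally show ?thesis .
    qed
    have "(\<Sum>i\<in>I. c' i * A i j) = 0" if "j < Suc N" for j
    proof (cases "j = N")
      case True
      then have "A' i j = 0" for i using i0 by (simp add: A'_def)
      then show ?thesis by (simp add: sum_c')
    qed (use that c in \<open>simp add: sum_c'\<close>)
    moreover have "\<exists>i\<in>I. c' i \<noteq> 0"
    proof -
      obtain i where "i \<in> J" "c i \<noteq> 0" using c by blast
      then show ?thesis using J by (intro bexI[of _ i]) (auto simp: c'_def)
    qed
    ultimately show ?thesis by blast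
  qed
qed

text \<open>
Far out the leading coefficient \<open>a L\<close> is bounded away from zero, so the equation bounds \<open>\<psi> z\<close> by a power
of \<open>|z|\<close>, and Liouville's theorem applies.
\<close>

lemma entire_algebraic_imp_polynomial:
  fixes a :: "nat \<Rightarrow> complex poly"
  assumes \<psi>: "\<psi> holomorphic_on UNIV" and rel: "\<And>z. (\<Sum>l\<le>h. poly (a l) z * \<psi> z ^ l) = 0"
    and nz: "\<exists>l\<le>h. a l \<noteq> 0"
  shows "\<exists>q. \<forall>z. \<psi> z = poly q z"
proof -
  define L where "L = (GREATEST l. l \<le> h \<and> a l \<noteq> 0)"
  have L: "L \<le> h" "a L \<noteq> 0"
    using GreatestI_ex_nat[of "\<lambda>l. l \<le> h \<and> a l \<noteq> 0" h] nz by (auto simp: L_def)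
  have Lmax: "a l = 0" if "L < l" "l \<le> h" for l
    using Greatest_le_nat[of "\<lambda>l. l \<le> h \<and> a l \<noteq> 0" l h] that by (force simp: L_def)
  have rel': "(\<Sum>l<L. poly (a l) z * \<psi> z ^ l) = - (poly (a L) z * \<psi> z ^ L)" for z
  proof -
    have "(\<Sum>l\<le>h. poly (a l) z * \<psi> z ^ l) = (\<Sum>l\<le>L. poly (a l) z * \<psi> z ^ l)"
      using L Lmax by (intro sum.mono_neutral_right) auto
    then have "(\<Sum>l\<le>L. poly (a l) z * \<psi> z ^ l) = 0" using rel by simp
    then show ?thesis by (simp add: lessThan_Suc_atMost[symmetric] eq_neg_iff_add_eq_0)
  qed
  obtain \<epsilon> r0 where \<epsilon>: "0 < \<epsilon>" "\<And>z. r0 \<le> norm z \<Longrightarrow> \<epsilon> \<le> norm (poly (a L) z)"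
  proof (cases "degree (a L) = 0")
    case True
    then obtain c where "a L = [:c:]" by (metis degree_eq_zeroE)
    then show ?thesis using that[of "norm c" 0] L by auto
  next
    case False
    then have "\<exists>i. i \<noteq> 0 \<and> i \<le> degree (a L) \<and> coeff (a L) i \<noteq> 0"
      using L by (intro exI[of _ "degree (a L)"]) simp
    from polyfun_extremal[OF this, of 1] have "\<forall>\<^sub>F z in at_infinity. 1 \<le> norm (poly (a L) z)"
      by (simp add: poly_altdef)
    then show ?thesis using that[of 1] by (auto simp: eventually_at_infinity)
  qed
  define D where "D = Max (degree ` a ` {..h})"
  have D: "degree (a l) \<le> D" if "l \<le> h" for l using that by (auto simp: D_def)
  define B where "B l = (\<Sum>i\<le>degree (a l). norm (coeff (a l) i))" for l
  have poly_le: "norm (poly (a l) z) \<le> B l * norm z ^ D" if "l \<le> h" "1 \<le> norm z" for l z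
  proof -
    have "norm (poly (a l) z) \<le> (\<Sum>i\<le>degree (a l). norm (coeff (a l) i) * norm z ^ D)"
      unfolding poly_altdef using D[OF that(1)] that(2)
      by (intro sum_norm_le) (auto simp: norm_mult norm_power intro!: mult_left_mono power_increasing)
    then show ?thesis by (simp add: B_def sum_distrib_right)
  qed
  have L0: "0 < L"
  proof (rule ccontr)
    assume "\<not> 0 < L"
    then have "poly (a L) z = 0" for z using rel'[of z] by simp
    then have "a L = 0" by (metis poly_all_0_iff_0)
    then show False using L by simp
  qed
  define M where "M = 1 + (\<Sum>l<L. B l) / \<epsilon>"
  have B0: "0 \<le> B l" for l by (simp add: B_def sum_nonneg)
  have bound: "norm (\<psi> z) \<le> M * norm z ^ D" if z: "max 1 r0 \<le> norm z" for z
  proof (cases "norm (\<psi> z) \<le> 1")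
    case True
    also have "1 \<le> M * norm z ^ D"
      using z \<epsilon> B0 mult_mono[of 1 M 1 "norm z ^ D"] by (simp add: M_def sum_nonneg)
    finally show ?thesis .
  next
    case False
    have "norm (poly (a L) z) * norm (\<psi> z) ^ L = norm (\<Sum>l<L. poly (a l) z * \<psi> z ^ l)"
      unfolding rel' by (simp add: norm_mult norm_power)
    also have "\<dots> \<le> (\<Sum>l<L. (B l * norm z ^ D) * norm (\<psi> z) ^ (L - 1))"
    proof (rule sum_norm_le)
      fix l assume l: "l \<in> {..<L}"
      show "norm (poly (a l) z * \<psi> z ^ l) \<le> (B l * norm z ^ D) * norm (\<psi> z) ^ (L - 1)"
        unfolding norm_mult norm_power using l L z False B0
        by (intro mult_mono poly_le power_increasing) auto
    qed
    also have "\<dots> = (\<Sum>l<L. B l) * norm z ^ D * norm (\<psi> z) ^ (L - 1)"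
      by (simp add: sum_distrib_right)
    finally have "\<epsilon> * norm (\<psi> z) ^ L \<le> (\<Sum>l<L. B l) * norm z ^ D * norm (\<psi> z) ^ (L - 1)"
      using mult_right_mono[OF \<epsilon>(2), of z "norm (\<psi> z) ^ L"] z by simp
    moreover have "norm (\<psi> z) ^ L = norm (\<psi> z) * norm (\<psi> z) ^ (L - 1)"
      using L0 by (cases L) auto
    moreover have "0 < norm (\<psi> z) ^ (L - 1)" using False by (intro zero_less_power) linarith
    ultimately have "\<epsilon> * norm (\<psi> z) \<le> (\<Sum>l<L. B l) * norm z ^ D"
      by (metis mult.assoc mult_le_cancel_right_pos)
    then have "norm (\<psi> z) \<le> (\<Sum>l<L. B l) / \<epsilon> * norm z ^ D"
      using \<epsilon>(1) by (simp add: field_simps)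
    also have "\<dots> \<le> M * norm z ^ D"
      by (intro mult_right_mono) (auto simp: M_def)
    finally show ?thesis .
  qed
  define q where "q = (\<Sum>k\<le>D. monom ((deriv ^^ k) \<psi> 0 / fact k) k)"
  have "\<psi> z = poly q z" for z
    using Liouville_polynomial[OF \<psi> bound, where \<xi> = z and A = "max 1 r0"] by (simp add: q_def poly_sum poly_monom)
  then show ?thesis by blast
qed

text \<open>
The Schwarz lemma for a zero of order \<open>N\<close>, that is, the maximum principle for \<open>f z / z\<^sup>N\<close>.
\<close>

lemma high_order_zero_decay:
  assumes f: "f holomorphic_on UNIV" and 0: "\<And>j. j < N \<Longrightarrow> (deriv ^^ j) f 0 = 0"
    and r: "0 < r" and B: "\<And>z. norm z = 2 * r \<Longrightarrow> norm (f z) \<le> B" and z: "norm z \<le> r"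
  shows "norm (f z) \<le> B / 2 ^ N"
proof -
  define c where "c j = (deriv ^^ j) f 0 / fact j" for j
  have sums: "(\<lambda>j. c j * w ^ j) sums f w" for w
    using holomorphic_power_series[of f 0 "norm w + 1" w] holomorphic_on_subset[OF f]
    by (simp add: c_def)
  define g where "g w = (\<Sum>j. c (j + N) * w ^ j)" for w
  have summ: "summable (\<lambda>j. c (j + N) * w ^ j)" for w
  proof (cases "w = 0")
    case False
    have "summable (\<lambda>j. c (j + N) * w ^ (j + N))"
      using sums_summable[OF sums] summable_iff_shift[of "\<lambda>j. c j * w ^ j" N] by simp
    then have "summable (\<lambda>j. c (j + N) * w ^ (j + N) / w ^ N)" by (rule summable_divide)
    then show ?thesis using False by (simp add: power_add)
  qed simp
  have fg: "f w = w ^ N * g w" for w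
  proof -
    have "(\<lambda>j. c (j + N) * w ^ (j + N)) sums (f w - (\<Sum>j<N. c j * w ^ j))"
      using sums_split_initial_segment[OF sums] by blast
    moreover have "(\<Sum>j<N. c j * w ^ j) = 0" using 0 by (simp add: c_def)
    moreover have "(\<lambda>j. w ^ N * (c (j + N) * w ^ j)) sums (w ^ N * g w)"
      unfolding g_def by (intro sums_mult summable_sums summ)
    ultimately show ?thesis by (simp add: power_add mult_ac sums_iff)
  qed
  have g: "g holomorphic_on UNIV"
  proof -
    have "g holomorphic_on ball 0 \<rho>" for \<rho>
    proof (rule power_series_holomorphic)
      fix w show "(\<lambda>n. c (n + N) * (w - 0) ^ n) sums g w"
        unfolding g_def using summable_sums[OF summ] by simp
    qed
    then have "g field_differentiable at w" for w
      using holomorphic_onD[of g "ball 0 (norm w + 1)" w]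
      by (metis at_within_open centre_in_ball dist_0_norm holomorphic_on_open less_add_one mem_ball open_ball
          field_differentiable_def)
    then show ?thesis by (simp add: holomorphic_on_def)
  qed
  have "norm (g w) \<le> B / (2 * r) ^ N" if "w \<in> cball 0 (2 * r)" for w
  proof (rule maximum_modulus_frontier[of g "cball 0 (2 * r)"])
    show "norm (g w) \<le> B / (2 * r) ^ N" if "w \<in> frontier (cball 0 (2 * r))" for w
    proof -
      have "norm w = 2 * r" using that r by (simp add: frontier_cball)
      then show ?thesis using B[of w] r by (simp add: fg norm_mult norm_power field_simps)
    qed
  qed (use that g in \<open>auto intro: holomorphic_on_subset holomorphic_on_imp_continuous_on\<close>)
  from this[of z] have "norm (g z) \<le> B / (2 * r) ^ N" using z r by simp
  then have "norm (f z) \<le> r ^ N * (B / (2 * r) ^ N)"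
    unfolding fg norm_mult norm_power using z by (intro mult_mono power_mono) (use r in auto)
  also have "\<dots> = B / 2 ^ N" using r by (simp add: power_mult_distrib)
  finally show ?thesis .
qed

text \<open>
There are \<open>(h + 1)\<^sup>2\<close> products \<open>z\<^sup>i (\<psi> z)\<^sup>l\<close> with \<open>i, l \<le> h\<close>, all of degree at most \<open>2 h\<close>. Some combination
of them vanishes at \<open>0\<close> to order \<open>h\<^sup>2\<close> without being identically zero. Its growth from radius \<open>r\<close>
to radius \<open>2 r\<close> by at least \<open>2\<close> to the power \<open>h\<^sup>2\<close> contradicts the bound \<open>C\<^sup>2\<^sup>h\<close> for large \<open>h\<close>.
\<close>

lemma not_hull_bound_circle:
  assumes \<psi>: "\<psi> holomorphic_on UNIV" and transc: "\<not> (\<exists>q. \<forall>z. \<psi> z = poly q z)"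
    and K: "K \<subseteq> cball 0 r" and r: "0 < r" and C: "1 \<le> C"
  shows "\<exists>z. norm z = 2 * r \<and> \<not> hull_bound \<psi> K (graph_point \<psi> z) C"
proof (rule ccontr)
  assume "\<not> ?thesis"
  then have hb: "\<And>z. norm z = 2 * r \<Longrightarrow> hull_bound \<psi> K (graph_point \<psi> z) C" by blast
  have key: "2 ^ (h * h) \<le> C ^ (2 * h)" for h
  proof -
    define I where "I = {..h} \<times> {..h}"
    define g where "g = (\<lambda>(i, l) z. z ^ i * \<psi> z ^ l)"
    have ghol: "g i holomorphic_on A" for i A
      unfolding g_def by (auto simp: split_beta intro!: holomorphic_intros holomorphic_on_subset[OF \<psi>])
    have "h * h < card I" by (simp add: I_def)
    then obtain c where c: "\<exists>i\<in>I. c i \<noteq> 0" "\<And>j. j < h * h \<Longrightarrow> (\<Sum>i\<in>I. c i * (deriv ^^ j) (g i) 0) = 0"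
      using homogeneous_system_nontrivial_solution[of I "h * h" "\<lambda>i j. (deriv ^^ j) (g i) 0"]
      by (auto simp: I_def)
    define f where "f z = (\<Sum>i\<in>I. c i * g i z)" for z
    have fhol: "f holomorphic_on A" for A
      unfolding f_def by (intro holomorphic_intros ghol)
    have f0: "(deriv ^^ j) f 0 = 0" if "j < h * h" for j
    proof -
      have "(deriv ^^ j) (\<lambda>z. \<Sum>i\<in>J. c i * g i z) 0 = (\<Sum>i\<in>J. c i * (deriv ^^ j) (g i) 0)" if "finite J" for J
        using that
      proof (induction J)
        case (insert i J)
        have "(deriv ^^ j) (\<lambda>z. c i * g i z + (\<Sum>i\<in>J. c i * g i z)) 0 =
            (deriv ^^ j) (\<lambda>z. c i * g i z) 0 + (deriv ^^ j) (\<lambda>z. \<Sum>i\<in>J. c i * g i z) 0"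
          by (rule higher_deriv_add[of _ UNIV]) (auto intro!: holomorphic_intros ghol)
        moreover have "(deriv ^^ j) (\<lambda>z. c i * g i z) 0 = c i * (deriv ^^ j) (g i) 0"
          by (rule higher_deriv_cmult[of _ UNIV]) (auto intro!: ghol)
        ultimately show ?case using insert by simp
      qed simp
      from this[of I] c(2)[OF that] show ?thesis by (simp add: f_def[abs_def] I_def)
    qed
    have fc: "f \<in> curve_polys \<psi> (2 * h)"
      unfolding f_def
    proof (intro curve_polys_sum curve_polys_cmult)
      fix i assume i: "i \<in> I"
      have "(\<lambda>z. z ^ fst i * \<psi> z ^ snd i) \<in> curve_polys \<psi> (fst i * 1 + snd i * 1)"
        by (intro curve_polys_mult curve_polys_power curve_polys_id curve_polys_graph)
      then have "(\<lambda>z. z ^ fst i * \<psi> z ^ snd i) \<in> curve_polys \<psi> (2 * h)"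
        by (rule curve_polys_mono) (use i in \<open>auto simp: I_def\<close>)
      then show "(\<lambda>z. g i z) \<in> curve_polys \<psi> (2 * h)" by (simp add: g_def split_beta)
    qed
    have "\<exists>z. f z \<noteq> 0"
    proof (rule ccontr)
      assume "\<not> ?thesis"
      define a where "a l = (\<Sum>i\<le>h. monom (c (i, l)) i)" for l
      have "(\<Sum>l\<le>h. poly (a l) z * \<psi> z ^ l) = f z" for z
      proof -
        have "f z = (\<Sum>i\<le>h. \<Sum>l\<le>h. c (i, l) * (z ^ i * \<psi> z ^ l))"
          by (simp add: f_def I_def g_def sum.cartesian_product split_beta)
        also have "\<dots> = (\<Sum>l\<le>h. poly (a l) z * \<psi> z ^ l)"
          by (subst sum.swap) (simp add: a_def poly_sum poly_monom sum_distrib_right mult.assoc)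
        finally show ?thesis by simp
      qed
      moreover have "\<exists>l\<le>h. a l \<noteq> 0"
      proof -
        obtain i l where il: "i \<le> h" "l \<le> h" "c (i, l) \<noteq> 0" using c(1) by (auto simp: I_def)
        have "coeff (a l) i = (\<Sum>i'\<le>h. if i' = i then c (i', l) else 0)"
          unfolding a_def coeff_sum by (intro sum.cong) auto
        then have "coeff (a l) i = c (i, l)" using il by simp
        then show ?thesis using il by (intro exI[of _ l]) auto
      qed
      ultimately show False
        using entire_algebraic_imp_polynomial[OF \<psi>, of a h] transc \<open>\<not> (\<exists>z. f z \<noteq> 0)\<close> by auto
    qed
    then obtain z1 where z1: "f z1 \<noteq> 0" by blast
    have "\<exists>z\<in>cball 0 r. \<forall>w\<in>cball 0 r. norm (f w) \<le> norm (f z)"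
      using r by (intro continuous_attains_sup) (auto intro!: continuous_intros holomorphic_on_imp_continuous_on fhol)
    then obtain zm where zm: "norm zm \<le> r" "\<And>w. norm w \<le> r \<Longrightarrow> norm (f w) \<le> norm (f zm)"
      by auto
    define s where "s = norm (f zm)"
    have "s \<noteq> 0"
    proof
      assume "s = 0"
      then have "f w = 0" if "w \<in> ball 0 r" for w using zm(2)[of w] that by (simp add: s_def)
      then have "f z1 = 0"
        using analytic_continuation_open[of "ball 0 r" UNIV f "\<lambda>_. 0" z1] r fhol by auto
      then show False using z1 by simp
    qed
    then have s: "0 < s" by (simp add: s_def)
    obtain p where p: "p \<in> hompoly (2 * h)" "f = (\<lambda>z. p (graph_point \<psi> z))"
      using curve_polysE[OF fc] by blast
    have "norm (f z) \<le> s * C ^ (2 * h)" if "norm z = 2 * r" for z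
    proof -
      have "norm (of_real (1 / s) * p (graph_point \<psi> z)) \<le> C ^ (2 * h)"
      proof (rule hull_boundD[OF hb[OF that] hompoly_cmult[OF p(1)]])
        fix w assume "w \<in> K"
        then have "norm w \<le> r" using K by auto
        then show "norm (of_real (1 / s) * p (graph_point \<psi> w)) \<le> 1"
          using zm(2)[of w] s by (simp add: norm_mult norm_divide p(2) s_def)
      qed
      then show ?thesis using s by (simp add: norm_mult norm_divide p(2) field_simps)
    qed
    from high_order_zero_decay[OF fhol f0 r this zm(1)]
    have "s \<le> s * C ^ (2 * h) / 2 ^ (h * h)" by (simp add: s_def)
    then show ?thesis using s by (simp add: field_simps)
  qed
  obtain h :: nat where h: "C\<^sup>2 < 2 ^ h" using real_arch_pow[of 2 "C\<^sup>2"] by auto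
  then have h0: "0 < h" using one_le_power[OF C, of 2] by (cases h) auto
  have "(C\<^sup>2) ^ h < (2 ^ h) ^ h" using h h0 by (intro power_strict_mono) auto
  then have "C ^ (2 * h) < 2 ^ (h * h)" by (simp add: power_mult[symmetric])
  then show False using key[of h] by simp
qed

text \<open>
By \<open>hull_bound_nearby\<close> the points with a hull bound form a relatively open and closed subset of the connected
set \<open>outside K\<close>. If it is not empty, compactness gives one constant on a large circle, against
\<open>not_hull_bound_circle\<close>.
\<close>

lemma not_hull_bound_outside:
  assumes \<psi>: "\<psi> holomorphic_on UNIV" and transc: "\<not> (\<exists>q. \<forall>z. \<psi> z = poly q z)"
    and K: "compact K" and a: "a \<in> outside K" and C: "1 \<le> C"
  shows "\<not> hull_bound \<psi> K (graph_point \<psi> a) C"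
proof
  assume hb: "hull_bound \<psi> K (graph_point \<psi> a) C"
  define U where "U = outside K"
  define T where "T = {z \<in> U. \<exists>C\<ge>1. hull_bound \<psi> K (graph_point \<psi> z) C}"
  have openU: "open U" unfolding U_def using K by (intro open_outside compact_imp_closed)
  have U: "U \<inter> K = {}" by (auto simp: U_def outside_def)
  obtain r where r: "0 < r" "K \<subseteq> cball 0 r"
    using compact_imp_bounded[OF K] unfolding bounded_pos by (metis mem_cball_0 subsetI)
  define spreads where "spreads V \<longleftrightarrow> (\<forall>w\<in>V. \<forall>C\<ge>1. hull_bound \<psi> K (graph_point \<psi> w) C \<longrightarrow>
    (\<forall>v\<in>V. hull_bound \<psi> K (graph_point \<psi> v) (C ^ 6)))" for V
  have near: "\<exists>e>0. ball z e \<subseteq> U \<and> spreads (ball z e)" if z: "z \<in> U" for z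
  proof -
    obtain \<delta> where \<delta>: "0 < \<delta>" "ball z \<delta> \<subseteq> U" using openU z by (meson open_contains_ball)
    have "hull_bound \<psi> K (graph_point \<psi> v) (C ^ 6)"
      if w: "w \<in> ball z (\<delta> / 16)" and v: "v \<in> ball z (\<delta> / 16)" and C: "1 \<le> C"
        and hw: "hull_bound \<psi> K (graph_point \<psi> w) C" for w v C
    proof (rule hull_bound_nearby[OF \<psi> r(2) _ _ C hw])
      show "2 * (\<delta> / 4) \<le> norm (x - w)" if "x \<in> K" for x
      proof -
        have "x \<notin> ball z \<delta>" using that \<delta> U by auto
        then have "\<delta> \<le> dist z x" by simp
        moreover have "dist z x \<le> dist z w + dist w x" by (rule dist_triangle)
        ultimately show ?thesis using w \<delta>(1) by (simp add: dist_norm norm_minus_commute)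
      qed
      show "norm (v - w) \<le> \<delta> / 4 / 2"
        using w v dist_triangle2[of v w z] by (simp add: dist_norm norm_minus_commute)
    qed (use \<delta> in simp)
    then show ?thesis
      using \<delta> by (intro exI[of _ "\<delta> / 16"]) (auto simp: spreads_def intro: subsetD[OF subset_ball])
  qed
  have one6: "1 \<le> C ^ 6" if "1 \<le> C" for C :: real using that by simp
  have "openin (top_of_set U) T"
    unfolding openin_contains_ball
  proof (intro conjI ballI)
    fix z assume z: "z \<in> T"
    then obtain C where C: "1 \<le> C" "hull_bound \<psi> K (graph_point \<psi> z) C" "z \<in> U" by (auto simp: T_def)
    obtain e where e: "0 < e" "ball z e \<subseteq> U" "spreads (ball z e)" using near[OF C(3)] by blast
    have "ball z e \<inter> U \<subseteq> T"
    proof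
      fix v assume "v \<in> ball z e \<inter> U"
      then have v: "v \<in> ball z e" "v \<in> U" by auto
      have "hull_bound \<psi> K (graph_point \<psi> v) (C ^ 6)"
        using e(3)[unfolded spreads_def, rule_format, of z C v] e(1) C v by simp
      then show "v \<in> T" using v one6[OF C(1)] unfolding T_def by blast
    qed
    then show "\<exists>e>0. ball z e \<inter> U \<subseteq> T" using e by blast
  qed (auto simp: T_def)
  moreover have "openin (top_of_set U) (U - T)"
    unfolding openin_contains_ball
  proof (intro conjI ballI)
    fix z assume z: "z \<in> U - T"
    obtain e where e: "0 < e" "ball z e \<subseteq> U" "spreads (ball z e)" using near[of z] z by blast
    have "ball z e \<inter> U \<subseteq> U - T"
    proof
      fix w assume w: "w \<in> ball z e \<inter> U"
      have "w \<notin> T"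
      proof
        assume "w \<in> T"
        then obtain C where "1 \<le> C" "hull_bound \<psi> K (graph_point \<psi> w) C" by (auto simp: T_def)
        then have "hull_bound \<psi> K (graph_point \<psi> z) (C ^ 6)" using e w by (auto simp: spreads_def)
        then have "z \<in> T" using z one6[OF \<open>1 \<le> C\<close>] unfolding T_def by blast
        then show False using z by simp
      qed
      then show "w \<in> U - T" using w by simp
    qed
    then show "\<exists>e>0. ball z e \<inter> U \<subseteq> U - T" using e by blast
  qed auto
  then have "closedin (top_of_set U) T"
    by (auto simp: closedin_def T_def)
  moreover have "connected U"
    unfolding U_def using compact_imp_bounded[OF K] by (intro connected_outside) simp_all
  moreover have "a \<in> T" using hb a C by (auto simp: T_def U_def)
  ultimately have TU: "T = U" by (metis connected_clopen empty_iff)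
  define \<Gamma> where "\<Gamma> = sphere (0 :: complex) (2 * r)"
  have \<Gamma>U: "\<Gamma> \<subseteq> U"
  proof
    fix z assume z: "z \<in> \<Gamma>"
    have "- cball 0 r \<subseteq> outside (cball (0 :: complex) r)"
      by (simp add: outside_convex)
    also have "\<dots> \<subseteq> U" unfolding U_def using r by (intro outside_mono)
    finally show "z \<in> U" using z r by (auto simp: \<Gamma>_def)
  qed
  have "\<exists>C\<ge>1. \<forall>z\<in>\<Gamma>. hull_bound \<psi> K (graph_point \<psi> z) C"
  proof -
    have "\<forall>z\<in>\<Gamma>. \<exists>e D. 0 < e \<and> 1 \<le> D \<and> (\<forall>v\<in>ball z e. hull_bound \<psi> K (graph_point \<psi> v) D)"
    proof
      fix z assume "z \<in> \<Gamma>"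
      then have z: "z \<in> T" using \<Gamma>U TU by auto
      then obtain C where C: "1 \<le> C" "hull_bound \<psi> K (graph_point \<psi> z) C" "z \<in> U" by (auto simp: T_def)
      obtain e where e: "0 < e" "spreads (ball z e)" using near[OF C(3)] by blast
      then show "\<exists>e D. 0 < e \<and> 1 \<le> D \<and> (\<forall>v\<in>ball z e. hull_bound \<psi> K (graph_point \<psi> v) D)"
        using C one6[OF C(1)] e(1) e(2)[unfolded spreads_def, rule_format, of z C]
        by (intro exI[of _ e] exI[of _ "C ^ 6"]) auto
    qed
    then obtain e D where eD: "\<And>z. z \<in> \<Gamma> \<Longrightarrow> 0 < e z" "\<And>z. z \<in> \<Gamma> \<Longrightarrow> 1 \<le> D z"
      "\<And>z v. z \<in> \<Gamma> \<Longrightarrow> v \<in> ball z (e z) \<Longrightarrow> hull_bound \<psi> K (graph_point \<psi> v) (D z)"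
      by metis
    have "compact \<Gamma>" by (simp add: \<Gamma>_def)
    then obtain Y where Y: "Y \<subseteq> \<Gamma>" "finite Y" "\<Gamma> \<subseteq> (\<Union>z\<in>Y. ball z (e z))"
      by (rule compactE_image[of \<Gamma> \<Gamma> "\<lambda>z. ball z (e z)"]) (use eD in auto)
    define M where "M = Max (insert 1 (D ` Y))"
    have M: "1 \<le> M" "\<And>y. y \<in> Y \<Longrightarrow> D y \<le> M" using Y by (auto simp: M_def)
    have "hull_bound \<psi> K (graph_point \<psi> z) M" if z: "z \<in> \<Gamma>" for z
    proof -
      obtain y where y: "y \<in> Y" "z \<in> ball y (e y)" using Y z by blast
      then have "y \<in> \<Gamma>" using Y by auto
      have "0 \<le> D y" using eD(2)[OF \<open>y \<in> \<Gamma>\<close>] by simp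
      then show ?thesis
        using hull_bound_mono[OF eD(3)[OF \<open>y \<in> \<Gamma>\<close> y(2)] order_refl _ M(2)[OF y(1)]] by simp
    qed
    then show ?thesis using M by blast
  qed
  then obtain C where "1 \<le> C" "\<And>z. norm z = 2 * r \<Longrightarrow> hull_bound \<psi> K (graph_point \<psi> z) C"
    by (auto simp: \<Gamma>_def)
  then show False using not_hull_bound_circle[OF \<psi> transc r(2,1)] by blast
qed

section \<open>Points off the graph and at infinity\<close>

lemma hull_bound_scale:
  assumes "hull_bound \<psi> K X C" shows "hull_bound \<psi> K (c *s X) (norm c * C)"
  unfolding hull_bound_def
proof (intro allI ballI impI)
  fix k p assume p: "p \<in> hompoly k" "\<forall>z\<in>K. norm (p (graph_point \<psi> z)) \<le> 1"
  then have "norm (p X) \<le> C ^ k" using assms by (simp add: hull_bound_def)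
  then show "norm (p (c *s X)) \<le> (norm c * C) ^ k"
    by (simp add: hompoly_scale[OF p(1)] norm_mult norm_power power_mult_distrib mult_left_mono)
qed

lemma hompoly_homogenized_graph:
  assumes "degree s \<le> n" "1 \<le> n"
  shows "\<exists>p\<in>hompoly n. \<forall>X. X $ 1 = 1 \<longrightarrow> p X = X $ 3 - poly s (X $ 2)"
proof -
  define p where "p X = X $ 3 * (X $ 1) ^ (n - 1) + (\<Sum>i\<le>n. - coeff s i * ((X $ 2) ^ i * (X $ 1) ^ (n - i)))"
    for X :: "complex ^ 3"
  have "(\<lambda>X. X $ 3 * (X $ 1) ^ (n - 1)) \<in> hompoly (1 + (n - 1) * 1)"
    by (intro hompoly_mult hompoly_coord hompoly_power)
  moreover have "(\<lambda>X. \<Sum>i\<le>n. - coeff s i * ((X $ 2) ^ i * (X $ 1) ^ (n - i))) \<in> hompoly n"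
  proof (intro hompoly_sum hompoly_cmult)
    fix i assume "i \<in> {..n}"
    moreover have "(\<lambda>X. (X $ 2) ^ i * (X $ 1) ^ (n - i)) \<in> hompoly (i * 1 + (n - i) * 1)"
      by (intro hompoly_mult hompoly_coord hompoly_power)
    ultimately show "(\<lambda>X. (X $ 2) ^ i * (X $ 1) ^ (n - i)) \<in> hompoly n" by simp
  qed
  ultimately have "p \<in> hompoly n"
    using hompoly_add[of _ n] assms(2) by (simp add: p_def[abs_def])
  moreover have "p X = X $ 3 - poly s (X $ 2)" if "X $ 1 = 1" for X
  proof -
    have "poly s x = (\<Sum>i\<le>n. coeff s i * x ^ i)" for x
      unfolding poly_altdef using assms(1)
      by (intro sum.mono_neutral_left) (auto simp: coeff_eq_0)
    then show ?thesis using that by (simp add: p_def sum_negf)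
  qed
  ultimately show ?thesis by blast
qed

text \<open>
The form that restricts to \<open>w - s z\<close>, with \<open>s\<close> a Taylor polynomial of \<open>\<psi>\<close> of degree \<open>n\<close>, is smaller on \<open>K\<close>
than any given geometric sequence in \<open>n\<close>, but at \<open>Y\<close> it tends to \<open>Y $ 3 - \<psi> (Y $ 2)\<close>, which is not zero.
\<close>

lemma not_hull_bound_off_graph:
  assumes \<psi>: "\<psi> holomorphic_on UNIV" and K: "bounded K" and Y: "Y $ 1 = 1" "Y $ 3 \<noteq> \<psi> (Y $ 2)" and C: "1 \<le> C"
  shows "\<not> hull_bound \<psi> K Y C"
proof
  assume hb: "hull_bound \<psi> K Y C"
  define a where "a = Y $ 2"
  define b where "b = Y $ 3"
  obtain R0 where R0: "\<And>z. z \<in> K \<Longrightarrow> norm z \<le> R0" using K by (auto simp: bounded_iff)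
  define R where "R = max 1 (max R0 (norm a))"
  have R: "1 \<le> R" "norm a \<le> R" "\<And>z. z \<in> K \<Longrightarrow> norm z \<le> R" using R0 by (auto simp: R_def le_max_iff_disj)
  define B where "B = 2 * R * C"
  have "1 * 1 \<le> R * C" using R C by (intro mult_mono) auto
  then have B: "1 \<le> B" by (simp add: B_def)
  obtain n0 where n0: "\<And>n. n0 \<le> n \<Longrightarrow> \<exists>s. lipschitz_remainder \<psi> R n s (1 / B ^ n) \<and> poly s 0 = \<psi> 0"
    using taylor_remainder_lipschitz[OF \<psi> R(1) B] by blast
  define \<beta> where "\<beta> = norm (b - \<psi> a)"
  have \<beta>: "0 < \<beta>" using Y by (simp add: \<beta>_def a_def b_def)
  have key: "\<beta> \<le> 2 * R * (1 / 2) ^ n" if n: "max 1 n0 \<le> n" for n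
  proof -
    from n0[of n] n obtain s where "lipschitz_remainder \<psi> R n s (1 / B ^ n)" "poly s 0 = \<psi> 0" by auto
    then have s: "degree s \<le> n" "poly s 0 = \<psi> 0"
      "\<And>\<zeta> z. norm \<zeta> \<le> R \<Longrightarrow> norm z \<le> R \<Longrightarrow>
        norm ((\<psi> \<zeta> - poly s \<zeta>) - (\<psi> z - poly s z)) \<le> 1 / B ^ n * norm (\<zeta> - z)"
      by (simp_all add: lipschitz_remainder_def)
    have rem: "norm (\<psi> z - poly s z) \<le> R / B ^ n" if "norm z \<le> R" for z
    proof -
      have "norm (\<psi> z - poly s z) \<le> 1 / B ^ n * norm z" using s(3)[OF that, of 0] s(2) R by simp
      also have "\<dots> \<le> 1 / B ^ n * R" using that B by (intro mult_left_mono) auto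
      finally show ?thesis by simp
    qed
    obtain p where p: "p \<in> hompoly n" "\<And>X. X $ 1 = 1 \<Longrightarrow> p X = X $ 3 - poly s (X $ 2)"
      using hompoly_homogenized_graph[OF s(1)] n by auto
    have "norm (of_real (B ^ n / R) * p Y) \<le> C ^ n"
    proof (rule hull_boundD[OF hb hompoly_cmult[OF p(1)]])
      fix z assume "z \<in> K"
      then have "norm (\<psi> z - poly s z) \<le> R / B ^ n" using rem R by simp
      then have "B ^ n / R * norm (\<psi> z - poly s z) \<le> B ^ n / R * (R / B ^ n)"
        using R B by (intro mult_left_mono) auto
      then show "norm (of_real (B ^ n / R) * p (graph_point \<psi> z)) \<le> 1"
        using R B unfolding norm_mult norm_of_real by (simp add: p(2))
    qed
    then have "B ^ n / R * norm (b - poly s a) \<le> C ^ n"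
      using R B Y unfolding norm_mult norm_of_real by (simp add: p(2) a_def b_def)
    then have 1: "norm (b - poly s a) \<le> R * (C ^ n / B ^ n)"
      using R B by (simp add: field_simps)
    have "\<beta> \<le> norm (b - poly s a) + norm (\<psi> a - poly s a)"
      unfolding \<beta>_def using norm_triangle_ineq4[of "b - poly s a" "\<psi> a - poly s a"] by simp
    also have "\<dots> \<le> R * (C ^ n / B ^ n) + R / B ^ n"
      using 1 rem[OF R(2)] by (rule add_mono)
    also have "R / B ^ n \<le> R * (C ^ n / B ^ n)"
      using R B one_le_power[OF C, of n] by (simp add: divide_simps)
    also have "C ^ n / B ^ n = (1 / (2 * R)) ^ n"
    proof -
      have "C / B = 1 / (2 * R)" using C R by (simp add: B_def)
      then show ?thesis by (metis power_divide)
    qed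
    also have "(1 / (2 * R)) ^ n \<le> (1 / 2) ^ n"
      using R by (intro power_mono) (auto simp: divide_simps)
    finally show ?thesis using R by (simp add: mult_left_mono)
  qed
  have "\<forall>\<^sub>F n in sequentially. 2 * R * (1 / 2) ^ n < \<beta>"
    using \<beta> R(1) by real_asymp
  then obtain n1 where n1: "\<And>n. n1 \<le> n \<Longrightarrow> 2 * R * (1 / 2) ^ n < \<beta>"
    by (auto simp: eventually_sequentially)
  show False using n1[of "max n1 (max 1 n0)"] key[of "max n1 (max 1 n0)"] by simp
qed

text \<open>
Let \<open>lin\<close> be a linear form with \<open>lin X = 1\<close>. A representing measure for \<open>X\<close> in degree \<open>m\<close> annihilates all
polynomials of smaller degree, since their homogenisations vanish on the line at infinity, and gives
\<open>lin\<^sup>m\<close> the integral \<open>1\<close>. No point of a large circle has a hull bound for a disc inside it that contains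
\<open>K\<close>. So among finitely many polynomials, bounded by \<open>1\<close> on this disc, there is a huge one at every point of the
circle, and the annihilation of its difference quotient makes the Cauchy transform of the measure tiny at that
point. Cauchy's formula recovers the
integral of \<open>lin\<^sup>m\<close> from the Cauchy transform and so makes it smaller than \<open>1\<close>.
\<close>

lemma not_hull_bound_at_infinity:
  assumes \<psi>: "\<psi> holomorphic_on UNIV" and transc: "\<not> (\<exists>q. \<forall>z. \<psi> z = poly q z)"
    and K: "bounded K" and X: "X $ 1 = 0" "X \<noteq> 0" and C: "1 \<le> C"
  shows "\<not> hull_bound \<psi> K X C"
proof
  assume hbK: "hull_bound \<psi> K X C"
  obtain r0 where r0: "\<And>z. z \<in> K \<Longrightarrow> norm z \<le> r0" using K by (auto simp: bounded_iff)
  define r where "r = max 1 r0"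
  have r: "1 \<le> r" by (simp add: r_def)
  define K0 where "K0 = cball (0 :: complex) r"
  have "K \<subseteq> K0" using r0 by (auto simp: K0_def r_def le_max_iff_disj)
  then have hb: "hull_bound \<psi> K0 X C" using hull_bound_mono[OF hbK _ _ order_refl] C by simp
  obtain i where i: "X $ i \<noteq> 0" using X(2) by (auto simp: vec_eq_iff)
  define lin where "lin Y = 1 / X $ i * Y $ i" for Y
  have lin: "lin \<in> hompoly 1" unfolding lin_def[abs_def] by (intro hompoly_cmult hompoly_coord)
  have linX: "lin X = 1" using i by (simp add: lin_def)
  define L where "L z = lin (graph_point \<psi> z)" for z
  have Lc: "L \<in> curve_polys \<psi> 1" using curve_polysI[OF lin, of \<psi>] by (simp add: L_def[abs_def])
  have Lhol: "L holomorphic_on A" for A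
    using curve_polys_holomorphic[OF \<psi> Lc] holomorphic_on_subset by blast
  obtain \<Lambda> where \<Lambda>: "1 \<le> \<Lambda>" "\<And>z. norm z \<le> 2 * r \<Longrightarrow> norm (L z) \<le> \<Lambda>"
    using curve_polys_bounded[OF \<psi> Lc] by blast
  define D where "D = \<Lambda> * C"
  have D: "1 \<le> D" using mult_mono[of 1 \<Lambda> 1 C] \<Lambda> C by (simp add: D_def)
  \<comment> \<open>The exponent of \<open>M\<close> will be about half of \<open>m\<close>, so its square root has to beat \<open>\<Lambda> * C\<close>.\<close>
  define M where "M = 2 * D\<^sup>2"
  have M: "1 \<le> M" using power_mono[OF D, of 2] by (simp add: M_def)
  define \<Gamma> where "\<Gamma> = sphere (0 :: complex) (2 * r)"
  have ex: "\<exists>k F. 1 \<le> k \<and> F \<in> curve_polys \<psi> k \<and> (\<forall>z\<in>K0. norm (F z) \<le> 1) \<and> M ^ k < norm (F \<zeta>)"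
    if \<zeta>: "\<zeta> \<in> \<Gamma>" for \<zeta>
  proof -
    have "\<zeta> \<in> outside K0" using \<zeta> r by (simp add: K0_def \<Gamma>_def outside_convex)
    then have "\<not> hull_bound \<psi> K0 (graph_point \<psi> \<zeta>) M"
      using not_hull_bound_outside[OF \<psi> transc _ _ M] by (simp add: K0_def)
    then obtain k p where p: "p \<in> hompoly k" "\<forall>z\<in>K0. norm (p (graph_point \<psi> z)) \<le> 1"
      "M ^ k < norm (p (graph_point \<psi> \<zeta>))"
      unfolding hull_bound_def by (auto simp: not_le)
    have "k \<noteq> 0"
    proof
      assume "k = 0"
      moreover have "0 \<in> K0" using r by (simp add: K0_def)
      ultimately show False
        using p hompoly_0_const[of p "graph_point \<psi> \<zeta>" "graph_point \<psi> 0"] by force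
    qed
    then show ?thesis
      using p curve_polysI[OF p(1), of \<psi>]
      by (intro exI[of _ k] exI[of _ "\<lambda>z. p (graph_point \<psi> z)"]) auto
  qed
  then obtain k F where kF: "\<And>\<zeta>. \<zeta> \<in> \<Gamma> \<Longrightarrow> 1 \<le> k \<zeta>" "\<And>\<zeta>. \<zeta> \<in> \<Gamma> \<Longrightarrow> F \<zeta> \<in> curve_polys \<psi> (k \<zeta>)"
    "\<And>\<zeta> z. \<zeta> \<in> \<Gamma> \<Longrightarrow> z \<in> K0 \<Longrightarrow> norm (F \<zeta> z) \<le> 1" "\<And>\<zeta>. \<zeta> \<in> \<Gamma> \<Longrightarrow> M ^ k \<zeta> < norm (F \<zeta> \<zeta>)"
    by metis
  have "compact \<Gamma>" by (simp add: \<Gamma>_def)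
  moreover have "open {z. M ^ k \<zeta> < norm (F \<zeta> z)}" if "\<zeta> \<in> \<Gamma>" for \<zeta>
    by (intro open_Collect_less continuous_intros holomorphic_on_imp_continuous_on
        curve_polys_holomorphic[OF \<psi> kF(2)[OF that]])
  ultimately obtain Y where Y: "Y \<subseteq> \<Gamma>" "finite Y" "\<Gamma> \<subseteq> (\<Union>\<zeta>\<in>Y. {z. M ^ k \<zeta> < norm (F \<zeta> z)})"
    by (rule compactE_image[of \<Gamma> \<Gamma> "\<lambda>\<zeta>. {z. M ^ k \<zeta> < norm (F \<zeta> z)}"]) (use kF(4) in auto)
  \<comment> \<open>Powers bring all the polynomials to one degree.\<close>
  define kk where "kk = prod k Y"
  have kk: "1 \<le> kk" unfolding kk_def using kF(1) Y(1) by (intro prod_ge_1) auto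
  define G where "G y z = F y z ^ (kk div k y)" for y z
  have kdvd: "kk div k y * k y = kk" if "y \<in> Y" for y
    unfolding kk_def by (rule dvd_div_mult_self[OF dvd_prodI[OF Y(2) that]])
  have G: "G y \<in> curve_polys \<psi> kk" if "y \<in> Y" for y
    using curve_polys_power[OF kF(2), of y "kk div k y"] kdvd[OF that] that Y(1)
    by (auto simp: G_def[abs_def])
  have G1: "norm (G y z) \<le> 1" if "y \<in> Y" "z \<in> K0" for y z
    using kF(3)[of y z] that Y(1) by (auto simp: G_def norm_power power_le_one)
  have G_big: "\<exists>y\<in>Y. M ^ kk < norm (G y \<zeta>)" if \<zeta>: "\<zeta> \<in> \<Gamma>" for \<zeta>
  proof -
    obtain y where y: "y \<in> Y" "M ^ k y < norm (F y \<zeta>)" using Y(3) \<zeta> by auto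
    have "kk div k y \<noteq> 0" using kdvd[OF y(1)] kk by (metis mult_0 not_one_le_zero)
    then have "(M ^ k y) ^ (kk div k y) < norm (F y \<zeta>) ^ (kk div k y)"
      using y(2) M by (intro power_strict_mono) auto
    moreover have "(M ^ k y) ^ (kk div k y) = M ^ kk"
      using kdvd[OF y(1)] by (simp add: power_mult[symmetric] mult.commute)
    ultimately show ?thesis using y(1) by (auto simp: G_def norm_power)
  qed
  define \<kappa> where "\<kappa> = real kk"
  have "\<forall>\<^sub>F N in sequentially. \<forall>y\<in>Y. \<forall>\<zeta>. norm \<zeta> \<le> 2 * r \<longrightarrow> (\<exists>Q\<in>curve_polys \<psi> (2 * (N * kk)).
    \<forall>z. norm z \<le> 2 * r \<longrightarrow> norm (G y \<zeta> ^ N - G y z ^ N - (\<zeta> - z) * Q z) \<le> 1 / 1 ^ N * norm (\<zeta> - z))"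
    by (intro eventually_ball_finite[OF Y(2)] ballI power_difference_quotient_approx[OF \<psi> _ G kk order_refl])
      (use r in simp_all)
  moreover have "\<forall>\<^sub>F N in sequentially. 8 * r * (2 * (real N * \<kappa>) + 2) ^ 3 * D * (1 / 2) ^ N < 1"
  proof -
    have "0 < \<kappa>" "0 < r" "0 < D" using kk r D by (auto simp: \<kappa>_def)
    then show ?thesis by real_asymp
  qed
  ultimately have "\<forall>\<^sub>F N in sequentially. False"
  proof eventually_elim
    case (elim N)
    define m where "m = Suc (2 * (N * kk))"
    obtain d x \<mu> where d: "d \<le> (m + 1) ^ 3" and x: "\<And>j. j < d \<Longrightarrow> x j \<in> K0"
      and \<mu>: "\<And>j. j < d \<Longrightarrow> norm (\<mu> j) \<le> 2 * C ^ m"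
      and repr: "\<And>q. q \<in> hompoly m \<Longrightarrow> q X = (\<Sum>j<d. \<mu> j * q (graph_point \<psi> (x j)))"
      using hull_bound_representing_measure[OF \<psi> _ hb] unfolding K0_def by blast
    define P where "P = 2 * (real m + 1) ^ 3"
    have P: "0 \<le> P" by (simp add: P_def)
    define \<Phi> where "\<Phi> \<zeta> = (\<Sum>j<d. \<mu> j / (\<zeta> - x j))" for \<zeta>
    have \<Phi>_le: "norm (\<Phi> \<zeta>) \<le> 2 * P * C ^ m / M ^ (kk * N)" if \<zeta>: "\<zeta> \<in> \<Gamma>" for \<zeta>
    proof -
      obtain y where y: "y \<in> Y" "M ^ kk < norm (G y \<zeta>)" using G_big[OF \<zeta>] by blast
      have n\<zeta>: "norm \<zeta> = 2 * r" using \<zeta> by (simp add: \<Gamma>_def)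
      have dist: "r \<le> norm (\<zeta> - x j)" if "j < d" for j
        using x[OF that] n\<zeta> norm_triangle_ineq2[of \<zeta> "x j"] by (simp add: K0_def)
      have inK: "norm (x j) \<le> 2 * r" if "j < d" for j using x[OF that] r by (simp add: K0_def)
      from elim(1)[rule_format, OF y(1), of \<zeta>] n\<zeta> obtain Q where Q: "Q \<in> curve_polys \<psi> (2 * (N * kk))"
        and QE: "\<And>z. norm z \<le> 2 * r \<Longrightarrow> norm (G y \<zeta> ^ N - G y z ^ N - (\<zeta> - z) * Q z) \<le> norm (\<zeta> - z)"
        by auto
      obtain q where q: "q \<in> hompoly (2 * (N * kk))" "Q = (\<lambda>z. q (graph_point \<psi> z))"
        using curve_polysE[OF Q] by blast
      \<comment> \<open>Here \<open>m\<close> is one more than the degree of \<open>q\<close>, so there is room for a factor that vanishes at \<open>X\<close>.\<close>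
      have "(\<lambda>Z. Z $ 1 * q Z) \<in> hompoly m"
        using hompoly_mult[OF hompoly_coord[of 1] q(1)] by (simp add: m_def)
      from repr[OF this] have Q0: "(\<Sum>j<d. \<mu> j * Q (x j)) = 0" by (simp add: X q(2))
      have "norm (G y \<zeta> ^ N * \<Phi> \<zeta> - (\<Sum>j<d. \<mu> j * Q (x j))) \<le> real d * (2 * C ^ m * (1 / r + 1))"
        unfolding \<Phi>_def by (rule cauchy_transform_estimate[where F = "G y", OF _ dist \<mu>])
          (use r G1[OF y(1) x] QE[OF inK] in auto)
      also have "\<dots> \<le> real d * (2 * C ^ m * 2)"
        using r C by (intro mult_left_mono) (auto simp: divide_simps)
      also have "\<dots> \<le> real ((m + 1) ^ 3) * (2 * C ^ m * 2)"
        using d C by (intro mult_right_mono) (simp_all only: of_nat_le_iff, simp)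
      finally have 2: "norm (G y \<zeta>) ^ N * norm (\<Phi> \<zeta>) \<le> 2 * P * C ^ m"
        by (simp add: Q0 P_def norm_mult norm_power mult_ac add_ac)
      have "M ^ (kk * N) * norm (\<Phi> \<zeta>) \<le> norm (G y \<zeta>) ^ N * norm (\<Phi> \<zeta>)"
        unfolding power_mult using y(2) M by (intro mult_right_mono power_mono) auto
      with 2 have "M ^ (kk * N) * norm (\<Phi> \<zeta>) \<le> 2 * P * C ^ m" by linarith
      moreover have "0 < M ^ (kk * N)" using M by simp
      ultimately show ?thesis by (simp add: pos_le_divide_eq mult.commute)
    qed
    have "(\<lambda>Y. lin Y ^ m) \<in> hompoly m" using hompoly_power[OF lin, of m] by simp
    from repr[OF this] have one: "(\<Sum>j<d. \<mu> j * L (x j) ^ m) = 1" by (simp add: linX L_def)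
    have "((\<lambda>u. \<Sum>j<d. \<mu> j * (L u ^ m / (u - x j))) has_contour_integral
        (\<Sum>j<d. \<mu> j * (2 * of_real pi * \<i> * L (x j) ^ m))) (circlepath 0 (2 * r))"
    proof (intro has_contour_integral_sum has_contour_integral_lmul)
      fix j assume "j \<in> {..<d}"
      then have "norm (x j - 0) < 2 * r" using x[of j] r by (simp add: K0_def)
      then show "((\<lambda>u. L u ^ m / (u - x j)) has_contour_integral (2 * of_real pi * \<i> * L (x j) ^ m))
          (circlepath 0 (2 * r))"
        by (intro Cauchy_integral_circlepath)
          (auto intro!: holomorphic_intros holomorphic_on_imp_continuous_on Lhol continuous_intros)
    qed simp
    moreover have "(\<Sum>j<d. \<mu> j * (2 * of_real pi * \<i> * L (x j) ^ m)) = 2 * of_real pi * \<i>"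
    proof -
      have "(\<Sum>j<d. \<mu> j * (2 * of_real pi * \<i> * L (x j) ^ m)) = 2 * of_real pi * \<i> * (\<Sum>j<d. \<mu> j * L (x j) ^ m)"
        unfolding sum_distrib_left by (intro sum.cong refl mult.left_commute)
      then show ?thesis by (simp add: one)
    qed
    moreover have "(\<lambda>u. \<Sum>j<d. \<mu> j * (L u ^ m / (u - x j))) = (\<lambda>u. L u ^ m * \<Phi> u)"
      by (simp add: \<Phi>_def sum_distrib_left mult_ac)
    ultimately have int: "((\<lambda>u. L u ^ m * \<Phi> u) has_contour_integral 2 * of_real pi * \<i>) (circlepath 0 (2 * r))"
      by simp
    have "norm (2 * of_real pi * \<i> :: complex) \<le> \<Lambda> ^ m * (2 * P * C ^ m / M ^ (kk * N)) * (2 * pi * (2 * r))"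
    proof (rule has_contour_integral_bound_circlepath[OF int])
      fix u :: complex assume u: "norm (u - 0) = 2 * r"
      then have "u \<in> \<Gamma>" by (simp add: \<Gamma>_def)
      from \<Phi>_le[OF this] \<Lambda>(2)[of u] \<Lambda>(1) u
      show "norm (L u ^ m * \<Phi> u) \<le> \<Lambda> ^ m * (2 * P * C ^ m / M ^ (kk * N))"
        unfolding norm_mult norm_power by (intro mult_mono power_mono) auto
    qed (use r P C M \<Lambda> in auto)
    then have "2 * pi * 1 \<le> 2 * pi * (\<Lambda> ^ m * (2 * P * C ^ m / M ^ (kk * N)) * (2 * r))"
      by (simp add: norm_mult mult_ac)
    then have "1 \<le> \<Lambda> ^ m * (2 * P * C ^ m / M ^ (kk * N)) * (2 * r)"
      by (rule mult_left_le_imp_le) simp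
    also have "\<dots> = 8 * r * (2 * (real N * \<kappa>) + 2) ^ 3 * (D ^ m / M ^ (kk * N))"
      by (simp add: P_def D_def power_mult_distrib \<kappa>_def m_def algebra_simps)
    also have "D ^ m / M ^ (kk * N) = D * (1 / 2) ^ (kk * N)"
    proof -
      have "D ^ m = D * (D\<^sup>2) ^ (kk * N)" by (simp add: m_def power_mult[symmetric] mult_ac)
      then show ?thesis using D by (simp add: M_def power_mult_distrib power_divide)
    qed
    also have "8 * r * (2 * (real N * \<kappa>) + 2) ^ 3 * (D * (1 / 2) ^ (kk * N)) \<le>
        8 * r * (2 * (real N * \<kappa>) + 2) ^ 3 * (D * (1 / 2) ^ N)"
      using r D kk by (intro mult_left_mono power_decreasing) (auto simp: \<kappa>_def)
    finally show False using elim(2) by (simp add: mult.assoc)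
  qed
  then show False by simp
qed

lemma not_hull_bound:
  assumes \<psi>: "\<psi> holomorphic_on UNIV" and transc: "\<not> (\<exists>q. \<forall>z. \<psi> z = poly q z)"
    and K: "compact K" and X: "X \<noteq> 0" "\<And>z c. z \<notin> outside K \<Longrightarrow> X \<noteq> c *s graph_point \<psi> z" and C: "1 \<le> C"
  shows "\<not> hull_bound \<psi> K X C"
proof (cases "X $ 1 = 0")
  case True
  then show ?thesis
    using not_hull_bound_at_infinity[OF \<psi> transc compact_imp_bounded[OF K] True X(1) C] by simp
next
  case False
  define Y where "Y = (1 / X $ 1) *s X"
  have Y1: "Y $ 1 = 1" using False by (simp add: Y_def)
  have XY: "X = X $ 1 *s Y" using False by (simp add: Y_def vec_eq_iff)
  have "\<not> hull_bound \<psi> K Y D" if D: "1 \<le> D" for D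
  proof (cases "Y $ 3 = \<psi> (Y $ 2)")
    case True
    then have "Y = graph_point \<psi> (Y $ 2)" using Y1 by (simp add: vec_eq_iff forall_3)
    moreover from this have "Y $ 2 \<in> outside K" using X(2) XY by metis
    ultimately show ?thesis
      using not_hull_bound_outside[OF \<psi> transc K _ D] by metis
  next
    case False
    then show ?thesis using not_hull_bound_off_graph[OF \<psi> compact_imp_bounded[OF K] Y1 _ D] by simp
  qed
  moreover have "hull_bound \<psi> K Y (max 1 (norm (1 / X $ 1) * C))" if "hull_bound \<psi> K X C"
    using hull_bound_mono[OF hull_bound_scale[OF that, of "1 / X $ 1"] order_refl] C
    by (simp add: Y_def)
  ultimately show ?thesis by fastforce
qed

text \<open>
Degree \<open>0\<close> is useless for the construction of a power series, and it is also impossible here: constants are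
bounded everywhere by their values on a nonempty \<open>K\<close>.
\<close>

lemma exists_large_hompoly:
  assumes \<psi>: "\<psi> holomorphic_on UNIV" and transc: "\<not> (\<exists>q. \<forall>z. \<psi> z = poly q z)"
    and K: "compact K" and X: "X \<noteq> 0" "\<And>z c. z \<notin> outside K \<Longrightarrow> X \<noteq> c *s graph_point \<psi> z"
  obtains k p where "1 \<le> k" "p \<in> hompoly k" "\<And>z. z \<in> K \<Longrightarrow> norm (p (graph_point \<psi> z)) \<le> 1" "M ^ k < norm (p X)"
proof (cases "K = {}")
  case True
  obtain i where i: "X $ i \<noteq> 0" using X(1) by (auto simp: vec_eq_iff)
  show ?thesis
  proof (rule that[of 1 "\<lambda>Y. of_real (\<bar>M\<bar> + 1) / X $ i * Y $ i"])
    show "(\<lambda>Y. of_real (\<bar>M\<bar> + 1) / X $ i * Y $ i) \<in> hompoly 1"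
      by (intro hompoly_cmult hompoly_coord)
    have "norm (of_real (\<bar>M\<bar> + 1) / X $ i * X $ i) = \<bar>M\<bar> + 1"
      using i by (simp del: of_real_add)
    then show "M ^ 1 < norm (of_real (\<bar>M\<bar> + 1) / X $ i * X $ i)" by simp
  qed (use True in auto)
next
  case False
  then obtain z0 where z0: "z0 \<in> K" by blast
  define C where "C = max 1 \<bar>M\<bar>"
  have "\<not> hull_bound \<psi> K X C"
    by (rule not_hull_bound[OF \<psi> transc K X]) (auto simp: C_def)
  then obtain k p where p: "p \<in> hompoly k" "\<forall>z\<in>K. norm (p (graph_point \<psi> z)) \<le> 1" "C ^ k < norm (p X)"
    unfolding hull_bound_def by (auto simp: not_le)
  have "k \<noteq> 0"
    using p z0 hompoly_0_const[of p X "graph_point \<psi> z0"] by (intro notI) force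
  moreover have "M ^ k \<le> C ^ k"
  proof -
    have "M ^ k \<le> \<bar>M\<bar> ^ k" by (metis abs_ge_self power_abs)
    also have "\<dots> \<le> C ^ k" by (intro power_mono) (auto simp: C_def)
    finally show ?thesis .
  qed
  ultimately show ?thesis using that[of k p] p by auto
qed

section \<open>The projective hull of a compact subset of the graph\<close>

text \<open>
The union of the set and its holes; for compact sets this is the polynomially convex hull in \<open>\<complex>\<close>.
\<close>

definition fill :: "complex set \<Rightarrow> complex set" where
  "fill K = - outside K"

lemma subset_fill: "K \<subseteq> fill K"
  by (auto simp: fill_def outside_def)

lemma fill_mono: "K \<subseteq> L \<Longrightarrow> fill K \<subseteq> fill L"
  unfolding fill_def using outside_mono by blast

lemma compact_fill: "compact K \<Longrightarrow> compact (fill K)"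
  unfolding fill_def compact_eq_bounded_closed
  by (simp add: open_outside closed_Compl cobounded_outside)

text \<open>
Filling the holes does not create new ones, because \<open>outside K\<close> is connected and unbounded.
\<close>

lemma outside_fill:
  assumes "compact K" shows "outside (fill K) = outside K"
proof
  show "outside (fill K) \<subseteq> outside K" by (rule outside_mono[OF subset_fill])
  have "connected (outside K)" "\<not> bounded (outside K)"
    using compact_imp_bounded[OF assms] by (auto intro: connected_outside simp: unbounded_outside)
  then show "outside K \<subseteq> outside (fill K)"
    by (auto simp: outside fill_def connected_component_eq_self)
qed

lemma fill_fill: "compact K \<Longrightarrow> fill (fill K) = fill K"
  using outside_fill by (simp add: fill_def)

text \<open>
Janiszewski's theorem: if neither of two disjoint compact sets separates a point from a point far
away, then their union does not either.
\<close>

lemma fill_Un_disjoint: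
  assumes A: "compact A" and B: "compact B" and AB: "A \<inter> B = {}"
  shows "fill (A \<union> B) \<subseteq> fill A \<union> fill B"
proof -
  have "z \<in> outside (A \<union> B)" if z: "z \<in> outside A" "z \<in> outside B" for z
  proof -
    have "bounded (A \<union> B)" using A B by (simp add: compact_imp_bounded)
    then have "\<not> bounded (outside (A \<union> B))" by (rule unbounded_outside)
    then obtain q where q: "q \<in> outside (A \<union> B)" by fastforce
    then have "q \<in> outside A" "q \<in> outside B" using outside_mono by blast+
    have cc: "connected_component (- S) z q"
      if "compact S" "z \<in> outside S" "q \<in> outside S" for S
    proof -
      have "connected (outside S)"
        using that(1) by (intro connected_outside compact_imp_bounded) simp_all
      moreover have "outside S \<subseteq> - S" using outside_no_overlap[of S] by blast
      ultimately show ?thesis unfolding connected_component_def using that by blast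
    qed
    have "connected_component (- (A \<union> B)) z q"
      using AB by (intro Janiszewski[OF A compact_imp_closed[OF B]] cc A B z \<open>q \<in> outside A\<close> \<open>q \<in> outside B\<close>) simp
    then show ?thesis
      using outside_same_component[of "A \<union> B" q z] q connected_component_sym by blast
  qed
  then show ?thesis by (auto simp: fill_def)
qed

lemma fill_empty: "fill {} = {}"
  by (simp add: fill_def)

lemma fill_UN_disjoint:
  assumes "finite I" "\<And>i. i \<in> I \<Longrightarrow> compact (D i)" "\<And>i j. i \<in> I \<Longrightarrow> j \<in> I \<Longrightarrow> i \<noteq> j \<Longrightarrow> D i \<inter> D j = {}"
  shows "fill (\<Union>i\<in>I. D i) \<subseteq> (\<Union>i\<in>I. fill (D i))"
  using assms
proof (induction I)
  case empty
  then show ?case by (simp add: fill_empty)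
next
  case (insert i I)
  have "fill (D i \<union> (\<Union>i\<in>I. D i)) \<subseteq> fill (D i) \<union> fill (\<Union>i\<in>I. D i)"
  proof (rule fill_Un_disjoint)
    show "compact (D i)" "compact (\<Union>i\<in>I. D i)"
      using insert.hyps insert.prems(1) by (auto intro!: compact_UN)
    have "D i \<inter> D j = {}" if "j \<in> I" for j
      using insert.prems(2)[of i j] insert.hyps that by auto
    then show "D i \<inter> (\<Union>i\<in>I. D i) = {}" by blast
  qed
  moreover have "fill (\<Union>i\<in>I. D i) \<subseteq> (\<Union>i\<in>I. fill (D i))"
    using insert.prems by (intro insert.IH) auto
  ultimately show ?case by auto
qed

lemma norm_le_on_fill:
  assumes K: "compact K" and F: "F holomorphic_on UNIV" and le: "\<And>z. z \<in> K \<Longrightarrow> norm (F z) \<le> B" and z: "z \<in> fill K"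
  shows "norm (F z) \<le> B"
proof (cases "z \<in> K")
  case False
  then have "z \<in> inside K" using z by (auto simp: fill_def outside_inside)
  then show ?thesis
  proof (rule maximum_modulus_frontier[rotated 4])
    show "norm (F z) \<le> B" if "z \<in> frontier (inside K)" for z
      using frontier_inside_subset[OF compact_imp_closed[OF K]] that le by auto
    show "bounded (inside K)" using K by (simp add: bounded_inside compact_imp_bounded)
  qed (auto intro: holomorphic_on_subset[OF F] holomorphic_on_imp_continuous_on)
qed (simp add: le)

definition graph_proj :: "(complex \<Rightarrow> complex) \<Rightarrow> complex \<Rightarrow> cp2" where
  "graph_proj \<psi> z = proj (graph_point \<psi> z)"

lemma continuous_on_proj: "continuous_on (- {0}) proj"
  unfolding continuous_on_open_invariant
proof (intro allI impI)
  fix B :: "cp2 set" assume "open B"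
  then have "open {z. z \<noteq> 0 \<and> proj z \<in> B}" by (simp add: open_cp2_def)
  then show "\<exists>A. open A \<and> A \<inter> - {0} = proj -` B \<inter> - {0}"
    by (intro exI[of _ "{z. z \<noteq> 0 \<and> proj z \<in> B}"]) auto
qed

lemma continuous_on_graph_point:
  assumes "\<psi> holomorphic_on UNIV" shows "continuous_on A (graph_point \<psi>)"
proof -
  have "graph_point \<psi> = (\<lambda>z. \<chi> i. if i = 1 then 1 else if i = 2 then z else \<psi> z)"
    by (rule ext) (simp add: vec_eq_iff forall_3)
  moreover have "continuous_on A \<psi>"
    using assms holomorphic_on_imp_continuous_on holomorphic_on_subset by blast
  then have "continuous_on A (\<lambda>z. if i = 1 then 1 else if i = 2 then z else \<psi> z)" for i :: 3
    by (cases "i = 1"; cases "i = 2") auto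
  ultimately show ?thesis by (simp add: continuous_on_vec_lambda)
qed

lemma continuous_on_graph_proj:
  assumes "\<psi> holomorphic_on UNIV" shows "continuous_on A (graph_proj \<psi>)"
  unfolding graph_proj_def[abs_def]
  by (rule continuous_on_compose2[OF continuous_on_proj continuous_on_graph_point[OF assms]]) auto

text \<open>
The quotient \<open>X $ 2 / X $ 1\<close> is a continuous coordinate on the part of the plane off the line at infinity, and it
inverts \<open>graph_proj \<psi>\<close>.
\<close>

lemma compact_subset_graph:
  assumes F: "compact F" and sub: "F \<subseteq> range (graph_proj \<psi>)"
  obtains L where "compact L" "F = graph_proj \<psi> ` L"
proof -
  define chart where "chart Z = rep_cp2 Z $ 2 / rep_cp2 Z $ 1" for Z
  have chart: "chart (proj x) = x $ 2 / x $ 1 \<and> rep_cp2 (proj x) $ 1 \<noteq> 0" if "x $ 1 \<noteq> 0" for x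
  proof -
    have "x \<noteq> 0" using that by auto
    then obtain c where "c \<noteq> 0" "rep_cp2 (proj x) = c *s x"
      using proj_eq_iff[of x "rep_cp2 (proj x)"] rep_cp2_nonzero proj_rep_cp2 by auto
    then show ?thesis using that by (simp add: chart_def)
  qed
  have rep1: "x $ 1 \<noteq> 0" if x: "x \<noteq> 0" "rep_cp2 (proj x) $ 1 \<noteq> 0" for x
  proof -
    obtain c where "c \<noteq> 0" "rep_cp2 (proj x) = c *s x"
      using proj_eq_iff[of x "rep_cp2 (proj x)"] rep_cp2_nonzero proj_rep_cp2 x by auto
    then show ?thesis using x by auto
  qed
  have F1: "rep_cp2 Z $ 1 \<noteq> 0" if "Z \<in> F" for Z
    using sub that chart[of "graph_point \<psi> _"] by (auto simp: graph_proj_def)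
  have "continuous_on F chart"
    unfolding continuous_on_open_invariant
  proof (intro allI impI)
    fix U :: "complex set" assume U: "open U"
    define A where "A = {Z. rep_cp2 Z $ 1 \<noteq> 0 \<and> chart Z \<in> U}"
    have "{x. x \<noteq> 0 \<and> proj x \<in> A} = {x. x $ 1 \<noteq> 0} \<inter> (\<lambda>x. x $ 2 / x $ 1) -` U"
      using chart rep1 by (auto simp: A_def)
    moreover have "open ({x :: complex ^ 3. x $ 1 \<noteq> 0} \<inter> (\<lambda>x. x $ 2 / x $ 1) -` U)"
      using U by (intro continuous_open_preimage open_Collect_neq continuous_intros) auto
    ultimately have "open A" by (simp add: open_cp2_def)
    moreover have "A \<inter> F = chart -` U \<inter> F" using F1 by (auto simp: A_def)
    ultimately show "\<exists>A. open A \<and> A \<inter> F = chart -` U \<inter> F" by blast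
  qed
  then have "compact (chart ` F)" using F by (rule compact_continuous_image)
  moreover have "F = graph_proj \<psi> ` chart ` F"
  proof -
    have "graph_proj \<psi> (chart Z) = Z" if "Z \<in> F" for Z
      using sub that chart[of "graph_point \<psi> _"] by (auto simp: graph_proj_def)
    then show ?thesis by force
  qed
  ultimately show ?thesis using that by blast
qed

lemma proj_eq_graph_proj:
  assumes "X \<noteq> 0" "X = c *s graph_point \<psi> z" shows "proj X = graph_proj \<psi> z"
proof -
  have "c \<noteq> 0" using assms by auto
  then have "proj (graph_point \<psi> z) = proj X" using assms by (subst proj_eq_iff) auto
  then show ?thesis by (simp add: graph_proj_def)
qed

lemma unit_representative:
  obtains x where "norm x = 1" "proj x = Z"
proof -
  define x where "x = complex_of_real (1 / norm (rep_cp2 Z)) *s rep_cp2 Z"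
  have nz: "0 < norm (rep_cp2 Z)" using rep_cp2_nonzero by simp
  then have x1: "norm x = 1" by (simp add: x_def norm_scale_vec norm_divide)
  then have x0: "x \<noteq> 0" by auto
  have "proj (rep_cp2 Z) = proj x"
    using nz by (subst proj_eq_iff[OF rep_cp2_nonzero x0]) (auto simp: x_def)
  then show ?thesis using x1 that by (simp add: proj_rep_cp2)
qed

lemma subset_projective_hull: "K \<subseteq> projective_hull K"
  unfolding projective_hull_def pabs_sup_def
  by (auto intro!: exI[of _ 1] SUP_upper)

lemma one_le_norm_graph_point: "1 \<le> norm (graph_point \<psi> z)"
  by (metis graph_point_nth(1) Finite_Cartesian_Product.norm_nth_le norm_one)

lemma pabs_graph_proj:
  "p \<in> hompoly k \<Longrightarrow> 1 \<le> k \<Longrightarrow> pabs k p (graph_proj \<psi> z) = root k (norm (p (graph_point \<psi> z))) / norm (graph_point \<psi> z)"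
  unfolding graph_proj_def by (subst pabs_proj) auto

text \<open>
Because \<open>|\<gamma> z|\<close> is at least \<open>1\<close> and bounded on compact sets, membership in the hull amounts to a hull bound
for some \<open>C\<close>. One inclusion is \<open>exists_large_hompoly\<close>, the other one the maximum principle.
\<close>

theorem projective_hull_graph:
  assumes \<psi>: "\<psi> holomorphic_on UNIV" and transc: "\<not> (\<exists>q. \<forall>z. \<psi> z = poly q z)" and K: "compact K"
  shows "projective_hull (graph_proj \<psi> ` K) = graph_proj \<psi> ` fill K"
proof
  show "projective_hull (graph_proj \<psi> ` K) \<subseteq> graph_proj \<psi> ` fill K"
  proof
    fix Z assume "Z \<in> projective_hull (graph_proj \<psi> ` K)"
    then obtain C where C: "0 < C" and hull: "\<And>k p. p \<in> hompoly k \<Longrightarrow>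
        ennreal (pabs k p Z) \<le> ennreal C * pabs_sup k p (graph_proj \<psi> ` K)"
      unfolding projective_hull_def by blast
    define X where "X = rep_cp2 Z"
    have X: "X \<noteq> 0" "proj X = Z" by (simp_all add: X_def rep_cp2_nonzero proj_rep_cp2)
    show "Z \<in> graph_proj \<psi> ` fill K"
    proof (rule ccontr)
      assume Z: "Z \<notin> graph_proj \<psi> ` fill K"
      have "X \<noteq> c *s graph_point \<psi> z" if "z \<notin> outside K" for z c
        using proj_eq_graph_proj[OF X(1), of c \<psi> z] Z that X by (auto simp: fill_def)
      then obtain k p where k: "1 \<le> k" and p: "p \<in> hompoly k"
        and le1: "\<And>z. z \<in> K \<Longrightarrow> norm (p (graph_point \<psi> z)) \<le> 1" and big: "(C * norm X) ^ k < norm (p X)"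
        using exists_large_hompoly[OF \<psi> transc K X(1)] by metis
      have "pabs_sup k p (graph_proj \<psi> ` K) \<le> 1"
        unfolding pabs_sup_def
      proof (rule SUP_least)
        fix W assume "W \<in> graph_proj \<psi> ` K"
        then obtain z where z: "z \<in> K" "W = graph_proj \<psi> z" by blast
        have "root k (norm (p (graph_point \<psi> z))) \<le> 1"
          using le1[OF z(1)] k by (simp add: real_root_le_1_iff)
        then have "pabs k p W \<le> 1"
          using order_trans[OF _ one_le_norm_graph_point[of \<psi> z]] k p
          by (simp add: z(2) pabs_graph_proj divide_le_eq_1)
        then show "ennreal (pabs k p W) \<le> 1" by simp
      qed
      then have "ennreal (pabs k p Z) \<le> ennreal C * 1"
        using hull[OF p] by (meson mult_left_mono order_trans zero_le)
      then have "pabs k p Z \<le> C" using C by (simp add: ennreal_le_iff)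
      then have "root k (norm (p X)) \<le> C * norm X"
        using k X by (simp add: pabs_def Let_def X_def[symmetric] divide_le_eq)
      moreover have "C * norm X < root k (norm (p X))"
      proof -
        have "root k ((C * norm X) ^ k) < root k (norm (p X))"
          using big k by (intro real_root_less_mono) auto
        then show ?thesis using k C by (simp add: real_root_power_cancel)
      qed
      ultimately show False by simp
    qed
  qed
  show "graph_proj \<psi> ` fill K \<subseteq> projective_hull (graph_proj \<psi> ` K)"
  proof
    fix Z assume "Z \<in> graph_proj \<psi> ` fill K"
    then obtain z where z: "z \<in> fill K" "Z = graph_proj \<psi> z" by blast
    have ne: "K \<noteq> {}" using z fill_empty by auto
    obtain B where B: "1 \<le> B" "\<And>w. w \<in> K \<Longrightarrow> norm (graph_point \<psi> w) \<le> B"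
    proof -
      have "bounded (graph_point \<psi> ` K)"
        by (intro compact_imp_bounded compact_continuous_image continuous_on_graph_point \<psi> K)
      then obtain b where "\<And>w. w \<in> K \<Longrightarrow> norm (graph_point \<psi> w) \<le> b" by (auto simp: bounded_iff)
      then show ?thesis using that[of "max 1 b"] by (auto simp: le_max_iff_disj)
    qed
    have "ennreal (pabs k p Z) \<le> ennreal B * pabs_sup k p (graph_proj \<psi> ` K)" if p: "p \<in> hompoly k" for k p
    proof -
      define F where "F w = p (graph_point \<psi> w)" for w
      have F: "F holomorphic_on UNIV"
        using curve_polys_holomorphic[OF \<psi> curve_polysI[OF p]] by (simp add: F_def[abs_def])
      have "\<exists>w\<in>K. \<forall>u\<in>K. norm (F u) \<le> norm (F w)"
        using K ne by (intro continuous_attains_sup)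
          (auto intro!: continuous_intros holomorphic_on_imp_continuous_on holomorphic_on_subset[OF F])
      then obtain w where w: "w \<in> K" "\<And>u. u \<in> K \<Longrightarrow> norm (F u) \<le> norm (F w)" by blast
      have Fz: "norm (F z) \<le> norm (F w)" by (rule norm_le_on_fill[OF K F w(2) z(1)])
      have "pabs k p Z \<le> B * pabs k p (graph_proj \<psi> w)"
      proof (cases "k = 0")
        case True
        then have "pabs k p Z = pabs k p (graph_proj \<psi> w)"
          using p hompoly_0_const[of p "rep_cp2 Z"] by (simp add: pabs_def) metis
        moreover have "0 \<le> pabs k p (graph_proj \<psi> w)" using True by (simp add: pabs_def)
        ultimately show ?thesis using B mult_right_mono[of 1 B "pabs k p (graph_proj \<psi> w)"] by simp
      next
        case False
        then have k: "1 \<le> k" by simp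
        have gz: "1 \<le> norm (graph_point \<psi> z)" by (rule one_le_norm_graph_point)
        have "pabs k p Z = root k (norm (F z)) / norm (graph_point \<psi> z)"
          using pabs_graph_proj[OF p k] by (simp add: z F_def)
        also have "\<dots> \<le> root k (norm (F z)) / 1"
          using gz k by (intro divide_left_mono) auto
        also have "\<dots> \<le> root k (norm (F w))" using Fz k by simp
        also have "\<dots> = norm (graph_point \<psi> w) * pabs k p (graph_proj \<psi> w)"
          using pabs_graph_proj[OF p k, of \<psi> w] by (simp add: F_def)
        also have "\<dots> \<le> B * pabs k p (graph_proj \<psi> w)"
          using B(2)[OF w(1)] pabs_graph_proj[OF p k, of \<psi> w] k by (intro mult_right_mono) auto
        finally show ?thesis .
      qed
      then have "ennreal (pabs k p Z) \<le> ennreal B * ennreal (pabs k p (graph_proj \<psi> w))"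
        using B(1) by (simp add: ennreal_mult'[symmetric] ennreal_leI)
      also have "\<dots> \<le> ennreal B * pabs_sup k p (graph_proj \<psi> ` K)"
        unfolding pabs_sup_def using w(1) by (intro mult_left_mono SUP_upper) auto
      finally show ?thesis .
    qed
    then show "Z \<in> projective_hull (graph_proj \<psi> ` K)"
      unfolding projective_hull_def using B(1) by (intro CollectI exI[of _ B]) auto
  qed
qed

section \<open>From convergence sets to unions of convex sets\<close>

lemma convergent1_iff: "convergent1 F \<longleftrightarrow> (\<exists>B\<ge>0. \<forall>n\<ge>1. norm (fps_nth F n) \<le> B ^ n)"
proof
  assume "convergent1 F"
  then obtain e where e: "0 < e" "\<And>t. norm t < e \<Longrightarrow> summable (\<lambda>n. norm (fps_nth F n * t ^ n))"
    unfolding convergent1_def eventually_nhds_metric by (auto simp: dist_norm)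
  define t where "t = complex_of_real (e / 2)"
  have t: "0 < norm t" "norm t < e" using e(1) by (simp_all add: t_def norm_divide)
  have "(\<lambda>n. norm (fps_nth F n * t ^ n)) \<longlonglongrightarrow> 0" by (rule summable_LIMSEQ_zero[OF e(2)[OF t(2)]])
  then have "Bseq (\<lambda>n. norm (fps_nth F n * t ^ n))" by (intro convergent_imp_Bseq convergentI)
  then obtain M where M: "\<And>n. norm (fps_nth F n * t ^ n) \<le> M" by (auto simp: Bseq_def)
  define M' where "M' = max 1 M"
  have "norm (fps_nth F n) \<le> (M' / norm t) ^ n" if "1 \<le> n" for n
  proof -
    have "norm (fps_nth F n) * norm t ^ n \<le> M'"
      using M[of n] by (simp add: M'_def norm_mult norm_power)
    also have "M' \<le> M' ^ n" using that by (intro self_le_power) (auto simp: M'_def)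
    finally show ?thesis using t by (simp add: power_divide pos_le_divide_eq)
  qed
  then show "\<exists>B\<ge>0. \<forall>n\<ge>1. norm (fps_nth F n) \<le> B ^ n"
    using t by (intro exI[of _ "M' / norm t"]) (auto simp: M'_def)
next
  assume "\<exists>B\<ge>0. \<forall>n\<ge>1. norm (fps_nth F n) \<le> B ^ n"
  then obtain B where B: "0 \<le> B" "\<And>n. 1 \<le> n \<Longrightarrow> norm (fps_nth F n) \<le> B ^ n" by blast
  define e where "e = 1 / (2 * (B + 1))"
  have "0 < e" using B by (simp add: e_def)
  moreover have "summable (\<lambda>n. norm (fps_nth F n * t ^ n))" if "norm t < e" for t
  proof (rule summable_comparison_test')
    fix n :: nat assume n: "1 \<le> n"
    have "norm (fps_nth F n * t ^ n) \<le> B ^ n * e ^ n"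
      unfolding norm_mult norm_power using B n that by (intro mult_mono power_mono) auto
    also have "\<dots> = (B * e) ^ n" by (simp add: power_mult_distrib)
    also have "\<dots> \<le> (1 / 2) ^ n" using B by (intro power_mono) (auto simp: e_def divide_simps)
    finally show "norm (norm (fps_nth F n * t ^ n)) \<le> (1 / 2) ^ n" by simp
  qed (simp add: summable_geometric)
  ultimately show "convergent1 F"
    unfolding convergent1_def eventually_nhds_metric by (auto simp: dist_norm)
qed

lemma Conv_iff:
  assumes "x \<noteq> 0"
  shows "proj x \<in> Conv f \<longleftrightarrow> (\<exists>B\<ge>0. \<forall>n\<ge>1. norm (fps_nth (slice f x) n) \<le> B ^ n)"
proof -
  have "proj x \<in> Conv f \<longleftrightarrow> convergent1 (slice f x)"
    using assms Conv_all_representatives[of f] unfolding Conv_def by blast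
  then show ?thesis by (simp only: convergent1_iff)
qed

lemma slice_hompoly: "(\<lambda>x. fps_nth (slice f x) n) \<in> hompoly n"
  unfolding slice_def by (simp add: hompoly_collect)

text \<open>
A point in the hull of \<open>E j\<close> need not be in \<open>E j\<close>, since the constant \<open>C\<close> of the point intervenes, but it
still has \<open>|g n X|\<close> at most geometric in \<open>n\<close> and thus lies in \<open>Conv f\<close>. So the hulls of the \<open>E j\<close> exhaust
\<open>Conv f\<close> too, and unlike the \<open>E j\<close> they are convex.
\<close>

lemma convergence_set_imp_union:
  assumes \<psi>: "\<psi> holomorphic_on UNIV" and transc: "\<not> (\<exists>q. \<forall>z. \<psi> z = poly q z)"
    and sub: "Conv f \<subseteq> range (graph_proj \<psi>)"
  shows "\<exists>F :: nat \<Rightarrow> cp2 set. (\<forall>j. compact (F j) \<and> projectively_convex (F j)) \<and> Conv f = (\<Union>j. F j)"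
proof -
  define g where "g n x = fps_nth (slice f x) n" for n x
  have g: "g n \<in> hompoly n" for n unfolding g_def[abs_def] by (rule slice_hompoly)
  define S where "S j = {x. norm x = 1 \<and> (\<forall>n\<ge>1. norm (g n x) \<le> real j ^ n)}" for j :: nat
  define E where "E j = proj ` S j" for j
  have S0: "x \<noteq> 0" if "x \<in> S j" for x j using that by (auto simp: S_def)
  have "compact (S j)" for j
  proof -
    have "S j = sphere 0 1 \<inter> (\<Inter>n\<in>{1..}. {x. norm (g n x) \<le> real j ^ n})"
      by (auto simp: S_def)
    moreover have "closed {x. norm (g n x) \<le> real j ^ n}" for n
      by (intro closed_Collect_le continuous_intros continuous_on_hompoly[OF g])
    ultimately show ?thesis by (auto intro!: compact_Int_closed closed_INT)
  qed
  then have E: "compact (E j)" for j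
    unfolding E_def using S0 by (intro compact_continuous_image continuous_on_subset[OF continuous_on_proj]) auto
  have EConv: "E j \<subseteq> Conv f" for j
  proof
    fix Z assume "Z \<in> E j"
    then obtain x where x: "x \<in> S j" "Z = proj x" by (auto simp: E_def)
    then show "Z \<in> Conv f"
      using Conv_iff[OF S0[OF x(1)], of f] by (auto simp: S_def g_def intro!: exI[of _ "real j"])
  qed
  have ConvE: "\<exists>j. Z \<in> E j" if ZC: "Z \<in> Conv f" for Z
  proof -
    obtain x where x1: "norm x = 1" and xZ: "proj x = Z" using unit_representative by blast
    have x0: "x \<noteq> 0" using x1 by auto
    from xZ obtain B where B: "0 \<le> B" "\<And>n. 1 \<le> n \<Longrightarrow> norm (g n x) \<le> B ^ n"
      using Conv_iff[OF x0, of f] ZC by (auto simp: g_def)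
    obtain j :: nat where "B \<le> real j" using real_arch_simple by blast
    then have "x \<in> S j"
      using x1 B by (auto simp: S_def intro: order_trans[OF _ power_mono])
    then show ?thesis using xZ by (auto simp: E_def)
  qed
  have hullE: "projective_hull (E j) \<subseteq> Conv f" for j
  proof
    fix Z assume "Z \<in> projective_hull (E j)"
    then obtain C where C: "0 < C" and hull: "\<And>k p. p \<in> hompoly k \<Longrightarrow>
        ennreal (pabs k p Z) \<le> ennreal C * pabs_sup k p (E j)"
      unfolding projective_hull_def by blast
    define X where "X = rep_cp2 Z"
    have X: "X \<noteq> 0" "proj X = Z" by (simp_all add: X_def rep_cp2_nonzero proj_rep_cp2)
    have "norm (g n X) \<le> (C * real j * norm X) ^ n" if n: "1 \<le> n" for n
    proof -
      have "pabs_sup n (g n) (E j) \<le> ennreal (real j)"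
        unfolding pabs_sup_def
      proof (rule SUP_least)
        fix W assume "W \<in> E j"
        then obtain x where x: "x \<in> S j" "W = proj x" by (auto simp: E_def)
        have "root n (norm (g n x)) \<le> root n (real j ^ n)"
          using x n by (auto simp: S_def)
        also have "\<dots> = real j" using n by (simp add: real_root_power_cancel)
        finally have "pabs n (g n) W \<le> real j"
          using x n pabs_proj[OF g S0[OF x(1)]] by (simp add: S_def)
        then show "ennreal (pabs n (g n) W) \<le> ennreal (real j)" by (rule ennreal_leI)
      qed
      then have "ennreal (pabs n (g n) Z) \<le> ennreal C * ennreal (real j)"
        using hull[OF g] by (meson mult_left_mono order_trans zero_le)
      then have "pabs n (g n) Z \<le> C * real j"
        using C by (simp add: ennreal_mult'[symmetric] ennreal_le_iff)
      then have "root n (norm (g n X)) \<le> C * real j * norm X"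
        using n X by (simp add: pabs_def Let_def X_def[symmetric] divide_le_eq)
      then have "root n (norm (g n X)) ^ n \<le> (C * real j * norm X) ^ n"
        using n by (intro power_mono) auto
      then show ?thesis using n by simp
    qed
    then show "Z \<in> Conv f"
      using Conv_iff[OF X(1), of f] X(2) C by (auto simp: g_def intro!: exI[of _ "C * real j * norm X"])
  qed
  have "\<exists>L. compact L \<and> E j = graph_proj \<psi> ` L" for j
    using compact_subset_graph[OF E[of j]] EConv[of j] sub by (metis order_trans)
  then obtain L where L: "\<And>j. compact (L j)" "\<And>j. E j = graph_proj \<psi> ` L j" by metis
  define F where "F j = graph_proj \<psi> ` fill (L j)" for j
  have F: "F j = projective_hull (E j)" for j
    unfolding F_def L(2) by (rule projective_hull_graph[OF \<psi> transc L(1), symmetric])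
  have "compact (F j)" for j
    unfolding F_def by (intro compact_continuous_image continuous_on_graph_proj \<psi> compact_fill L)
  moreover have "projectively_convex (F j)" for j
    unfolding projectively_convex_def F_def
    by (simp add: projective_hull_graph[OF \<psi> transc compact_fill[OF L(1)]] fill_fill[OF L(1)])
  moreover have "Conv f = (\<Union>j. F j)"
  proof
    show "Conv f \<subseteq> (\<Union>j. F j)"
    proof
      fix Z assume "Z \<in> Conv f"
      then obtain j where "Z \<in> E j" using ConvE by blast
      then show "Z \<in> (\<Union>j. F j)" using subset_projective_hull[of "E j"] by (auto simp: F)
    qed
    show "(\<Union>j. F j) \<subseteq> Conv f"
      unfolding F using hullE by (rule UN_least)
  qed
  ultimately show ?thesis by blast
qed

section \<open>An exhaustion by disjoint shells\<close>

text \<open>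
The part of \<open>L i\<close> that keeps a distance from all earlier sets. For fixed \<open>t\<close> the shells are mutually
disjoint, as Janiszewski's theorem requires; as \<open>t\<close> grows they exhaust \<open>L i\<close> minus the earlier sets.
\<close>

definition shell :: "(nat \<Rightarrow> complex set) \<Rightarrow> nat \<Rightarrow> nat \<Rightarrow> complex set" where
  "shell L i t = {z \<in> L i. \<forall>j<i. \<forall>y\<in>L j. 1 / real (t + 1) \<le> dist z y}"

definition stage :: "(nat \<Rightarrow> complex set) \<Rightarrow> nat \<Rightarrow> complex set" where
  "stage L t = (\<Union>i\<le>t. shell L i t)"

lemma shell_subset: "shell L i t \<subseteq> L i"
  by (auto simp: shell_def)

lemma compact_shell:
  assumes "compact (L i)" shows "compact (shell L i t)"
proof -
  have "shell L i t = L i \<inter> (\<Inter>j\<in>{..<i}. \<Inter>y\<in>L j. {z. 1 / real (t + 1) \<le> dist z y})"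
    by (auto simp: shell_def)
  moreover have "closed {z :: complex. 1 / real (t + 1) \<le> dist z y}" for y
    by (intro closed_Collect_le continuous_intros)
  ultimately show ?thesis using assms by (auto intro!: compact_Int_closed closed_INT)
qed

lemma shell_disjoint: "i \<noteq> j \<Longrightarrow> shell L i t \<inter> shell L j t = {}"
proof -
  have "shell L i t \<inter> shell L j t = {}" if "j < i" for i j
    using that by (fastforce simp: shell_def)
  then show "i \<noteq> j \<Longrightarrow> shell L i t \<inter> shell L j t = {}"
    by (metis Int_commute linorder_neqE_nat)
qed

lemma compact_stage: "(\<And>i. compact (L i)) \<Longrightarrow> compact (stage L t)"
  unfolding stage_def by (intro compact_UN compact_shell) auto

lemma stage_mono: "t \<le> u \<Longrightarrow> stage L t \<subseteq> stage L u"
proof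
  fix z assume tu: "t \<le> u" and "z \<in> stage L t"
  then obtain i where i: "i \<le> t" "z \<in> shell L i t" by (auto simp: stage_def)
  have "1 / real (u + 1) \<le> 1 / real (t + 1)" using tu by (intro divide_left_mono) auto
  then have "z \<in> shell L i u" using i(2) unfolding shell_def by (blast intro: order_trans)
  then show "z \<in> stage L u" using i(1) tu by (auto simp: stage_def)
qed

lemma in_some_stage:
  assumes "\<And>i. compact (L i)" "z \<in> (\<Union>i. L i)"
  obtains t where "z \<in> stage L t"
proof -
  define i where "i = (LEAST i. z \<in> L i)"
  have i: "z \<in> L i" unfolding i_def using assms(2) by (auto intro: LeastI)
  have less: "z \<notin> L j" if "j < i" for j using not_less_Least that unfolding i_def by blast
  define S where "S = (\<Union>j<i. L j)"
  have "compact S" unfolding S_def using assms(1) by (intro compact_UN) auto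
  then have "closed S" by (rule compact_imp_closed)
  have "z \<notin> S" using less by (auto simp: S_def)
  obtain \<delta> where \<delta>: "0 < \<delta>" "\<And>y. y \<in> S \<Longrightarrow> \<delta> \<le> dist z y"
    using separate_point_closed[OF \<open>closed S\<close> \<open>z \<notin> S\<close>] by blast
  obtain n where n: "1 / real (Suc n) < \<delta>" using nat_approx_posE[OF \<delta>(1)] .
  define t where "t = max i n"
  have "1 / real (t + 1) \<le> 1 / real (Suc n)" by (intro divide_left_mono) (auto simp: t_def)
  then have "1 / real (t + 1) \<le> dist z y" if "j < i" "y \<in> L j" for j y
    using n \<delta>(2)[of y] that by (force simp: S_def)
  then have "z \<in> shell L i t" using i by (auto simp: shell_def)
  then have "z \<in> stage L t" unfolding stage_def by (intro UN_I[of i]) (simp_all add: t_def)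
  then show ?thesis by (rule that)
qed

text \<open>
A segment that leads into a hole must cross the set itself.
\<close>

lemma dist_fill_attained:
  assumes K: "compact K" and y: "y \<in> fill K" and z: "z \<notin> fill K"
  obtains x where "x \<in> K" "dist z x \<le> dist z y"
proof -
  have "closed_segment z y \<inter> K \<noteq> {}"
  proof
    assume "closed_segment z y \<inter> K = {}"
    then have "connected_component (- K) z y"
      unfolding connected_component_def by (intro exI[of _ "closed_segment z y"]) auto
    then show False using outside_same_component[of K z y] y z by (simp add: fill_def)
  qed
  then obtain x where x: "x \<in> closed_segment z y" "x \<in> K" by blast
  then have "dist z x \<le> dist z y"
    using segment_bound(1)[of x z y] by (simp add: dist_norm norm_minus_commute)
  then show ?thesis using that x by blast
qed

text \<open>
If \<open>z\<close> were close to \<open>fill (stage L t)\<close> for all large \<open>t\<close>, it would be close to the shell of some index \<open>i t\<close>.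
Shells of \<open>t\<close> and \<open>t + 1\<close> with increasing index are farther apart than the sum of the two margins, so
\<open>i t\<close> cannot increase. Being bounded, it confines the shells to finitely many \<open>L i\<close>, and \<open>z\<close> is
in the closure of their union.
\<close>

lemma frequently_far_from_stage:
  assumes L: "\<And>i. compact (L i)" and fillL: "\<And>i. fill (L i) = L i" and z: "z \<notin> (\<Union>i. L i)"
  shows "\<exists>t\<ge>t0. \<forall>y\<in>fill (stage L t). 1 / (2 * real (t + 2)) \<le> dist z y"
proof (rule ccontr)
  assume "\<not> ?thesis"
  then have close: "\<exists>y\<in>fill (stage L t). dist z y < 1 / (2 * real (t + 2))" if "t0 \<le> t" for t
    using that by (meson not_le)
  have "\<exists>i. \<exists>x\<in>shell L i t. dist z x < 1 / (2 * real (t + 2))" if t: "t0 \<le> t" for t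
  proof -
    obtain y where y: "y \<in> fill (stage L t)" "dist z y < 1 / (2 * real (t + 2))" using close[OF t] by blast
    have "fill (stage L t) \<subseteq> (\<Union>i\<in>{..t}. fill (shell L i t))"
      unfolding stage_def by (intro fill_UN_disjoint compact_shell L shell_disjoint) auto
    then obtain i where i: "y \<in> fill (shell L i t)" using y by auto
    have "fill (shell L i t) \<subseteq> L i" using fill_mono[OF shell_subset] fillL by blast
    then have "z \<notin> fill (shell L i t)" using z by blast
    then obtain x where "x \<in> shell L i t" "dist z x \<le> dist z y"
      using dist_fill_attained[OF compact_shell[OF L] i] by blast
    then show ?thesis using y(2) by (intro exI[of _ i] bexI[of _ x]) auto
  qed
  then obtain i x where ix: "\<And>t. t0 \<le> t \<Longrightarrow> x t \<in> shell L (i t) t"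
    "\<And>t. t0 \<le> t \<Longrightarrow> dist z (x t) < 1 / (2 * real (t + 2))" by metis
  have step: "i (Suc t) \<le> i t" if t: "t0 \<le> t" for t
  proof (rule ccontr)
    assume "\<not> i (Suc t) \<le> i t"
    then have "i t < i (Suc t)" by simp
    moreover have "x t \<in> L (i t)" using ix(1)[OF t] shell_subset by blast
    moreover have "x (Suc t) \<in> shell L (i (Suc t)) (Suc t)" using ix(1) t by simp
    ultimately have "1 / real (Suc t + 1) \<le> dist (x (Suc t)) (x t)"
      unfolding shell_def by blast
    also have "\<dots> \<le> dist z (x (Suc t)) + dist z (x t)" by (rule dist_triangle3)
    also have "\<dots> < 1 / (2 * real (Suc t + 2)) + 1 / (2 * real (t + 2))"
      using ix(2)[of "Suc t"] ix(2)[OF t] t by (intro add_strict_mono) auto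
    also have "\<dots> \<le> 1 / (2 * real (t + 2)) + 1 / (2 * real (t + 2))"
      by (intro add_right_mono divide_left_mono) auto
    also have "\<dots> = 1 / real (Suc t + 1)" by (simp add: field_simps)
    finally show False by simp
  qed
  have i_le: "i (t0 + n) \<le> i t0" for n
  proof (induction n)
    case (Suc n)
    then show ?case using step[of "t0 + n"] by simp
  qed simp
  define S where "S = (\<Union>j\<le>i t0. L j)"
  have "compact S" unfolding S_def using L by (intro compact_UN) auto
  then have "closed S" by (rule compact_imp_closed)
  have "z \<notin> S" using z by (auto simp: S_def)
  obtain \<delta> where \<delta>: "0 < \<delta>" "\<And>y. y \<in> S \<Longrightarrow> \<delta> \<le> dist z y"
    using separate_point_closed[OF \<open>closed S\<close> \<open>z \<notin> S\<close>] by blast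
  obtain n where n: "1 / real (Suc n) < \<delta>" using nat_approx_posE[OF \<delta>(1)] .
  have "x (t0 + n) \<in> S"
    using ix(1)[of "t0 + n"] i_le[of n] shell_subset by (force simp: S_def)
  then have "\<delta> \<le> dist z (x (t0 + n))" by (rule \<delta>(2))
  also have "\<dots> < 1 / (2 * real (t0 + n + 2))" using ix(2)[of "t0 + n"] by simp
  also have "\<dots> \<le> 1 / real (Suc n)" by (intro divide_left_mono) auto
  finally show False using n by simp
qed

section \<open>From unions of convex sets to convergence sets\<close>

text \<open>
A neighbourhood of the part of the graph over \<open>A\<close>, as a cone in homogeneous coordinates.
\<close>

definition graph_nbhd :: "(complex \<Rightarrow> complex) \<Rightarrow> complex set \<Rightarrow> real \<Rightarrow> (complex ^ 3) set" where
  "graph_nbhd \<psi> A \<epsilon> = {X. X $ 1 \<noteq> 0 \<and> (\<exists>y\<in>A. dist (X $ 2 / X $ 1) y < \<epsilon>) \<and>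
    norm (X $ 3 / X $ 1 - \<psi> (X $ 2 / X $ 1)) < \<epsilon>}"

lemma open_graph_nbhd:
  assumes "\<psi> holomorphic_on UNIV" shows "open (graph_nbhd \<psi> A \<epsilon>)"
proof -
  define f :: "complex ^ 3 \<Rightarrow> complex" where "f X = X $ 2 / X $ 1" for X
  define g :: "complex ^ 3 \<Rightarrow> complex" where "g X = X $ 3 / X $ 1 - \<psi> (f X)" for X
  have S: "open {X :: complex ^ 3. X $ 1 \<noteq> 0}" by (intro open_Collect_neq continuous_intros)
  have f: "continuous_on {X. X $ 1 \<noteq> 0} f" unfolding f_def by (intro continuous_intros) auto
  have "continuous_on {X. X $ 1 \<noteq> 0} (\<lambda>X. \<psi> (f X))"
    by (rule continuous_on_compose2[OF holomorphic_on_imp_continuous_on[OF assms] f]) auto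
  then have g: "continuous_on {X. X $ 1 \<noteq> 0} g" unfolding g_def by (intro continuous_intros) auto
  have "graph_nbhd \<psi> A \<epsilon> = ({X. X $ 1 \<noteq> 0} \<inter> f -` (\<Union>y\<in>A. ball y \<epsilon>)) \<inter> ({X. X $ 1 \<noteq> 0} \<inter> g -` ball 0 \<epsilon>)"
    by (auto simp: graph_nbhd_def f_def g_def dist_commute)
  also have "open \<dots>"
    by (intro open_Int continuous_open_preimage[OF f S] continuous_open_preimage[OF g S] open_UN) auto
  finally show ?thesis .
qed

text \<open>
Off the neighbourhood, each point of the unit sphere has a form that is large at it; by compactness finitely many of
them suffice.
\<close>

lemma finite_separating_family:
  assumes \<psi>: "\<psi> holomorphic_on UNIV" and transc: "\<not> (\<exists>q. \<forall>z. \<psi> z = poly q z)"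
    and K: "compact K" and \<epsilon>: "0 < \<epsilon>"
  shows "\<exists>ps. (\<forall>(k, p)\<in>set ps. 1 \<le> k \<and> p \<in> hompoly k \<and> (\<forall>z\<in>K. norm (p (graph_point \<psi> z)) \<le> 1)) \<and>
    (\<forall>X. norm X = 1 \<longrightarrow> X \<notin> graph_nbhd \<psi> (fill K) \<epsilon> \<longrightarrow> (\<exists>(k, p)\<in>set ps. M ^ k < norm (p X)))"
proof -
  define C where "C = sphere 0 1 - graph_nbhd \<psi> (fill K) \<epsilon>"
  have C: "compact C" unfolding C_def by (intro compact_diff open_graph_nbhd \<psi>) simp
  have "\<exists>k p. 1 \<le> k \<and> p \<in> hompoly k \<and> (\<forall>z\<in>K. norm (p (graph_point \<psi> z)) \<le> 1) \<and> M ^ k < norm (p X)"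
    if X: "X \<in> C" for X
  proof -
    have X0: "X \<noteq> 0" using X by (auto simp: C_def)
    have "X \<noteq> c *s graph_point \<psi> z" if z: "z \<notin> outside K" for z c
    proof
      assume eq: "X = c *s graph_point \<psi> z"
      then have "c \<noteq> 0" using X0 by auto
      then have "X \<in> graph_nbhd \<psi> (fill K) \<epsilon>"
        using z \<epsilon> by (auto simp: graph_nbhd_def eq fill_def intro!: bexI[of _ z])
      then show False using X by (simp add: C_def)
    qed
    from exists_large_hompoly[OF \<psi> transc K X0 this, of M] show ?thesis by metis
  qed
  then obtain k p where kp: "\<And>X. X \<in> C \<Longrightarrow> 1 \<le> k X" "\<And>X. X \<in> C \<Longrightarrow> p X \<in> hompoly (k X)"
    "\<And>X z. X \<in> C \<Longrightarrow> z \<in> K \<Longrightarrow> norm (p X (graph_point \<psi> z)) \<le> 1" "\<And>X. X \<in> C \<Longrightarrow> M ^ k X < norm (p X X)"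
    by metis
  have "open {Y. M ^ k X < norm (p X Y)}" if "X \<in> C" for X
    by (intro open_Collect_less continuous_intros continuous_on_hompoly[OF kp(2)[OF that]])
  then obtain Y where Y: "Y \<subseteq> C" "finite Y" "C \<subseteq> (\<Union>X\<in>Y. {Z. M ^ k X < norm (p X Z)})"
    by (rule compactE_image[OF C, of C "\<lambda>X. {Y. M ^ k X < norm (p X Y)}"]) (use kp(4) in auto)
  obtain ys where ys: "set ys = Y" using finite_list[OF Y(2)] by blast
  show ?thesis
  proof (intro exI[of _ "map (\<lambda>X. (k X, p X)) ys"] conjI allI impI)
    show "\<forall>(k, p)\<in>set (map (\<lambda>X. (k X, p X)) ys). 1 \<le> k \<and> p \<in> hompoly k \<and> (\<forall>z\<in>K. norm (p (graph_point \<psi> z)) \<le> 1)"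
      using ys Y(1) kp(1-3) by auto
    fix X :: "complex ^ 3" assume "norm X = 1" "X \<notin> graph_nbhd \<psi> (fill K) \<epsilon>"
    then have "X \<in> C" by (simp add: C_def)
    then show "\<exists>(k, p)\<in>set (map (\<lambda>X. (k X, p X)) ys). M ^ k < norm (p X)"
      using Y(3) ys by auto
  qed
qed

lemma series_with_homogeneous_parts:
  assumes "inj d" "\<And>e::nat. G e \<in> hompoly (d e)"
  obtains f where "\<And>e x. fps_nth (slice f x) (d e) = G e x" "\<And>n x. n \<notin> range d \<Longrightarrow> fps_nth (slice f x) n = 0"
proof -
  have "\<forall>e. \<exists>c. \<forall>x. G e x = (\<Sum>\<alpha> | mdeg \<alpha> = d e. c \<alpha> * mono3 x \<alpha>)"
    using hompoly_expand[OF assms(2)] by metis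
  then obtain c where c: "\<And>e x. G e x = (\<Sum>\<alpha> | mdeg \<alpha> = d e. c e \<alpha> * mono3 x \<alpha>)" by metis
  define f where "f \<alpha> = (if mdeg \<alpha> \<in> range d then c (inv_into UNIV d (mdeg \<alpha>)) \<alpha> else 0)" for \<alpha>
  show ?thesis
  proof (rule that[of f])
    show "fps_nth (slice f x) (d e) = G e x" for e x
      unfolding slice_def c by (simp, intro sum.cong) (auto simp: f_def assms(1))
    show "fps_nth (slice f x) n = 0" if "n \<notin> range d" for n x
      using that unfolding slice_def by (simp, intro sum.neutral) (auto simp: f_def)
  qed
qed

text \<open>
Powers of forms of the given degrees can be arranged to have strictly increasing degrees: the \<open>e\<close>-th
degree is a partial product of the numbers \<open>2 * k i\<close>.
\<close>

lemma degree_sequence: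
  assumes "\<And>e::nat. 1 \<le> k e"
  obtains j :: "nat \<Rightarrow> nat" where "\<And>e. 1 \<le> j e" "strict_mono (\<lambda>e. j e * k e)"
proof -
  define d where "d e = (\<Prod>i\<le>e. 2 * k i)" for e
  have pos: "0 < d e" for e unfolding d_def using assms by (intro prod_pos) (auto simp: Suc_le_eq)
  have dvd: "k e dvd d e" for e
  proof -
    have "2 * k e dvd d e" unfolding d_def by (rule dvd_prodI) auto
    then show ?thesis by (rule dvd_mult_right)
  qed
  have "d e < d (Suc e)" for e
  proof -
    have "d (Suc e) = d e * (2 * k (Suc e))" by (simp add: d_def mult.commute)
    moreover have "1 < 2 * k (Suc e)" using assms[of "Suc e"] by simp
    ultimately show ?thesis using pos[of e] by simp
  qed
  then have "strict_mono d" by (simp add: strict_mono_Suc_iff)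
  then have "strict_mono (\<lambda>e. d e div k e * k e)" using dvd by simp
  moreover have "1 \<le> d e div k e" for e
    using pos[of e] dvd[of e] by (metis One_nat_def Suc_leI dvd_div_eq_0_iff neq0_conv not_gr0)
  ultimately show ?thesis using that[of "\<lambda>e. d e div k e"] by simp
qed

lemma convergent3_imp_Conv:
  assumes "convergent3 f" shows "Conv f = UNIV"
proof -
  obtain \<epsilon> where \<epsilon>: "0 < \<epsilon>" "\<And>z. norm z < \<epsilon> \<Longrightarrow> (\<lambda>\<alpha>. norm (f \<alpha> * mono3 z \<alpha>)) summable_on UNIV"
    using assms unfolding convergent3_def eventually_nhds_metric by (auto simp: dist_norm)
  have "convergent1 (slice f x)" if "x \<noteq> 0" for x
    unfolding convergent1_def eventually_nhds_metric
  proof (intro exI[of _ "\<epsilon> / norm x"] conjI allI impI)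
    show "0 < \<epsilon> / norm x" using \<epsilon> that by simp
    fix t :: complex assume "dist t 0 < \<epsilon> / norm x"
    then have "norm (t *s x) < \<epsilon>" using that by (simp add: norm_scale_vec pos_less_divide_eq)
    then have s: "(\<lambda>\<alpha>. norm (f \<alpha> * mono3 (t *s x) \<alpha>)) summable_on UNIV" by (rule \<epsilon>(2))
    show "summable (\<lambda>n. norm (fps_nth (slice f x) n * t ^ n))"
    proof (rule summableI_nonneg_bounded)
      fix N
      have le: "norm (fps_nth (slice f x) n * t ^ n) \<le> (\<Sum>\<alpha> | mdeg \<alpha> = n. norm (f \<alpha> * mono3 (t *s x) \<alpha>))" for n
      proof -
        have "fps_nth (slice f x) n * t ^ n = fps_nth (slice f (t *s x)) n"
          by (simp add: slice_scale mult.commute)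
        then show ?thesis by (simp add: slice_def norm_sum)
      qed
      have "(\<Sum>n<N. norm (fps_nth (slice f x) n * t ^ n)) \<le>
          (\<Sum>n<N. \<Sum>\<alpha> | mdeg \<alpha> = n. norm (f \<alpha> * mono3 (t *s x) \<alpha>))"
        by (intro sum_mono le)
      also have "\<dots> = (\<Sum>\<alpha>\<in>(\<Union>n<N. {\<alpha>. mdeg \<alpha> = n}). norm (f \<alpha> * mono3 (t *s x) \<alpha>))"
        by (rule sum.UNION_disjoint[symmetric]) (auto simp: finite_mdeg)
      also have "\<dots> \<le> infsum (\<lambda>\<alpha>. norm (f \<alpha> * mono3 (t *s x) \<alpha>)) UNIV"
        by (rule finite_sum_le_infsum[OF s]) (auto simp: finite_mdeg)
      finally show "(\<Sum>n<N. norm (fps_nth (slice f x) n * t ^ n)) \<le>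
          infsum (\<lambda>\<alpha>. norm (f \<alpha> * mono3 (t *s x) \<alpha>)) UNIV" .
    qed simp
  qed
  then show ?thesis
    unfolding Conv_def using rep_cp2_nonzero proj_rep_cp2 by blast
qed

text \<open>
A point of \<open>E\<close> lies in all stages from some \<open>t\<close> on, so all but finitely many forms are bounded by \<open>1\<close> at it. A
point outside \<open>E\<close> escapes from the neighbourhoods of infinitely many stages, so at it the forms are not
bounded by any geometric sequence. The series diverges because it does so at a point that is not on the graph.
\<close>

lemma union_imp_convergence_set:
  assumes \<psi>: "\<psi> holomorphic_on UNIV" and transc: "\<not> (\<exists>q. \<forall>z. \<psi> z = poly q z)"
    and L: "\<And>i. compact (L i)" and fillL: "\<And>i::nat. fill (L i) = L i"
  shows "convergence_set (graph_proj \<psi> ` (\<Union>i. L i))"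
proof -
  have "\<forall>t. \<exists>ps. (\<forall>(k, p)\<in>set ps. 1 \<le> k \<and> p \<in> hompoly k \<and> (\<forall>z\<in>stage L t. norm (p (graph_point \<psi> z)) \<le> 1)) \<and>
    (\<forall>X. norm X = 1 \<longrightarrow> X \<notin> graph_nbhd \<psi> (fill (stage L t)) (1 / (2 * real (t + 2))) \<longrightarrow>
      (\<exists>(k, p)\<in>set ps. real t ^ k < norm (p X)))"
    by (intro allI finite_separating_family[OF \<psi> transc compact_stage[OF L]]) simp
  from choice[OF this] obtain ps where PS: "\<forall>t. (\<forall>(k, p)\<in>set (ps t). 1 \<le> k \<and> p \<in> hompoly k \<and>
      (\<forall>z\<in>stage L t. norm (p (graph_point \<psi> z)) \<le> 1)) \<and>
    (\<forall>X. norm X = 1 \<longrightarrow> X \<notin> graph_nbhd \<psi> (fill (stage L t)) (1 / (2 * real (t + 2))) \<longrightarrow>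
      (\<exists>(k, p)\<in>set (ps t). real t ^ k < norm (p X)))" ..
  note ps = conjunct1[OF spec[OF PS]]
  note big = conjunct2[OF spec[OF PS], rule_format]
  \<comment> \<open>Pairs beyond the length of the list get the zero form, in degree \<open>1\<close> so that all degrees are positive.\<close>
  define kp where "kp e = (case prod_decode e of (t, l) \<Rightarrow> if l < length (ps t) then ps t ! l else (1, \<lambda>_. 0))" for e
  define k where "k e = fst (kp e)" for e
  define p where "p e = snd (kp e)" for e
  have kp_props: "1 \<le> k e \<and> p e \<in> hompoly (k e)" for e
  proof (cases "prod_decode e")
    case (Pair t l)
    show ?thesis
    proof (cases "l < length (ps t)")
      case True
      then have "ps t ! l \<in> set (ps t)" by simp
      then show ?thesis using ps[of t] True Pair by (auto simp: k_def p_def kp_def split_beta)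
    next
      case False
      then show ?thesis using Pair hompoly_0 by (simp add: k_def p_def kp_def)
    qed
  qed
  obtain j where j: "\<And>e. 1 \<le> j e" "strict_mono (\<lambda>e. j e * k e)"
    using degree_sequence[of k] kp_props by metis
  have inj: "inj (\<lambda>e. j e * k e)" using j(2) by (rule strict_mono_imp_inj_on)
  obtain f where f: "\<And>e x. fps_nth (slice f x) (j e * k e) = p e x ^ j e"
    "\<And>n x. n \<notin> range (\<lambda>e. j e * k e) \<Longrightarrow> fps_nth (slice f x) n = 0"
    by (rule series_with_homogeneous_parts[OF inj, of "\<lambda>e x. p e x ^ j e"])
      (use kp_props hompoly_power in auto)
  have Conv: "proj x \<in> Conv f \<longleftrightarrow> (\<exists>B\<ge>0. \<forall>e. norm (p e x) \<le> B ^ k e)" if "x \<noteq> 0" for x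
  proof -
    have iff: "norm (fps_nth (slice f x) (j e * k e)) \<le> B ^ (j e * k e) \<longleftrightarrow> norm (p e x) \<le> B ^ k e" if "0 \<le> B" for B e
    proof -
      have "B ^ (j e * k e) = (B ^ k e) ^ j e" by (simp add: power_mult[symmetric] mult.commute)
      then show ?thesis
        using that j(1)[of e] by (simp add: f(1) norm_power power_mono_iff)
    qed
    have "(\<forall>n\<ge>1. norm (fps_nth (slice f x) n) \<le> B ^ n) \<longleftrightarrow> (\<forall>e. norm (p e x) \<le> B ^ k e)" if B: "0 \<le> B" for B
    proof
      assume *: "\<forall>n\<ge>1. norm (fps_nth (slice f x) n) \<le> B ^ n"
      show "\<forall>e. norm (p e x) \<le> B ^ k e"
      proof
        fix e
        have "1 * 1 \<le> j e * k e" using j(1) kp_props by (intro mult_mono) auto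
        then have "norm (fps_nth (slice f x) (j e * k e)) \<le> B ^ (j e * k e)"
          using *[rule_format, of "j e * k e"] by simp
        then show "norm (p e x) \<le> B ^ k e" using iff[OF B] by blast
      qed
    next
      assume *: "\<forall>e. norm (p e x) \<le> B ^ k e"
      show "\<forall>n\<ge>1. norm (fps_nth (slice f x) n) \<le> B ^ n"
      proof (intro allI impI)
        fix n
        show "norm (fps_nth (slice f x) n) \<le> B ^ n"
        proof (cases "n \<in> range (\<lambda>e. j e * k e)")
          case True
          then show ?thesis using * iff[OF B] by auto
        qed (use f(2) B in simp)
      qed
    qed
    then show ?thesis using Conv_iff[OF that, of f] by blast
  qed
  have sub: "graph_proj \<psi> z \<in> Conv f" if z: "z \<in> (\<Union>i. L i)" for z
  proof -
    obtain t0 where t0: "z \<in> stage L t0" using in_some_stage[OF L z] .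
    define I where "I = prod_encode ` (SIGMA t:{..<t0}. {..<length (ps t)})"
    have "finite I" unfolding I_def by (intro finite_imageI finite_SigmaI) auto
    define B where "B = Max (insert 1 ((\<lambda>e. norm (p e (graph_point \<psi> z))) ` I))"
    have B: "1 \<le> B" "\<And>e. e \<in> I \<Longrightarrow> norm (p e (graph_point \<psi> z)) \<le> B"
      using \<open>finite I\<close> by (auto simp: B_def)
    have "norm (p e (graph_point \<psi> z)) \<le> B" for e
    proof (cases "prod_decode e")
      case (Pair t l)
      then have e: "e = prod_encode (t, l)" by (metis prod_decode_inverse)
      show ?thesis
      proof (cases "l < length (ps t)")
        case True
        show ?thesis
        proof (cases "t < t0")
          case True
          then have "e \<in> I" using e \<open>l < length (ps t)\<close> by (auto simp: I_def)
          then show ?thesis by (rule B(2))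
        next
          case False
          then have "z \<in> stage L t" using t0 stage_mono[of t0 t L] by auto
          moreover have "ps t ! l \<in> set (ps t)" using \<open>l < length (ps t)\<close> by simp
          ultimately have "norm (p e (graph_point \<psi> z)) \<le> 1"
            using ps[of t] \<open>l < length (ps t)\<close> Pair by (auto simp: p_def kp_def split_beta)
          then show ?thesis using B(1) by simp
        qed
      next
        case False
        then show ?thesis using B(1) Pair by (simp add: p_def kp_def)
      qed
    qed
    moreover have "B \<le> B ^ k e" for e using B(1) kp_props[of e] by (intro self_le_power) auto
    ultimately have "\<forall>e. norm (p e (graph_point \<psi> z)) \<le> B ^ k e" by (meson order_trans)
    then show ?thesis
      unfolding graph_proj_def using B(1) by (subst Conv) (auto intro!: exI[of _ B])
  qed
  have sup: "Z \<in> graph_proj \<psi> ` (\<Union>i. L i)" if Z: "Z \<in> Conv f" for Z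
  proof (rule ccontr)
    assume Zn: "Z \<notin> graph_proj \<psi> ` (\<Union>i. L i)"
    obtain x where x1: "norm x = 1" and xZ: "proj x = Z" using unit_representative by blast
    have x0: "x \<noteq> 0" using x1 by auto
    from xZ obtain B where B: "0 \<le> B" "\<And>e. norm (p e x) \<le> B ^ k e"
      using Conv[OF x0] Z by auto
    have far: "\<exists>t\<ge>t0. x \<notin> graph_nbhd \<psi> (fill (stage L t)) (1 / (2 * real (t + 2)))" for t0
    proof (rule ccontr)
      assume "\<not> ?thesis"
      then have near: "x \<in> graph_nbhd \<psi> (fill (stage L t)) (1 / (2 * real (t + 2)))" if "t0 \<le> t" for t
        using that by blast
      define z where "z = x $ 2 / x $ 1"
      have x1': "x $ 1 \<noteq> 0" using near[OF order_refl] by (simp add: graph_nbhd_def)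
      have "norm (x $ 3 / x $ 1 - \<psi> z) = 0"
      proof (rule ccontr)
        assume "norm (x $ 3 / x $ 1 - \<psi> z) \<noteq> 0"
        then have "0 < norm (x $ 3 / x $ 1 - \<psi> z)" by simp
        then obtain n where n: "1 / real (Suc n) < norm (x $ 3 / x $ 1 - \<psi> z)"
          by (rule nat_approx_posE)
        have "norm (x $ 3 / x $ 1 - \<psi> z) < 1 / (2 * real (t0 + n + 2))"
          using near[of "t0 + n"] by (simp add: graph_nbhd_def z_def)
        also have "\<dots> \<le> 1 / real (Suc n)" by (intro divide_left_mono) auto
        finally show False using n by simp
      qed
      then have "x = x $ 1 *s graph_point \<psi> z"
        using x1' by (simp add: vec_eq_iff forall_3 z_def field_simps)
      from proj_eq_graph_proj[OF x0 this] have "Z = graph_proj \<psi> z" using xZ by simp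
      then have "z \<notin> (\<Union>i. L i)" using Zn by blast
      from frequently_far_from_stage[OF L fillL this, of t0] obtain t where
        "t0 \<le> t" "\<forall>y\<in>fill (stage L t). 1 / (2 * real (t + 2)) \<le> dist z y" by blast
      then show False using near[of t] by (force simp: graph_nbhd_def z_def)
    qed
    obtain t0 :: nat where t0: "B \<le> real t0" using real_arch_simple by blast
    obtain t where t: "t0 \<le> t" "x \<notin> graph_nbhd \<psi> (fill (stage L t)) (1 / (2 * real (t + 2)))"
      using far by blast
    obtain k' p' where kp': "(k', p') \<in> set (ps t)" "real t ^ k' < norm (p' x)"
      using big[OF x1 t(2)] by blast
    then obtain l where l: "l < length (ps t)" "ps t ! l = (k', p')" by (metis in_set_conv_nth)
    define e where "e = prod_encode (t, l)"
    have "k e = k'" "p e = p'" using l by (simp_all add: e_def k_def p_def kp_def)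
    then have "real t ^ k' < B ^ k'" using kp'(2) B(2)[of e] by simp
    moreover have "B ^ k' \<le> real t ^ k'" using B(1) t0 t(1) by (intro power_mono) auto
    ultimately show False by simp
  qed
  have "Conv f = graph_proj \<psi> ` (\<Union>i. L i)" using sub sup by auto
  moreover have "\<not> convergent3 f"
  proof
    assume "convergent3 f"
    \<comment> \<open>The point \<open>[0 : 0 : 1]\<close> is at infinity.\<close>
    then have "proj (axis 3 1) \<in> Conv f" by (simp add: convergent3_imp_Conv)
    then obtain z where "proj (axis 3 1) = proj (graph_point \<psi> z)" using sup by (force simp: graph_proj_def)
    moreover have "(axis 3 1 :: complex ^ 3) \<noteq> 0" by (simp add: axis_eq_0_iff)
    ultimately obtain c where c: "c \<noteq> 0" "graph_point \<psi> z = c *s axis 3 1"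
      using proj_eq_iff[of "axis 3 1" "graph_point \<psi> z"] by auto
    from arg_cong[OF c(2), of "\<lambda>v. v $ 1"] show False by (simp add: axis_def)
  qed
  ultimately show ?thesis unfolding convergence_set_def by blast
qed

theorem theorem5p8:
  fixes \<psi> :: "complex \<Rightarrow> complex" and E :: "cp2 set"
  assumes "\<psi> holomorphic_on UNIV"
    and "\<not> (\<exists>q :: complex poly. \<forall>z. \<psi> z = poly q z)"
    and "E \<subseteq> {proj (vector [1, z, \<psi> z]) | z. z \<in> UNIV}"
  shows "convergence_set E \<longleftrightarrow>
    (\<exists>F :: nat \<Rightarrow> cp2 set. (\<forall>j. compact (F j) \<and> projectively_convex (F j)) \<and> E = (\<Union>j. F j))"
proof
  have range: "{proj (vector [1, z, \<psi> z]) | z. z \<in> UNIV} = range (graph_proj \<psi>)"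
    by (auto simp: graph_proj_def graph_point_def)
  show "\<exists>F :: nat \<Rightarrow> cp2 set. (\<forall>j. compact (F j) \<and> projectively_convex (F j)) \<and> E = (\<Union>j. F j)"
    if E: "convergence_set E"
  proof -
    obtain f where "E = Conv f" using E unfolding convergence_set_def by blast
    then show ?thesis using convergence_set_imp_union[OF assms(1,2), of f] assms(3)[unfolded range] by simp
  qed
  assume "\<exists>F :: nat \<Rightarrow> cp2 set. (\<forall>j. compact (F j) \<and> projectively_convex (F j)) \<and> E = (\<Union>j. F j)"
  then obtain F :: "nat \<Rightarrow> cp2 set" where
    "(\<forall>j. compact (F j) \<and> projectively_convex (F j)) \<and> E = (\<Union>j. F j)" ..
  then have F: "\<And>j. compact (F j)" "\<And>j. projectively_convex (F j)" and E: "E = (\<Union>j. F j)"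
    by simp_all
  have "\<exists>L. compact L \<and> F j = graph_proj \<psi> ` L" for j
  proof -
    have "F j \<subseteq> range (graph_proj \<psi>)" using assms(3) unfolding range E by blast
    then show ?thesis by (rule compact_subset_graph[OF F(1)]) blast
  qed
  then obtain L where L: "\<And>j. compact (L j)" "\<And>j. F j = graph_proj \<psi> ` L j" by metis
  have inj: "inj (graph_proj \<psi>)"
  proof (rule injI)
    fix z w assume "graph_proj \<psi> z = graph_proj \<psi> w"
    then obtain c where "graph_point \<psi> w = c *s graph_point \<psi> z"
      using proj_eq_iff[of "graph_point \<psi> z" "graph_point \<psi> w"] by (auto simp: graph_proj_def)
    then have "graph_point \<psi> w $ 1 = c * graph_point \<psi> z $ 1" "graph_point \<psi> w $ 2 = c * graph_point \<psi> z $ 2"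
      by simp_all
    then show "z = w" by simp
  qed
  have "fill (L j) = L j" for j
  proof -
    have "graph_proj \<psi> ` fill (L j) = graph_proj \<psi> ` L j"
      using projective_hull_graph[OF assms(1,2) L(1)] F(2)[of j] L(2)[of j]
      unfolding projectively_convex_def by metis
    then show ?thesis using inj by (simp add: inj_image_eq_iff)
  qed
  from union_imp_convergence_set[OF assms(1,2) L(1) this] show "convergence_set E"
    by (simp add: E L(2) image_UN)
qed

end
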